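(* Let $C$ be a locally convex, locally convex-compact, sober topological cone. Every continuous valuation $\nu$ on $C$ has a unique barycenter $\beta(\nu)$, and the barycenter map $\beta\colon \mathbf V_{\mathrm w} C \to C$ is continuous. Hence $\beta$ is the structure map of a $\mathbf V_{\mathrm w}$-algebra on $C$, and it is the unique $\mathbf V_{\mathrm w}$-algebra structure on $C$ that induces the given cone structure on $C$.
   Context: Order and topology. $\mathbb R_+$ is the set of non-negative reals and $\overline{\mathbb R}_+ = \mathbb R_+\cup\{\infty\}$, with $0\cdot\infty=0$. $\overline{\mathbb R}_+$ carries the Scott topology of its usual order (open sets: $\emptyset$, $\overline{\mathbb R}_+$ and the intervals $]a,\infty]$, $a\in\mathbb R_+$), and $\mathbb R_+$ carries the subspace topology. A lower semicontinuous map on a space $X$ is a continuous map $X\to\overline{\mathbb R}_+$ for this topology. Compactness does not include any separation axiom. A space is sober if every nonempty irreducible closed subset is the closure of a unique point. Cones. A cone is an additive commutative monoid $(C,+,0)$ with an action $(a,x)\mapsto a\cdot x$ of the semiring $\mathbb R_+$, satisfying $0\cdot x=0$, $(ab)\cdot x=a\cdot(b\cdot x)$, $1\cdot x=x$, $a\cdot 0=0$, $a\cdot(x+y)=a\cdot x+a\cdot y$, $(a+b)\cdot x=a\cdot x+b\cdot x$. A topological cone is a cone with a $T_0$ topology making addition $C\times C\to C$ and scalar multiplication $\mathbb R_+\times C\to C$ jointly continuous (where $\mathbb R_+$ has the subspace topology induced by the Scott topology on $\overline{\mathbb R}_+$). A subset $A$ of $C$ is convex if $ax+(1-a)y\in A$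 for all $x,y\in A$, $a\in[0,1]$. $C$ is locally convex if every point has a neighborhood base of convex open sets, and locally convex-compact if every point has a neighborhood base of convex compact (not necessarily open) neighborhoods. $C^*$ is the set of linear lower semicontinuous maps $\Lambda\colon C\to\overline{\mathbb R}_+$, where linear means preserving sums and scalar products. Valuations. A continuous valuation $\nu$ on a space $X$ is a map from the lattice of open subsets of $X$ to $\overline{\mathbb R}_+$ with $\nu(\emptyset)=0$, $\nu(U\cup V)+\nu(U\cap V)=\nu(U)+\nu(V)$ for all open $U,V$, and which is Scott-continuous (monotone, and preserving suprema of directed families of open sets). The integral of a lower semicontinuous $h\colon X\to\overline{\mathbb R}_+$ is $\int_{x\in X} h(x)\,d\nu=\int_0^\infty \nu(h^{-1}(]t,\infty]))\,dt$. $\mathbf V_{\mathrm w}X$ is the set of all continuous valuations on $X$ with the weak topology, i.e. the one with subbasic open sets $\{\nu\mid \nu(U)>r\}$, $U$ open in $X$, $r\in\mathbb R_+$. $\mathbf V_{\mathrm w}X$ is a cone under pointwise operations. $\delta_x$ is the Dirac valuation: $\delta_x(U)=1$ if $x\in U$, and $0$ otherwise. For continuous $f\colon X\to Y$, $\mathbf V_{\mathrm w}f(\nu)(V)=\nu(f^{-1}(V))$. $\mathbf V_{\mathrm w}$ is a monad on the category of $T_0$ spaces and continuous maps, with unit $\eta_X(x)=\delta_x$ and multiplication $\mu_X(\varphi)(U)=\int_{\nu\in\mathbf V_{\mathrm w}X}\nu(U)\,d\varphi$ for $\varphi\in\mathbf V_{\mathrm w}\mathbf V_{\mathrm w}X$.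 A $\mathbf V_{\mathrm w}$-algebra on $X$ is an Eilenberg-Moore algebra of this monad, i.e. a continuous map $\alpha\colon\mathbf V_{\mathrm w}X\to X$ with $\alpha\circ\eta_X=\mathrm{id}_X$ and $\alpha\circ\mathbf V_{\mathrm w}\alpha=\alpha\circ\mu_X$. It induces a cone structure on $X$ by $x+y=\alpha(\delta_x+\delta_y)$ and $a\cdot x=\alpha(a\delta_x)$. A barycenter of a continuous valuation $\nu$ on $C$ is a point $x_0\in C$ such that $\Lambda(x_0)=\int_{x\in C}\Lambda(x)\,d\nu$ for every $\Lambda\in C^*$. *)

theory Defs
  imports "HOL-Analysis.Analysis"
begin

section \<open>Scott topology and lower semicontinuity\<close>

definition scott_ennreal :: "ennreal topology" where
  "scott_ennreal =
     topology (\<lambda>U. U = {} \<or> U = UNIV \<or> (\<exists>a::real. 0 \<le> a \<and> U = {ennreal a<..}))"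

lemma scott_open_iff:
  "(U = {} \<or> U = UNIV \<or> (\<exists>a::real. 0 \<le> a \<and> U = {ennreal a<..})) \<longleftrightarrow>
     U = UNIV \<or> (\<exists>c::ennreal. U = {c<..})"
proof
  assume "U = {} \<or> U = UNIV \<or> (\<exists>a::real. 0 \<le> a \<and> U = {ennreal a<..})"
  moreover have "{} = {top::ennreal<..}" by auto
  ultimately show "U = UNIV \<or> (\<exists>c::ennreal. U = {c<..})" by blast
next
  assume "U = UNIV \<or> (\<exists>c::ennreal. U = {c<..})"
  moreover have "U = {} \<or> (\<exists>a::real. 0 \<le> a \<and> U = {ennreal a<..})" if "U = {c<..}" for c
    using that by (cases c) auto
  ultimately show "U = {} \<or> U = UNIV \<or> (\<exists>a::real. 0 \<le> a \<and> U = {ennreal a<..})" by blast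
qed

lemma openin_scott_ennreal:
  "openin scott_ennreal U \<longleftrightarrow>
     U = {} \<or> U = UNIV \<or> (\<exists>a::real. 0 \<le> a \<and> U = {ennreal a<..})"
proof -
  have "istopology (\<lambda>U. U = UNIV \<or> (\<exists>c::ennreal. U = {c<..}))"
    unfolding istopology_def
  proof (intro conjI allI impI)
    fix S T :: "ennreal set"
    assume "S = UNIV \<or> (\<exists>c. S = {c<..})" "T = UNIV \<or> (\<exists>c. T = {c<..})"
    moreover have "{c<..} \<inter> {d<..} = {max c d<..}" for c d :: ennreal by auto
    ultimately show "S \<inter> T = UNIV \<or> (\<exists>c. S \<inter> T = {c<..})" by auto
  next
    fix \<K> :: "ennreal set set"
    assume K: "\<forall>K\<in>\<K>. K = UNIV \<or> (\<exists>c. K = {c<..})"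
    show "\<Union>\<K> = UNIV \<or> (\<exists>c. \<Union>\<K> = {c<..})"
    proof (cases "UNIV \<in> \<K>")
      case False
      have "\<Union>\<K> = {Inf {c. {c<..} \<in> \<K>}<..}"
      proof (rule set_eqI)
        fix x
        have "x \<in> \<Union>\<K> \<longleftrightarrow> (\<exists>c. {c<..} \<in> \<K> \<and> c < x)"
        proof
          assume "x \<in> \<Union>\<K>"
          then obtain K where "K \<in> \<K>" "x \<in> K" by blast
          moreover from \<open>K \<in> \<K>\<close> False have "K \<noteq> UNIV" by metis
          with bspec[OF K \<open>K \<in> \<K>\<close>] obtain c where "K = {c<..}" by metis
          ultimately show "\<exists>c. {c<..} \<in> \<K> \<and> c < x" by auto
        next
          assume "\<exists>c. {c<..} \<in> \<K> \<and> c < x"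
          then show "x \<in> \<Union>\<K>" by auto
        qed
        then show "x \<in> \<Union>\<K> \<longleftrightarrow> x \<in> {Inf {c. {c<..} \<in> \<K>}<..}"
          by (simp add: Inf_less_iff)
      qed
      then show ?thesis by blast
    qed auto
  qed
  from topology_inverse'[OF this] show ?thesis
    unfolding scott_ennreal_def scott_open_iff by (rule fun_cong)
qed

lemma topspace_scott_ennreal [simp]: "topspace scott_ennreal = UNIV"
  unfolding topspace_def openin_scott_ennreal by blast

text \<open>The non-negative reals with the subspace topology inherited from \<open>scott_ennreal\<close>.\<close>

definition scott_nonneg :: "real topology" where
  "scott_nonneg = pullback_topology {0..} ennreal scott_ennreal"

definition lsc :: "('a::topological_space \<Rightarrow> ennreal) \<Rightarrow> bool" where
  "lsc h \<longleftrightarrow> continuous_map euclidean scott_ennreal h"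

lemma lsc_iff: "lsc h \<longleftrightarrow> (\<forall>c. open {x. c < h x})"
proof
  assume L: "lsc h"
  show "\<forall>c. open {x. c < h x}"
  proof
    fix c
    have "openin scott_ennreal {c<..}"
      unfolding openin_scott_ennreal scott_open_iff
      by (rule disjI2, rule exI[of _ c], rule refl)
    then have "openin euclidean {x \<in> topspace euclidean. h x \<in> {c<..}}"
      using L unfolding lsc_def by (rule openin_continuous_map_preimage[rotated])
    then show "open {x. c < h x}" by simp
  qed
next
  assume L: "\<forall>c. open {x. c < h x}"
  have "open {x. h x \<in> U}" if "openin scott_ennreal U" for U
    using that unfolding openin_scott_ennreal
  proof (elim disjE exE conjE)
    fix a :: real assume "U = {ennreal a<..}"
    then show ?thesis using L by simp
  qed simp_all
  then show "lsc h"
    by (simp add: lsc_def continuous_map_def)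
qed

section \<open>Topological cones\<close>

text \<open>Scalars are the non-negative reals, rendered as reals with guards \<open>0 \<le> a\<close>; the values of
  \<open>cscale\<close> at negative scalars are irrelevant throughout.\<close>

class abstract_cone = comm_monoid_add +
  fixes cscale :: "real \<Rightarrow> 'a \<Rightarrow> 'a"  (infixr \<open>\<cdot>\<close> 75)
  assumes cscale_zero_left: "0 \<cdot> x = 0"
    and cscale_cscale: "0 \<le> a \<Longrightarrow> 0 \<le> b \<Longrightarrow> (a * b) \<cdot> x = a \<cdot> (b \<cdot> x)"
    and cscale_one: "1 \<cdot> x = x"
    and cscale_zero_right: "0 \<le> a \<Longrightarrow> a \<cdot> 0 = 0"
    and cscale_add_right: "0 \<le> a \<Longrightarrow> a \<cdot> (x + y) = a \<cdot> x + a \<cdot> y"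
    and cscale_add_left: "0 \<le> a \<Longrightarrow> 0 \<le> b \<Longrightarrow> (a + b) \<cdot> x = a \<cdot> x + b \<cdot> x"

text \<open>Joint continuity of addition is part of \<open>topological_comm_monoid_add\<close>. The term
  \<open>topology open\<close> is what \<open>euclidean\<close> abbreviates on a topological space; the latter cannot be used
  inside a class specification.\<close>

class topological_cone = t0_space + topological_comm_monoid_add + abstract_cone +
  assumes continuous_cscale:
    "continuous_map (prod_topology scott_nonneg (topology open)) (topology open)
       (\<lambda>(a, x). a \<cdot> x)"

definition cone_convex :: "'a::abstract_cone set \<Rightarrow> bool" where
  "cone_convex A \<longleftrightarrow> (\<forall>x\<in>A. \<forall>y\<in>A. \<forall>a\<in>{0..1}. a \<cdot> x + (1 - a) \<cdot> y \<in> A)"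

definition locally_convex :: "'a::topological_cone itself \<Rightarrow> bool" where
  "locally_convex _ \<longleftrightarrow>
     neighbourhood_base_of (\<lambda>A. open A \<and> cone_convex A) (euclidean :: 'a topology)"

definition locally_convex_compact :: "'a::topological_cone itself \<Rightarrow> bool" where
  "locally_convex_compact _ \<longleftrightarrow>
     neighbourhood_base_of (\<lambda>A. compact A \<and> cone_convex A) (euclidean :: 'a topology)"

definition irreducible_closed :: "'a::topological_space set \<Rightarrow> bool" where
  "irreducible_closed F \<longleftrightarrow>
     closed F \<and> F \<noteq> {} \<and>
     (\<forall>A B. closed A \<longrightarrow> closed B \<longrightarrow> F \<subseteq> A \<union> B \<longrightarrow> F \<subseteq> A \<or> F \<subseteq> B)"

definition sober :: "'a::topological_space itself \<Rightarrow> bool" where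
  "sober _ \<longleftrightarrow> (\<forall>F::'a set. irreducible_closed F \<longrightarrow> (\<exists>!x. F = closure {x}))"

definition cone_dual :: "('a::topological_cone \<Rightarrow> ennreal) set" where
  "cone_dual = {\<Lambda>. lsc \<Lambda> \<and> (\<forall>x y. \<Lambda> (x + y) = \<Lambda> x + \<Lambda> y) \<and>
                  (\<forall>a\<ge>0. \<forall>x. \<Lambda> (a \<cdot> x) = ennreal a * \<Lambda> x)}"

section \<open>Continuous valuations\<close>

definition directed_opens :: "'a::topological_space set set \<Rightarrow> bool" where
  "directed_opens D \<longleftrightarrow>
     D \<noteq> {} \<and> (\<forall>U\<in>D. open U) \<and> (\<forall>U\<in>D. \<forall>V\<in>D. \<exists>W\<in>D. U \<subseteq> W \<and> V \<subseteq> W)"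

definition continuous_valuation :: "('a::topological_space set \<Rightarrow> ennreal) \<Rightarrow> bool" where
  "continuous_valuation \<nu> \<longleftrightarrow>
     \<nu> {} = 0 \<and>
     (\<forall>U V. open U \<longrightarrow> open V \<longrightarrow> \<nu> (U \<union> V) + \<nu> (U \<inter> V) = \<nu> U + \<nu> V) \<and>
     (\<forall>U V. open U \<longrightarrow> open V \<longrightarrow> U \<subseteq> V \<longrightarrow> \<nu> U \<le> \<nu> V) \<and>
     (\<forall>D. directed_opens D \<longrightarrow> \<nu> (\<Union>D) = (SUP U\<in>D. \<nu> U))"

text \<open>Valuations are only defined on open sets; as functions on all sets they are normalised to
  \<open>0\<close> off the open sets, so that equality of valuations is equality on open sets.\<close>

typedef (overloaded) 'a valuation =
  "{\<nu> :: 'a::topological_space set \<Rightarrow> ennreal.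
      continuous_valuation \<nu> \<and> (\<forall>U. \<not> open U \<longrightarrow> \<nu> U = 0)}"
  morphisms val Abs_valuation
proof
  have "(SUP U\<in>D. 0) = (0::ennreal)" if "directed_opens D" for D :: "'a set set"
    using that unfolding directed_opens_def by (intro SUP_const) (elim conjE)
  then show "(\<lambda>_. 0) \<in> {\<nu> :: 'a set \<Rightarrow> ennreal.
      continuous_valuation \<nu> \<and> (\<forall>U. \<not> open U \<longrightarrow> \<nu> U = 0)}"
    by (simp add: continuous_valuation_def)
qed

setup_lifting type_definition_valuation

lemma continuous_valuation_val: "continuous_valuation (val \<nu>)"
  using val[of \<nu>] by simp

lemma val_not_open: "\<not> open U \<Longrightarrow> val \<nu> U = 0"
  using val[of \<nu>] by simp

lemma val_empty [simp]: "val \<nu> {} = 0"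
  using continuous_valuation_val[of \<nu>] by (simp add: continuous_valuation_def)

lemma val_modular:
  "open U \<Longrightarrow> open V \<Longrightarrow> val \<nu> (U \<union> V) + val \<nu> (U \<inter> V) = val \<nu> U + val \<nu> V"
  using continuous_valuation_val[of \<nu>] by (simp add: continuous_valuation_def)

lemma val_mono: "open U \<Longrightarrow> open V \<Longrightarrow> U \<subseteq> V \<Longrightarrow> val \<nu> U \<le> val \<nu> V"
  using continuous_valuation_val[of \<nu>] by (simp add: continuous_valuation_def)

lemma val_Union_directed: "directed_opens D \<Longrightarrow> val \<nu> (\<Union>D) = (SUP U\<in>D. val \<nu> U)"
  using continuous_valuation_val[of \<nu>] by (simp add: continuous_valuation_def)

lemma val_SUP_directed:
  assumes "I \<noteq> {}" "\<And>i. i \<in> I \<Longrightarrow> open (U i)"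
    and "\<And>i j. i \<in> I \<Longrightarrow> j \<in> I \<Longrightarrow> \<exists>k\<in>I. U i \<subseteq> U k \<and> U j \<subseteq> U k"
  shows "val \<nu> (\<Union>i\<in>I. U i) = (SUP i\<in>I. val \<nu> (U i))"
proof -
  have "directed_opens (U ` I)" using assms by (fastforce simp: directed_opens_def)
  from val_Union_directed[OF this] show ?thesis by (simp add: image_image)
qed

lemma valuation_eqI:
  assumes "\<And>U. open U \<Longrightarrow> val \<nu> U = val \<mu> U"
  shows "\<nu> = \<mu>"
proof -
  have "val \<nu> = val \<mu>"
  proof
    fix U show "val \<nu> U = val \<mu> U"
      using assms[of U] val_not_open[of U \<nu>] val_not_open[of U \<mu>] by (cases "open U") metis+
  qed
  then show ?thesis by (simp add: val_inject)
qed

instantiation valuation :: (topological_space) topological_space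
begin

definition open_valuation_def:
  "open = generate_topology {{\<nu> :: 'a valuation. ennreal r < val \<nu> U} | r U. 0 \<le> r \<and> open U}"

instance
  by intro_classes (auto simp: open_valuation_def intro: generate_topology.intros)

end

lemma open_val_greater:
  fixes U :: "'a::topological_space set"
  assumes U: "open U"
  shows "open {\<nu>. c < val \<nu> U}"
proof (cases c)
  case (real r)
  have "{\<nu>. ennreal r < val \<nu> U} \<in> {{\<nu> :: 'a valuation. ennreal r < val \<nu> U} | r U. 0 \<le> r \<and> open U}"
    using U real by blast
  then show ?thesis
    unfolding open_valuation_def real by (rule generate_topology.Basis)
qed simp

lemma lsc_val: "open U \<Longrightarrow> lsc (\<lambda>\<nu>. val \<nu> U)"
  by (simp add: lsc_iff open_val_greater)

instance valuation :: (topological_space) t0_space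
proof
  fix \<nu> \<mu> :: "'a valuation"
  assume "\<nu> \<noteq> \<mu>"
  then obtain U where U: "open U" "val \<nu> U \<noteq> val \<mu> U" using valuation_eqI by blast
  show "\<exists>W. open W \<and> \<not> (\<nu> \<in> W \<longleftrightarrow> \<mu> \<in> W)"
  proof (cases "val \<nu> U < val \<mu> U")
    case True
    then show ?thesis
      using open_val_greater[OF U(1), of "val \<nu> U"]
      by (intro exI[of _ "{\<kappa>. val \<nu> U < val \<kappa> U}"]) simp
  next
    case False
    then have "val \<mu> U < val \<nu> U" using U(2) by auto
    then show ?thesis
      using open_val_greater[OF U(1), of "val \<mu> U"]
      by (intro exI[of _ "{\<kappa>. val \<mu> U < val \<kappa> U}"]) simp
  qed
qed

text \<open>Choquet-style integral; the integrand is antitone in \<open>t\<close>, hence Borel measurable, when \<open>h\<close> is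
  lower semicontinuous.\<close>

definition val_integral :: "'a::topological_space valuation \<Rightarrow> ('a \<Rightarrow> ennreal) \<Rightarrow> ennreal" where
  "val_integral \<nu> h = (\<integral>\<^sup>+ t \<in> {0<..}. val \<nu> (h -` {ennreal t<..}) \<partial>lborel)"

subsection \<open>The cone of valuations\<close>

instantiation valuation :: (topological_space) abstract_cone
begin

lift_definition zero_valuation :: "'a valuation" is "\<lambda>_. 0"
  by (auto simp: continuous_valuation_def directed_opens_def)

lift_definition plus_valuation :: "'a valuation \<Rightarrow> 'a valuation \<Rightarrow> 'a valuation"
  is "\<lambda>\<nu> \<mu> U. \<nu> U + \<mu> U"
proof (intro conjI allI impI)
  fix \<nu> \<mu> :: "'a set \<Rightarrow> ennreal"
  assume "continuous_valuation \<nu> \<and> (\<forall>U. \<not> open U \<longrightarrow> \<nu> U = 0)"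
     and "continuous_valuation \<mu> \<and> (\<forall>U. \<not> open U \<longrightarrow> \<mu> U = 0)"
  then have c: "continuous_valuation \<nu>" "continuous_valuation \<mu>" by auto
  show "continuous_valuation (\<lambda>U. \<nu> U + \<mu> U)"
    unfolding continuous_valuation_def
  proof (intro conjI allI impI)
    fix U V :: "'a set" assume "open U" "open V"
    then have "\<nu> (U \<union> V) + \<nu> (U \<inter> V) = \<nu> U + \<nu> V" "\<mu> (U \<union> V) + \<mu> (U \<inter> V) = \<mu> U + \<mu> V"
      using c by (simp_all add: continuous_valuation_def)
    then have "(\<nu> (U \<union> V) + \<nu> (U \<inter> V)) + (\<mu> (U \<union> V) + \<mu> (U \<inter> V)) =
        (\<nu> U + \<nu> V) + (\<mu> U + \<mu> V)" by (simp only:)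
    then show "\<nu> (U \<union> V) + \<mu> (U \<union> V) + (\<nu> (U \<inter> V) + \<mu> (U \<inter> V)) = \<nu> U + \<mu> U + (\<nu> V + \<mu> V)"
      by (simp only: ac_simps)
  next
    fix D :: "'a set set" assume D: "directed_opens D"
    have "(SUP U\<in>D. \<nu> U) + (SUP U\<in>D. \<mu> U) = (SUP U\<in>D. \<nu> U + \<mu> U)"
    proof (rule SUP_add_directed_ennreal[symmetric])
      fix U V assume "U \<in> D" "V \<in> D"
      then obtain W where W: "W \<in> D" "U \<subseteq> W" "V \<subseteq> W" using D by (meson directed_opens_def)
      moreover have "open U" "open V" "open W"
        using D \<open>U \<in> D\<close> \<open>V \<in> D\<close> W by (auto simp: directed_opens_def)
      ultimately show "\<exists>W\<in>D. \<nu> U + \<mu> V \<le> \<nu> W + \<mu> W"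
        using c by (intro bexI[of _ W]) (auto simp: continuous_valuation_def intro!: add_mono)
    qed
    then show "\<nu> (\<Union>D) + \<mu> (\<Union>D) = (SUP U\<in>D. \<nu> U + \<mu> U)"
      using c D by (simp add: continuous_valuation_def)
  qed (use c in \<open>auto simp: continuous_valuation_def intro!: add_mono\<close>)
qed auto

lift_definition cscale_valuation :: "real \<Rightarrow> 'a valuation \<Rightarrow> 'a valuation"
  is "\<lambda>a \<nu> U. ennreal a * \<nu> U"
  by (auto simp: continuous_valuation_def SUP_mult_left_ennreal intro!: mult_left_mono
      simp flip: distrib_left)

instance
proof
  fix a b :: real and \<nu> \<mu> \<kappa> :: "'a valuation"
  show "\<nu> + \<mu> + \<kappa> = \<nu> + (\<mu> + \<kappa>)" by transfer (simp add: add.assoc)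
  show "\<nu> + \<mu> = \<mu> + \<nu>" by transfer (simp add: add.commute)
  show "0 + \<nu> = \<nu>" by transfer simp
  show "0 \<cdot> \<nu> = 0" by transfer simp
  show "1 \<cdot> \<nu> = \<nu>" by transfer simp
  show "(a * b) \<cdot> \<nu> = a \<cdot> (b \<cdot> \<nu>)" if "0 \<le> a" "0 \<le> b"
    using that by transfer (simp add: ennreal_mult mult.assoc)
  show "a \<cdot> (0 :: 'a valuation) = 0" if "0 \<le> a" by transfer simp
  show "a \<cdot> (\<nu> + \<mu>) = a \<cdot> \<nu> + a \<cdot> \<mu>" if "0 \<le> a"
    by transfer (simp add: distrib_left)
  show "(a + b) \<cdot> \<nu> = a \<cdot> \<nu> + b \<cdot> \<nu>" if "0 \<le> a" "0 \<le> b"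
    using that by transfer (simp add: distrib_right)
qed

end

subsection \<open>Basic properties of the integral\<close>

text \<open>These are needed to see that the multiplication of the monad is well defined.\<close>

lemma lsc_open: "lsc h \<Longrightarrow> open (h -` {c<..})"
  by (simp add: lsc_iff vimage_def)

lemma lsc_sum_of_bool:
  fixes U :: "nat \<Rightarrow> 'a::topological_space set"
  assumes "\<And>k. k < m \<Longrightarrow> open (U k)"
  shows "open {x. j \<le> (\<Sum>k<m. of_bool (x \<in> U k) :: nat)}"
  using assms
proof (induction m arbitrary: j)
  case 0
  then show ?case by simp
next
  case (Suc m)
  note IH = Suc.IH and prems = Suc.prems
  show ?case
  proof (cases j)
    case (Suc i)
    have "{x. Suc i \<le> (\<Sum>k<Suc m. of_bool (x \<in> U k) :: nat)} =
        {x. Suc i \<le> (\<Sum>k<m. of_bool (x \<in> U k) :: nat)} \<union>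
        ({x. i \<le> (\<Sum>k<m. of_bool (x \<in> U k) :: nat)} \<inter> U m)"
      by (auto simp: of_bool_def)
    moreover have "open \<dots>"
      using IH[of "Suc i"] IH[of i] prems by (intro open_Un open_Int) simp_all
    ultimately show ?thesis using Suc by simp
  qed simp
qed

lemma val_sum_levels:
  fixes U :: "nat \<Rightarrow> 'a::topological_space set"
  assumes "\<And>k. k < m \<Longrightarrow> open (U k)"
  shows "(\<Sum>j<m. val \<nu> {x. Suc j \<le> (\<Sum>k<m. of_bool (x \<in> U k) :: nat)}) = (\<Sum>k<m. val \<nu> (U k))"
  using assms
proof (induction m)
  case 0
  then show ?case by simp
next
  case (Suc m)
  define B where "B j = {x. j \<le> (\<Sum>k<m. of_bool (x \<in> U k) :: nat)}" for j
  define B' where "B' j = {x. j \<le> (\<Sum>k<Suc m. of_bool (x \<in> U k) :: nat)}" for j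
  have oB: "open (B j)" for j unfolding B_def by (rule lsc_sum_of_bool) (use Suc.prems in simp)
  have oB': "open (B' j)" for j unfolding B'_def by (rule lsc_sum_of_bool) (use Suc.prems in simp)
  have oU: "open (U m)" using Suc.prems by simp
  have IH: "(\<Sum>j<m. val \<nu> (B (Suc j))) = (\<Sum>k<m. val \<nu> (U k))"
    unfolding B_def by (rule Suc.IH) (use Suc.prems in simp)
  have le: "(\<Sum>k<m. of_bool (x \<in> U k) :: nat) \<le> m" for x
    using sum_bounded_above[of "{..<m}" "\<lambda>k. of_bool (x \<in> U k) :: nat" 1] by simp
  have top: "B (Suc m) = {}"
    unfolding B_def using le by (auto simp: not_less_eq_eq)
  have bot: "B 0 = UNIV" by (simp add: B_def)
  have un: "B' (Suc j) = B (Suc j) \<union> (B j \<inter> U m)" for j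
    unfolding B_def B'_def by (auto simp: of_bool_def)
  have int: "B (Suc j) \<inter> U m = B (Suc j) \<inter> (B j \<inter> U m)" for j
    unfolding B_def by auto
  have mod: "val \<nu> (B' (Suc j)) + val \<nu> (B (Suc j) \<inter> U m) = val \<nu> (B (Suc j)) + val \<nu> (B j \<inter> U m)" for j
    unfolding un int by (rule val_modular) (simp_all add: oB oU open_Int)
  define X where "X = (\<Sum>j<m. val \<nu> (B (Suc j) \<inter> U m))"
  define L where "L = (\<Sum>j<Suc m. val \<nu> (B' (Suc j)))"
  define R where "R = (\<Sum>k<m. val \<nu> (U k))"
  have "L + (\<Sum>j<Suc m. val \<nu> (B (Suc j) \<inter> U m)) =
      (\<Sum>j<Suc m. val \<nu> (B (Suc j))) + (\<Sum>j<Suc m. val \<nu> (B j \<inter> U m))"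
    unfolding L_def sum.distrib[symmetric] by (simp only: mod)
  moreover have "(\<Sum>j<Suc m. val \<nu> (B (Suc j) \<inter> U m)) = X"
    by (simp add: X_def top)
  moreover have "(\<Sum>j<Suc m. val \<nu> (B (Suc j))) = R"
    by (simp add: top IH R_def)
  moreover have "(\<Sum>j<Suc m. val \<nu> (B j \<inter> U m)) = val \<nu> (U m) + X"
    unfolding sum.lessThan_Suc_shift X_def by (simp add: bot)
  ultimately have eq: "L + X = (R + val \<nu> (U m)) + X" by (metis add.assoc)
  have "L = R + val \<nu> (U m)"
  proof (cases "val \<nu> (U m) = top")
    case True
    have "U m \<subseteq> B' (Suc 0)" unfolding un bot by simp
    then have "val \<nu> (U m) \<le> val \<nu> (B' (Suc 0))" by (intro val_mono oU oB')
    also have "\<dots> \<le> L"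
      unfolding L_def by (rule member_le_sum[of 0 _ "\<lambda>j. val \<nu> (B' (Suc j))"]) simp_all
    finally show ?thesis using True by (simp add: top_unique)
  next
    case False
    have l: "val \<nu> (B (Suc j) \<inter> U m) \<le> val \<nu> (U m)" for j
      by (intro val_mono open_Int oB oU) simp
    have "val \<nu> (B (Suc j) \<inter> U m) < top" for j
      using order_le_less_trans[OF l] False by (simp add: less_top)
    then have "X < top" unfolding X_def by simp
    then show ?thesis using eq by (auto simp: less_top)
  qed
  then show ?case unfolding L_def R_def B'_def by simp
qed

lemma borel_measurable_antimono_ennreal:
  fixes g :: "real \<Rightarrow> ennreal"
  assumes "\<And>s t. s \<le> t \<Longrightarrow> g t \<le> g s"
  shows "g \<in> borel_measurable borel"
proof (rule borel_measurableI_greater)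
  fix y
  have "is_interval {t. y < g t}"
    unfolding is_interval_1 using assms by (auto intro: less_le_trans)
  then show "{x \<in> space borel. y < g x} \<in> sets borel"
    by (simp add: real_interval_borel_measurable)
qed

lemma measurable_levels:
  assumes "lsc h"
  shows "(\<lambda>t. val \<nu> (h -` {ennreal t<..})) \<in> borel_measurable borel"
proof (rule borel_measurable_antimono_ennreal)
  fix s t :: real assume "s \<le> t"
  then have "ennreal s \<le> ennreal t" by (rule ennreal_leI)
  then show "val \<nu> (h -` {ennreal t<..}) \<le> val \<nu> (h -` {ennreal s<..})"
    by (intro val_mono lsc_open assms) (auto intro: le_less_trans)
qed

lemma val_integral_SUP:
  fixes h :: "nat \<Rightarrow> 'a::topological_space \<Rightarrow> ennreal"
  assumes lsc: "\<And>n. lsc (h n)" and inc: "\<And>n x. h n x \<le> h (Suc n) x"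
  shows "val_integral \<nu> (\<lambda>x. SUP n. h n x) = (SUP n. val_integral \<nu> (h n))"
proof -
  have mono: "h m x \<le> h n x" if "m \<le> n" for m n x
    using lift_Suc_mono_le[of "\<lambda>n. h n x", OF inc that] .
  have sub: "h m -` {c<..} \<subseteq> h n -` {c<..}" if "m \<le> n" for m n c
    using mono[OF that] by (auto intro: less_le_trans)
  have un: "(\<lambda>x. SUP n. h n x) -` {c<..} = (\<Union>n. h n -` {c<..})" for c
    by (auto simp: less_SUP_iff)
  have lev: "val \<nu> ((\<lambda>x. SUP n. h n x) -` {c<..}) = (SUP n. val \<nu> (h n -` {c<..}))" for c
    unfolding un
  proof (rule val_SUP_directed)
    fix i j :: nat
    show "\<exists>k\<in>UNIV. h i -` {c<..} \<subseteq> h k -` {c<..} \<and> h j -` {c<..} \<subseteq> h k -` {c<..}"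
      using sub[of i "max i j"] sub[of j "max i j"] by (intro bexI[of _ "max i j"]) simp_all
  qed (simp_all add: lsc_open[OF lsc])
  have "(SUP n. val_integral \<nu> (h n)) =
      (\<integral>\<^sup>+ t. (SUP n. val \<nu> (h n -` {ennreal t<..}) * indicator {0<..} t) \<partial>lborel)"
    unfolding val_integral_def
  proof (rule nn_integral_monotone_convergence_SUP[symmetric])
    show "incseq (\<lambda>n t. val \<nu> (h n -` {ennreal t<..}) * indicator {0<..} t)"
      by (intro incseq_SucI le_funI mult_right_mono val_mono lsc_open lsc sub) simp_all
    show "(\<lambda>t. val \<nu> (h n -` {ennreal t<..}) * indicator {0<..} t) \<in> borel_measurable lborel" for n
      using measurable_levels[OF lsc, of \<nu> n] by simp
  qed
  also have "\<dots> = val_integral \<nu> (\<lambda>x. SUP n. h n x)"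
    unfolding val_integral_def lev by (simp add: SUP_mult_right_ennreal)
  finally show ?thesis by simp
qed

lemma val_integral_sum_of_bool:
  fixes U :: "nat \<Rightarrow> 'a::topological_space set"
  assumes U: "\<And>k. k < m \<Longrightarrow> open (U k)" and c: "0 < c"
  shows "val_integral \<nu> (\<lambda>x. ennreal (c * real (\<Sum>k<m. of_bool (x \<in> U k)))) =
    ennreal c * (\<Sum>k<m. val \<nu> (U k))"
proof -
  define N where "N x = (\<Sum>k<m. of_bool (x \<in> U k) :: nat)" for x
  define v where "v j = val \<nu> {x. Suc j \<le> N x}" for j
  have le: "N x \<le> m" for x
    unfolding N_def using sum_bounded_above[of "{..<m}" "\<lambda>k. of_bool (x \<in> U k) :: nat" 1] by simp
  have levels: "(\<Sum>j<m. v j) = (\<Sum>k<m. val \<nu> (U k))"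
    unfolding v_def N_def by (rule val_sum_levels) (rule U)
  have level: "val \<nu> ((\<lambda>x. ennreal (c * real (N x))) -` {ennreal t<..}) * indicator {0<..} t =
      (\<Sum>j<m. v j * indicator {c * real j..<c * real (Suc j)} t)" if "t \<noteq> 0" for t
  proof (cases "0 < t")
    case False
    then have "t < 0" using that by simp
    then have "t < c * real j" for j
      using c by (meson less_le_trans mult_nonneg_nonneg less_imp_le of_nat_0_le_iff)
    then have "indicator {c * real j..<c * real (Suc j)} t = (0::ennreal)" for j
      by (simp add: indicator_def not_le)
    then show ?thesis using False by simp
  next
    case True
    define i where "i = nat \<lfloor>t / c\<rfloor>"
    have i: "c * real i \<le> t" "t < c * real (Suc i)"
    proof -
      have "0 \<le> t / c" using True c by simp
      then have "real i = of_int \<lfloor>t / c\<rfloor>" unfolding i_def by simp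
      then have "real i \<le> t / c" "t / c < real i + 1" by linarith+
      then show "c * real i \<le> t" "t < c * real (Suc i)"
        using c by (simp_all add: field_simps)
    qed
    have iff: "t < c * real n \<longleftrightarrow> Suc i \<le> n" for n
    proof
      assume "t < c * real n"
      then have "c * real i < c * real n" using i by simp
      then show "Suc i \<le> n" using c by simp
    next
      assume "Suc i \<le> n"
      then have "c * real (Suc i) \<le> c * real n"
        using c by (intro mult_left_mono) simp_all
      then show "t < c * real n" using i by simp
    qed
    have ind: "indicator {c * real j..<c * real (Suc j)} t = (of_bool (j = i) :: ennreal)" for j
      using iff[of j] iff[of "Suc j"] by (auto simp: indicator_def not_less[symmetric])
    have "(\<lambda>x. ennreal (c * real (N x))) -` {ennreal t<..} = {x. Suc i \<le> N x}"
      using True by (simp only: set_eq_iff vimage_eq greaterThan_iff mem_Collect_eq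
          ennreal_less_iff[OF less_imp_le] iff simp_thms)
    then have "val \<nu> ((\<lambda>x. ennreal (c * real (N x))) -` {ennreal t<..}) * indicator {0<..} t = v i"
      using True by (simp add: v_def)
    also have "v i = (\<Sum>j<m. v j * of_bool (j = i))"
    proof (cases "i < m")
      case True
      then show ?thesis by (simp add: of_bool_def if_distrib sum.delta cong: if_cong)
    next
      case False
      then have "\<not> Suc i \<le> N x" for x using le[of x] by linarith
      then have "v i = 0" by (simp add: v_def)
      moreover have "(\<Sum>j<m. v j * of_bool (j = i)) = 0"
        using False by (intro sum.neutral) auto
      ultimately show ?thesis by simp
    qed
    finally show ?thesis unfolding ind .
  qed
  have "val_integral \<nu> (\<lambda>x. ennreal (c * real (N x))) =
      (\<integral>\<^sup>+ t. (\<Sum>j<m. v j * indicator {c * real j..<c * real (Suc j)} t) \<partial>lborel)"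
    unfolding val_integral_def
    by (rule nn_integral_cong_AE, rule AE_mp[OF AE_lborel_singleton[of "0::real"]])
       (rule AE_I2, rule impI, rule level)
  also have "\<dots> = (\<Sum>j<m. v j * emeasure lborel {c * real j..<c * real (Suc j)})"
    by (subst nn_integral_sum) (simp_all add: nn_integral_cmult_indicator)
  also have "\<dots> = (\<Sum>j<m. v j * ennreal c)"
    using c by (simp add: algebra_simps)
  also have "\<dots> = ennreal c * (\<Sum>k<m. val \<nu> (U k))"
    unfolding levels[symmetric] sum_distrib_left by (simp add: mult.commute)
  finally show ?thesis by (simp only: N_def)
qed

definition dyadic_count :: "nat \<Rightarrow> ennreal \<Rightarrow> nat" where
  "dyadic_count n y = (\<Sum>k<n * 2 ^ n. of_bool (y \<in> {ennreal (1 / 2 ^ n * real (Suc k))<..}))"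

lemma dyadic_count_Suc: "2 * dyadic_count n y \<le> dyadic_count (Suc n) y"
proof -
  define b where "b k = (of_bool (ennreal (1 / 2 ^ n * real (Suc k)) < y) :: nat)" for k
  define b' where "b' k = (of_bool (ennreal (1 / 2 ^ Suc n * real (Suc k)) < y) :: nat)" for k
  have le: "b k \<le> b' (2 * k)" "b k \<le> b' (Suc (2 * k))" for k
  proof -
    have e: "ennreal (1 / 2 ^ Suc n * real (Suc (2 * k))) \<le> ennreal (1 / 2 ^ n * real (Suc k))"
      "ennreal (1 / 2 ^ Suc n * real (Suc (Suc (2 * k)))) \<le> ennreal (1 / 2 ^ n * real (Suc k))"
      by (intro ennreal_leI; simp add: field_simps)+
    show "b k \<le> b' (2 * k)" "b k \<le> b' (Suc (2 * k))"
      unfolding b_def b'_def of_bool_less_eq_iff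
      using le_less_trans[OF e(1), of y] le_less_trans[OF e(2), of y] by blast+
  qed
  have "2 * (\<Sum>k<m. b k) \<le> (\<Sum>k<2 * m. b' k)" for m
  proof (induction m)
    case (Suc m)
    then show ?case using le[of m] by simp
  qed simp
  from this[of "n * 2 ^ n"] have "2 * dyadic_count n y \<le> (\<Sum>k<2 * (n * 2 ^ n). b' k)"
    by (simp add: dyadic_count_def b_def)
  also have "\<dots> \<le> (\<Sum>k<Suc n * 2 ^ Suc n. b' k)"
    by (rule sum_mono2) auto
  finally show ?thesis by (simp add: dyadic_count_def b'_def)
qed

lemma SUP_dyadic_count: "(SUP n. ennreal (1 / 2 ^ n * real (dyadic_count n y))) = y"
proof (rule antisym)
  show "(SUP n. ennreal (1 / 2 ^ n * real (dyadic_count n y))) \<le> y"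
  proof (rule SUP_least)
    fix n :: nat
    have "ennreal (1 / 2 ^ n * real (\<Sum>k<m. of_bool (y \<in> {ennreal (1 / 2 ^ n * real (Suc k))<..}))) \<le> y" for m
    proof (induction m)
      case (Suc m)
      show ?case
      proof (cases "y \<in> {ennreal (1 / 2 ^ n * real (Suc m))<..}")
        case True
        have "(\<Sum>k<Suc m. of_bool (y \<in> {ennreal (1 / 2 ^ n * real (Suc k))<..}) :: nat) \<le> Suc m"
          using sum_bounded_above[of "{..<Suc m}"
            "\<lambda>k. of_bool (y \<in> {ennreal (1 / 2 ^ n * real (Suc k))<..}) :: nat" 1] by simp
        then have "ennreal (1 / 2 ^ n * real (\<Sum>k<Suc m. of_bool (y \<in> {ennreal (1 / 2 ^ n * real (Suc k))<..})))
            \<le> ennreal (1 / 2 ^ n * real (Suc m))"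
          by (intro ennreal_leI mult_left_mono) (simp_all only: of_nat_le_iff, simp)
        also have "\<dots> \<le> y" using True by simp
        finally show ?thesis .
      next
        case False
        then show ?thesis using Suc by simp
      qed
    qed simp
    then show "ennreal (1 / 2 ^ n * real (dyadic_count n y)) \<le> y"
      unfolding dyadic_count_def .
  qed
next
  show "y \<le> (SUP n. ennreal (1 / 2 ^ n * real (dyadic_count n y)))" (is "_ \<le> ?S")
  proof (rule dense_le)
    fix z assume z: "z < y"
    then obtain r where r: "z = ennreal r" "0 \<le> r" by (cases z) auto
    have key: "ennreal (r - 1 / 2 ^ n) \<le> ?S" if n: "r \<le> real n" for n
    proof -
      define j where "j = nat \<lfloor>r * 2 ^ n\<rfloor>"
      have "real j = of_int \<lfloor>r * 2 ^ n\<rfloor>" using r by (simp add: j_def)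
      then have j: "real j \<le> r * 2 ^ n" "r * 2 ^ n < real j + 1" by linarith+
      have "real j \<le> real (n * 2 ^ n)"
        using j(1) n by (simp add: order_trans[OF _ mult_right_mono[OF n, of "2 ^ n"]])
      then have jn: "j \<le> n * 2 ^ n" by (simp only: of_nat_le_iff)
      have mem: "y \<in> {ennreal (1 / 2 ^ n * real (Suc k))<..}" if "k < j" for k
      proof -
        have "real (Suc k) \<le> real j" using that by simp
        then have "1 / 2 ^ n * real (Suc k) \<le> r" using j(1) by (simp add: field_simps)
        then have "ennreal (1 / 2 ^ n * real (Suc k)) \<le> ennreal r" by (rule ennreal_leI)
        also have "\<dots> < y" using z r by simp
        finally show ?thesis by (simp only: greaterThan_iff)
      qed
      have "j = (\<Sum>k<j. of_bool (y \<in> {ennreal (1 / 2 ^ n * real (Suc k))<..}) :: nat)"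
        using mem by simp
      also have "\<dots> \<le> dyadic_count n y"
        unfolding dyadic_count_def using jn by (intro sum_mono2) auto
      finally have "real j \<le> real (dyadic_count n y)" by simp
      then have "r - 1 / 2 ^ n \<le> 1 / 2 ^ n * real (dyadic_count n y)"
        using j(2) divide_right_mono[of "r * 2 ^ n - 1" "real (dyadic_count n y)" "2 ^ n"]
        by (simp add: diff_divide_distrib)
      then have "ennreal (r - 1 / 2 ^ n) \<le> ennreal (1 / 2 ^ n * real (dyadic_count n y))"
        by (rule ennreal_leI)
      also have "\<dots> \<le> ?S" by (rule SUP_upper) simp
      finally show ?thesis .
    qed
    have "(\<lambda>n. ennreal (r - 1 / 2 ^ n)) \<longlonglongrightarrow> ennreal (r - 0)"
      by (intro tendsto_ennrealI tendsto_diff tendsto_const LIMSEQ_divide_realpow_zero) simp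
    moreover have "\<exists>N. \<forall>n\<ge>N. ennreal (r - 1 / 2 ^ n) \<le> ?S"
    proof (intro exI allI impI)
      fix n assume "nat \<lceil>r\<rceil> \<le> n"
      then show "ennreal (r - 1 / 2 ^ n) \<le> ?S" by (intro key) linarith
    qed
    ultimately have "ennreal (r - 0) \<le> ?S" by (rule LIMSEQ_le_const2)
    then show "z \<le> ?S" using r by simp
  qed
qed

lemma lsc_sum_of_bool_scaled:
  fixes U :: "nat \<Rightarrow> 'a::topological_space set"
  assumes U: "\<And>k. k < m \<Longrightarrow> open (U k)" and c: "0 < c"
  shows "lsc (\<lambda>x. ennreal (c * real (\<Sum>k<m. of_bool (x \<in> U k))))"
  unfolding lsc_iff
proof
  fix d :: ennreal
  show "open {x. d < ennreal (c * real (\<Sum>k<m. of_bool (x \<in> U k)))}"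
  proof (cases d)
    case (real t)
    define i where "i = nat \<lfloor>t / c\<rfloor>"
    have "real i = of_int \<lfloor>t / c\<rfloor>" using c real by (simp add: i_def)
    then have i: "real i \<le> t / c" "t / c < real i + 1" by linarith+
    have iff: "t < c * real n \<longleftrightarrow> Suc i \<le> n" for n
    proof -
      have "t < c * real n \<longleftrightarrow> t / c < real n" using c by (simp add: field_simps)
      also have "\<dots> \<longleftrightarrow> Suc i \<le> n" using i by linarith
      finally show ?thesis .
    qed
    have "{x. d < ennreal (c * real (\<Sum>k<m. of_bool (x \<in> U k)))} =
        {x. Suc i \<le> (\<Sum>k<m. of_bool (x \<in> U k) :: nat)}"
      unfolding real(2) using real(1) by (simp only: ennreal_less_iff iff)
    then show ?thesis using lsc_sum_of_bool[of m U "Suc i", OF U] by simp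
  qed simp
qed

lemma dyadic_approx_le_Suc:
  "ennreal (1 / 2 ^ n * real (dyadic_count n y)) \<le> ennreal (1 / 2 ^ Suc n * real (dyadic_count (Suc n) y))"
proof (rule ennreal_leI)
  have "real (2 * dyadic_count n y) \<le> real (dyadic_count (Suc n) y)"
    using dyadic_count_Suc[of n y] by (simp only: of_nat_le_iff)
  then show "1 / 2 ^ n * real (dyadic_count n y) \<le> 1 / 2 ^ Suc n * real (dyadic_count (Suc n) y)"
    by (simp add: field_simps)
qed

lemma val_integral_eq_SUP:
  assumes "lsc h"
  shows "val_integral \<nu> h =
    (SUP n. ennreal (1 / 2 ^ n) * (\<Sum>k<n * 2 ^ n. val \<nu> (h -` {ennreal (1 / 2 ^ n * real (Suc k))<..})))"
proof -
  let ?U = "\<lambda>n k. h -` {ennreal (1 / 2 ^ n * real (Suc k))<..}"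
  have eq: "ennreal (1 / 2 ^ n * real (dyadic_count n (h x))) =
      ennreal (1 / 2 ^ n * real (\<Sum>k<n * 2 ^ n. of_bool (x \<in> ?U n k)))" for n x
    by (simp add: dyadic_count_def)
  have "val_integral \<nu> h = val_integral \<nu> (\<lambda>x. SUP n. ennreal (1 / 2 ^ n * real (dyadic_count n (h x))))"
    by (simp only: SUP_dyadic_count)
  also have "\<dots> = (SUP n. val_integral \<nu> (\<lambda>x. ennreal (1 / 2 ^ n * real (dyadic_count n (h x)))))"
  proof (rule val_integral_SUP)
    show "lsc (\<lambda>x. ennreal (1 / 2 ^ n * real (dyadic_count n (h x))))" for n
      unfolding eq by (rule lsc_sum_of_bool_scaled) (simp_all add: lsc_open[OF assms])
  qed (rule dyadic_approx_le_Suc)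
  also have "\<dots> = (SUP n. ennreal (1 / 2 ^ n) * (\<Sum>k<n * 2 ^ n. val \<nu> (?U n k)))"
    unfolding eq by (subst val_integral_sum_of_bool) (simp_all add: lsc_open[OF assms])
  finally show ?thesis .
qed

lemma val_integral_mono:
  assumes "lsc g" "lsc h" "\<And>x. g x \<le> h x"
  shows "val_integral \<nu> g \<le> val_integral \<nu> h"
  unfolding val_integral_def
  by (intro nn_integral_mono mult_right_mono val_mono lsc_open assms)
     (auto intro: less_le_trans[OF _ assms(3)])

lemma val_integral_add:
  assumes g: "lsc g" and h: "lsc h"
  shows "val_integral \<nu> (\<lambda>x. g x + h x) = val_integral \<nu> g + val_integral \<nu> h"
proof -
  let ?a = "\<lambda>n y. ennreal (1 / 2 ^ n * real (dyadic_count n y))"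
  let ?U = "\<lambda>f n k. f -` {ennreal (1 / 2 ^ n * real (Suc k))<..}"
  define m where "m n = n * 2 ^ n" for n :: nat
  define W where "W n k = (if k < m n then ?U g n k else ?U h n (k - m n))" for n k
  define S where "S f n = ennreal (1 / 2 ^ n) * (\<Sum>k<m n. val \<nu> (?U f n k))" for f n
  have oW: "open (W n k)" for n k
    by (simp add: W_def lsc_open[OF g] lsc_open[OF h])
  have split: "(\<Sum>k<m n + m n. F (W n k)) = (\<Sum>k<m n. F (?U g n k)) + (\<Sum>k<m n. F (?U h n k))"
    for n and F :: "_ \<Rightarrow> 'b::comm_monoid_add"
  proof -
    have "(\<Sum>k<a + b. G k) = (\<Sum>k<a. G k) + (\<Sum>k<b. G (a + k))"
      for a b and G :: "nat \<Rightarrow> 'b"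
      by (induction b) (simp_all add: add.assoc)
    then show ?thesis by (simp add: W_def)
  qed
  have eq: "?a n (g x) + ?a n (h x) =
      ennreal (1 / 2 ^ n * real (\<Sum>k<m n + m n. of_bool (x \<in> W n k)))" for n x
    unfolding split[of "\<lambda>V. of_bool (x \<in> V)"]
    by (simp add: dyadic_count_def m_def distrib_left add_divide_distrib flip: ennreal_plus)
  have Sa: "S f n = val_integral \<nu> (\<lambda>x. ?a n (f x))" if "lsc f" for f n
    unfolding S_def dyadic_count_def m_def
    using val_integral_sum_of_bool[of "n * 2 ^ n" "?U f n" "1 / 2 ^ n" \<nu>]
    by (simp add: lsc_open[OF that])
  have lsca: "lsc (\<lambda>x. ?a n (f x))" if "lsc f" for f :: "'a \<Rightarrow> ennreal" and n
    using lsc_sum_of_bool_scaled[of "n * 2 ^ n" "?U f n" "1 / 2 ^ n"]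
    by (simp add: lsc_open[OF that] dyadic_count_def)
  have incS: "incseq (S f)" if "lsc f" for f
    unfolding Sa[OF that]
    by (intro incseq_SucI val_integral_mono lsca that dyadic_approx_le_Suc)
  have inca: "incseq (\<lambda>n. ?a n y)" for y
    by (intro incseq_SucI dyadic_approx_le_Suc)
  have "val_integral \<nu> (\<lambda>x. g x + h x) = val_integral \<nu> (\<lambda>x. SUP n. ?a n (g x) + ?a n (h x))"
    by (simp only: ennreal_SUP_add[OF inca inca] SUP_dyadic_count)
  also have "\<dots> = (SUP n. val_integral \<nu> (\<lambda>x. ?a n (g x) + ?a n (h x)))"
  proof (rule val_integral_SUP)
    show "lsc (\<lambda>x. ?a n (g x) + ?a n (h x))" for n
      unfolding eq by (rule lsc_sum_of_bool_scaled) (simp_all add: oW)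
  qed (intro add_mono dyadic_approx_le_Suc)
  also have "\<dots> = (SUP n. S g n + S h n)"
  proof (rule SUP_cong[OF refl])
    fix n
    have "val_integral \<nu> (\<lambda>x. ?a n (g x) + ?a n (h x)) =
        ennreal (1 / 2 ^ n) * (\<Sum>k<m n + m n. val \<nu> (W n k))"
      unfolding eq by (rule val_integral_sum_of_bool) (simp_all add: oW)
    then show "val_integral \<nu> (\<lambda>x. ?a n (g x) + ?a n (h x)) = S g n + S h n"
      unfolding split[of "val \<nu>"] S_def by (simp add: distrib_left)
  qed
  also have "\<dots> = (SUP n. S g n) + (SUP n. S h n)"
    by (rule ennreal_SUP_add[OF incS[OF g] incS[OF h]])
  also have "\<dots> = val_integral \<nu> g + val_integral \<nu> h"
    unfolding S_def m_def val_integral_eq_SUP[OF g] val_integral_eq_SUP[OF h] ..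
  finally show ?thesis .
qed

lemma sum_SUP_directed_ennreal:
  fixes f :: "nat \<Rightarrow> 'i \<Rightarrow> ennreal"
  assumes ne: "I \<noteq> {}"
    and dir: "\<And>i j. i \<in> I \<Longrightarrow> j \<in> I \<Longrightarrow> \<exists>l\<in>I. \<forall>k. f k i \<le> f k l \<and> f k j \<le> f k l"
  shows "(\<Sum>k<m. SUP i\<in>I. f k i) = (SUP i\<in>I. \<Sum>k<m. f k i)"
proof (induction m)
  case 0
  then show ?case using ne by simp
next
  case (Suc m)
  have "(SUP i\<in>I. (\<Sum>k<m. f k i) + f m i) = (SUP i\<in>I. \<Sum>k<m. f k i) + (SUP i\<in>I. f m i)"
  proof (rule SUP_add_directed_ennreal)
    fix i j assume "i \<in> I" "j \<in> I"
    from dir[OF this] obtain l where l: "l \<in> I" "\<forall>k. f k i \<le> f k l \<and> f k j \<le> f k l" ..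
    then show "\<exists>l\<in>I. (\<Sum>k<m. f k i) + f m j \<le> (\<Sum>k<m. f k l) + f m l"
      by (intro bexI[of _ l] add_mono sum_mono) simp_all
  qed
  then show ?case using Suc by simp
qed

lemma val_integral_SUP_directed:
  fixes h :: "'i \<Rightarrow> 'a::topological_space \<Rightarrow> ennreal"
  assumes ne: "I \<noteq> {}" and lsc: "\<And>i. i \<in> I \<Longrightarrow> lsc (h i)"
    and dir: "\<And>i j. i \<in> I \<Longrightarrow> j \<in> I \<Longrightarrow> \<exists>l\<in>I. \<forall>x. h i x \<le> h l x \<and> h j x \<le> h l x"
  shows "val_integral \<nu> (\<lambda>x. SUP i\<in>I. h i x) = (SUP i\<in>I. val_integral \<nu> (h i))"
proof -
  have un: "(\<lambda>x. SUP i\<in>I. h i x) -` {c<..} = (\<Union>i\<in>I. h i -` {c<..})" for c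
    by (auto simp: less_SUP_iff)
  have lsc': "lsc (\<lambda>x. SUP i\<in>I. h i x)"
  proof -
    have "open (\<Union>i\<in>I. h i -` {c<..})" for c by (intro open_UN ballI lsc_open lsc)
    then show ?thesis unfolding lsc_iff un[symmetric] by (simp add: vimage_def)
  qed
  have sub: "h i -` {c<..} \<subseteq> h l -` {c<..}" if "\<forall>x. h i x \<le> h l x" for i l c
    using that by (auto intro: less_le_trans)
  have dir': "\<exists>l\<in>I. \<forall>c. h i -` {c<..} \<subseteq> h l -` {c<..} \<and> h j -` {c<..} \<subseteq> h l -` {c<..}"
    if "i \<in> I" "j \<in> I" for i j
    using dir[OF that] sub by metis
  have lev: "val \<nu> ((\<lambda>x. SUP i\<in>I. h i x) -` {c<..}) = (SUP i\<in>I. val \<nu> (h i -` {c<..}))" for c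
    unfolding un using ne lsc_open[OF lsc] dir' by (intro val_SUP_directed) metis+
  let ?c = "\<lambda>n k. ennreal (1 / 2 ^ n * real (Suc k))"
  have "(\<Sum>k<m. SUP i\<in>I. val \<nu> (h i -` {?c n k<..})) =
      (SUP i\<in>I. \<Sum>k<m. val \<nu> (h i -` {?c n k<..}))" for n m
  proof (rule sum_SUP_directed_ennreal[OF ne])
    fix i j assume "i \<in> I" "j \<in> I"
    with dir' obtain l where "l \<in> I" "\<And>c. h i -` {c<..} \<subseteq> h l -` {c<..}"
      "\<And>c. h j -` {c<..} \<subseteq> h l -` {c<..}" by metis
    then show "\<exists>l\<in>I. \<forall>k. val \<nu> (h i -` {?c n k<..}) \<le> val \<nu> (h l -` {?c n k<..}) \<and>
        val \<nu> (h j -` {?c n k<..}) \<le> val \<nu> (h l -` {?c n k<..})"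
      using \<open>i \<in> I\<close> \<open>j \<in> I\<close> by (intro bexI[of _ l] allI conjI val_mono lsc_open lsc)
  qed
  then have "val_integral \<nu> (\<lambda>x. SUP i\<in>I. h i x) =
      (SUP n. ennreal (1 / 2 ^ n) * (SUP i\<in>I. \<Sum>k<n * 2 ^ n. val \<nu> (h i -` {?c n k<..})))"
    unfolding val_integral_eq_SUP[OF lsc'] lev by (simp only:)
  also have "\<dots> = (SUP n. SUP i\<in>I. ennreal (1 / 2 ^ n) * (\<Sum>k<n * 2 ^ n. val \<nu> (h i -` {?c n k<..})))"
    by (simp only: SUP_mult_left_ennreal)
  also have "\<dots> = (SUP i\<in>I. SUP n. ennreal (1 / 2 ^ n) * (\<Sum>k<n * 2 ^ n. val \<nu> (h i -` {?c n k<..})))"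
    by (rule SUP_commute)
  also have "\<dots> = (SUP i\<in>I. val_integral \<nu> (h i))"
    by (rule SUP_cong[OF refl]) (simp only: val_integral_eq_SUP[OF lsc])
  finally show ?thesis .
qed

subsection \<open>The monad of continuous valuations\<close>

lift_definition dirac :: "'a::topological_space \<Rightarrow> 'a valuation"
  is "\<lambda>x U. if open U \<and> x \<in> U then 1 else 0"
proof (intro conjI allI impI)
  fix x :: 'a
  show "continuous_valuation (\<lambda>U. if open U \<and> x \<in> U then 1 else 0)"
    unfolding continuous_valuation_def
  proof (intro conjI allI impI)
    fix D :: "'a set set" assume "directed_opens D"
    then have o: "\<And>U. U \<in> D \<Longrightarrow> open U" and ne: "D \<noteq> {}" unfolding directed_opens_def by blast+
    show "(if open (\<Union>D) \<and> x \<in> \<Union>D then 1 else 0) =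
          (SUP U\<in>D. if open U \<and> x \<in> U then 1 else (0::ennreal))"
    proof (cases "x \<in> \<Union>D")
      case True
      then obtain U where U: "U \<in> D" "x \<in> U" by blast
      have "(SUP U\<in>D. if open U \<and> x \<in> U then 1 else (0::ennreal)) = 1"
      proof (rule antisym)
        show "(SUP U\<in>D. if open U \<and> x \<in> U then 1 else (0::ennreal)) \<le> 1"
          by (rule SUP_least) simp
        show "1 \<le> (SUP U\<in>D. if open U \<and> x \<in> U then 1 else (0::ennreal))"
          by (rule SUP_upper2[OF U(1)]) (simp add: U o)
      qed
      then show ?thesis using True o by (simp add: open_Union)
    next
      case False
      then have "(SUP U\<in>D. if open U \<and> x \<in> U then 1 else (0::ennreal)) = (SUP U\<in>D. 0)"
        by (intro SUP_cong) auto
      then show ?thesis using False ne by simp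
    qed
  qed (auto simp: open_Un open_Int)
qed simp

text \<open>\<open>val_map f\<close> is intended for continuous \<open>f\<close> only; otherwise it is the zero map.\<close>

lift_definition val_map ::
  "('a::topological_space \<Rightarrow> 'b::topological_space) \<Rightarrow> 'a valuation \<Rightarrow> 'b valuation"
  is "\<lambda>f \<nu> V. if continuous_on UNIV f \<and> open V then \<nu> (f -` V) else 0"
proof (intro conjI allI impI)
  fix f :: "'a \<Rightarrow> 'b" and \<nu> :: "'a set \<Rightarrow> ennreal"
  assume "continuous_valuation \<nu> \<and> (\<forall>U. \<not> open U \<longrightarrow> \<nu> U = 0)"
  then have c: "continuous_valuation \<nu>" by (rule conjunct1)
  show "continuous_valuation (\<lambda>V. if continuous_on UNIV f \<and> open V then \<nu> (f -` V) else 0)"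
  proof (cases "continuous_on UNIV f")
    case True
    then have o: "open (f -` V)" if "open V" for V using that by (simp add: open_vimage)
    show ?thesis
      unfolding continuous_valuation_def
    proof (intro conjI allI impI)
      fix D :: "'b set set" assume D: "directed_opens D"
      then have oD: "\<And>V. V \<in> D \<Longrightarrow> open V" unfolding directed_opens_def by blast
      have "directed_opens ((-`) f ` D)"
        unfolding directed_opens_def
      proof (intro conjI ballI)
        show "(-`) f ` D \<noteq> {}" using D by (simp add: directed_opens_def)
        show "open U" if "U \<in> (-`) f ` D" for U using that o oD by blast
        fix U V assume "U \<in> (-`) f ` D" "V \<in> (-`) f ` D"
        then obtain U' V' where U': "U' \<in> D" "U = f -` U'" and V': "V' \<in> D" "V = f -` V'" by blast
        then obtain W where "W \<in> D" "U' \<subseteq> W" "V' \<subseteq> W" using D unfolding directed_opens_def by metis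
        then show "\<exists>W\<in>(-`) f ` D. U \<subseteq> W \<and> V \<subseteq> W" unfolding U' V' by blast
      qed
      then have "\<nu> (\<Union>((-`) f ` D)) = (SUP V\<in>D. \<nu> (f -` V))"
        using c by (simp add: continuous_valuation_def image_image)
      moreover have "\<Union>((-`) f ` D) = f -` \<Union>D" by blast
      moreover have "(SUP V\<in>D. if continuous_on UNIV f \<and> open V then \<nu> (f -` V) else 0) =
          (SUP V\<in>D. \<nu> (f -` V))"
        using True oD by (intro SUP_cong) simp_all
      ultimately show "(if continuous_on UNIV f \<and> open (\<Union>D) then \<nu> (f -` \<Union>D) else 0) =
          (SUP V\<in>D. if continuous_on UNIV f \<and> open V then \<nu> (f -` V) else 0)"
        using True open_Union[of D] oD by simp
    qed (use c o True in \<open>simp_all add: continuous_valuation_def vimage_mono open_Un open_Int\<close>)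
  next
    case False
    then show ?thesis by (simp add: continuous_valuation_def directed_opens_def)
  qed
qed simp

lift_definition val_join :: "'a::topological_space valuation valuation \<Rightarrow> 'a valuation"
  is "\<lambda>\<phi> U. if open U then val_integral \<phi> (\<lambda>\<nu>. val \<nu> U) else 0"
proof (intro conjI allI impI)
  fix \<phi> :: "'a valuation valuation"
  show "continuous_valuation (\<lambda>U. if open U then val_integral \<phi> (\<lambda>\<nu>. val \<nu> U) else 0)"
    unfolding continuous_valuation_def
  proof (intro conjI allI impI)
    show "(if open {} then val_integral \<phi> (\<lambda>\<nu>. val \<nu> {}) else 0) = 0"
      by (simp add: val_integral_def vimage_def)
  next
    fix U V :: "'a set" assume o: "open U" "open V"
    then have o': "open (U \<union> V)" "open (U \<inter> V)" by (simp_all add: open_Un open_Int)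
    have "val_integral \<phi> (\<lambda>\<nu>. val \<nu> (U \<union> V)) + val_integral \<phi> (\<lambda>\<nu>. val \<nu> (U \<inter> V)) =
        val_integral \<phi> (\<lambda>\<nu>. val \<nu> U) + val_integral \<phi> (\<lambda>\<nu>. val \<nu> V)"
      unfolding val_integral_add[OF lsc_val[OF o'(1)] lsc_val[OF o'(2)], symmetric]
        val_integral_add[OF lsc_val[OF o(1)] lsc_val[OF o(2)], symmetric]
      by (simp only: val_modular[OF o])
    then show "(if open (U \<union> V) then val_integral \<phi> (\<lambda>\<nu>. val \<nu> (U \<union> V)) else 0) +
        (if open (U \<inter> V) then val_integral \<phi> (\<lambda>\<nu>. val \<nu> (U \<inter> V)) else 0) =
        (if open U then val_integral \<phi> (\<lambda>\<nu>. val \<nu> U) else 0) +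
        (if open V then val_integral \<phi> (\<lambda>\<nu>. val \<nu> V) else 0)"
      using o o' by (simp only: if_True)
  next
    fix U V :: "'a set" assume "open U" "open V" "U \<subseteq> V"
    then show "(if open U then val_integral \<phi> (\<lambda>\<nu>. val \<nu> U) else 0) \<le>
        (if open V then val_integral \<phi> (\<lambda>\<nu>. val \<nu> V) else 0)"
      using val_integral_mono[OF lsc_val lsc_val, of U V \<phi>] by (simp add: val_mono)
  next
    fix D :: "'a set set" assume D: "directed_opens D"
    then have oD: "\<And>V. V \<in> D \<Longrightarrow> open V" and ne: "D \<noteq> {}" unfolding directed_opens_def by blast+
    have "val_integral \<phi> (\<lambda>\<nu>. val \<nu> (\<Union>D)) = val_integral \<phi> (\<lambda>\<nu>. SUP U\<in>D. val \<nu> U)"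
      by (simp only: val_Union_directed[OF D])
    also have "\<dots> = (SUP U\<in>D. val_integral \<phi> (\<lambda>\<nu>. val \<nu> U))"
    proof (rule val_integral_SUP_directed[OF ne])
      show "lsc (\<lambda>\<nu>. val \<nu> U)" if "U \<in> D" for U using lsc_val[OF oD[OF that]] .
      fix U V assume UV: "U \<in> D" "V \<in> D"
      then obtain W where W: "W \<in> D" "U \<subseteq> W" "V \<subseteq> W" using D unfolding directed_opens_def by metis
      then show "\<exists>W\<in>D. \<forall>\<nu>. val \<nu> U \<le> val \<nu> W \<and> val \<nu> V \<le> val \<nu> W"
        using UV by (intro bexI[of _ W] allI conjI val_mono oD)
    qed
    also have "\<dots> = (SUP U\<in>D. if open U then val_integral \<phi> (\<lambda>\<nu>. val \<nu> U) else 0)"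
      using oD by (intro SUP_cong) simp_all
    finally show "(if open (\<Union>D) then val_integral \<phi> (\<lambda>\<nu>. val \<nu> (\<Union>D)) else 0) =
        (SUP U\<in>D. if open U then val_integral \<phi> (\<lambda>\<nu>. val \<nu> U) else 0)"
      using open_Union[of D] oD by simp
  qed
qed simp

subsection \<open>Algebras and barycenters\<close>

definition Vw_algebra :: "('a::t0_space valuation \<Rightarrow> 'a) \<Rightarrow> bool" where
  "Vw_algebra \<alpha> \<longleftrightarrow>
     continuous_on UNIV \<alpha> \<and> \<alpha> \<circ> dirac = id \<and> \<alpha> \<circ> val_map \<alpha> = \<alpha> \<circ> val_join"

text \<open>The zero of the induced cone need not be mentioned: it is determined by \<open>0 \<cdot> x = 0\<close>.\<close>

definition induces_cone :: "('a::{t0_space, abstract_cone} valuation \<Rightarrow> 'a) \<Rightarrow> bool" where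
  "induces_cone \<alpha> \<longleftrightarrow>
     (\<forall>x y. x + y = \<alpha> (dirac x + dirac y)) \<and> (\<forall>a\<ge>0. \<forall>x. a \<cdot> x = \<alpha> (a \<cdot> dirac x))"

definition is_barycenter :: "'a::topological_cone valuation \<Rightarrow> 'a \<Rightarrow> bool" where
  "is_barycenter \<nu> x\<^sub>0 \<longleftrightarrow> (\<forall>\<Lambda>\<in>cone_dual. \<Lambda> x\<^sub>0 = val_integral \<nu> \<Lambda>)"

definition barycenter :: "'a::topological_cone valuation \<Rightarrow> 'a" where
  "barycenter \<nu> = (THE x. is_barycenter \<nu> x)"

end

(*
  A lower semicontinuous superlinear functional that is maximal below a bound is automatically
  linear, so the dual of a locally convex cone separates points and barycenters are unique.

  A continuous valuation can be split along any open set into a part inside and a part outside, both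
  of them continuous valuations. Iterated splitting into pieces concentrated on convex compact sets Q_i
  with masses above a_i yields compact sets A = sum_i a_i Q_i. They form a filtered family, because any
  two sequences of splittings have a common refinement, and a sober space is well-filtered, so the
  intersection K of their saturations is a nonempty compact set. Every L in the dual is at least its
  integral on K and comes down to it on each A; applied to finite sums of functionals, compactness of K
  gives a point with equality for all L. It is the least point of K, hence a neighbourhood of it
  contains some A, and the conditions on the masses of A are open in the valuation: the barycenter map
  is continuous.

  If f is an algebra inducing the cone structure and L is in the dual, then L o f is linear and lower
  semicontinuous on the valuations, so it is integration of x |-> L (f (dirac x)) = L x by the
  Schroeder-Simpson theorem, which also follows from splittings. So f picks barycenters.
*)
theory Submission
  imports Defs
begin

section \<open>Cones and separation\<close>

subsection \<open>Saturation\<close>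

text \<open>Masses and functionals may be infinite, so nothing can be subtracted freely. This
  obstacle shapes \<open>shift_sup\<close>, the choice of the outer part of a splitting, and the
  finiteness guards before each cancellation. One principle, \<open>local_domination\<close>, gives
  three lower bounds: a linear functional of valuations dominates the integral of its values at
  Dirac valuations; the weights that approximants can carry inside an open set have a supremum no
  smaller than its mass; the infima of a functional over approximants have a supremum no smaller
  than its integral. The nonzero weights a_i stay strictly below the masses. Strictness makes the
  mass conditions open in the weak topology, and it survives the division of a weight between the
  two parts of a splitting, apart from parts that get weight zero. Continuity is read off from
  inequalities for all subfamilies of pieces, in the manner of Hall's marriage theorem: they follow
  from the splittings, and they alone already force every functional to have a value on A that is at
  most its integral.\<close>

definition up :: "'a::topological_space set \<Rightarrow> 'a set" where
  "up A = {y. \<exists>x\<in>A. \<forall>U. open U \<longrightarrow> x \<in> U \<longrightarrow> y \<in> U}"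

lemma up_superset: "A \<subseteq> up A"
  by (auto simp: up_def)

lemma up_mono: "A \<subseteq> B \<Longrightarrow> up A \<subseteq> up B"
  by (auto simp: up_def)

lemma up_up: "up (up A) = up A"
proof
  show "up (up A) \<subseteq> up A"
  proof
    fix z assume "z \<in> up (up A)"
    then obtain y where y: "y \<in> up A" "\<forall>U. open U \<longrightarrow> y \<in> U \<longrightarrow> z \<in> U" by (auto simp: up_def)
    from y(1) obtain x where "x \<in> A" "\<forall>U. open U \<longrightarrow> x \<in> U \<longrightarrow> y \<in> U" by (auto simp: up_def)
    with y(2) show "z \<in> up A" by (auto simp: up_def)
  qed
qed (rule up_superset)

lemma up_least: "A \<subseteq> up B \<Longrightarrow> up A \<subseteq> up B"
  using up_mono[of A "up B"] by (simp add: up_up)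

lemma up_subset_open: "open U \<Longrightarrow> A \<subseteq> U \<Longrightarrow> up A \<subseteq> U"
  by (auto simp: up_def)

lemma upE_open:
  assumes "y \<in> up A"
  obtains x where "x \<in> A" "\<And>U. open U \<Longrightarrow> x \<in> U \<Longrightarrow> y \<in> U"
  using assms by (auto simp: up_def)

text \<open>\<open>up A\<close> is the saturation of \<open>A\<close>, its upward closure in the
  specialization order, and closed sets are lower sets of that order. Compact sets need not be
  closed here, which is why filtered families are compared through saturations.\<close>

lemma up_Int_closed:
  assumes "y \<in> up A" "closed F" "y \<in> F"
  shows "A \<inter> F \<noteq> {}"
  using assms by (auto simp: up_def closed_def)

lemma lsc_upE:
  assumes "y \<in> up A" "lsc h"
  obtains x where "x \<in> A" "h x \<le> h y"
proof -
  obtain x where x: "x \<in> A" "\<And>U. open U \<Longrightarrow> x \<in> U \<Longrightarrow> y \<in> U"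
    using assms(1) by (rule upE_open) blast
  have "\<not> h y < h x"
    using x(2)[of "{z. h y < h z}"] assms(2) by (auto simp: lsc_iff)
  with x(1) show ?thesis by (intro that[of x]) simp_all
qed

lemma lsc_closed_le: "lsc h \<Longrightarrow> closed {x. h x \<le> c}"
  by (auto simp: lsc_iff closed_def Compl_eq not_le)

text \<open>Among finitely many points of \<open>Q\<close>, one with the least value lies in all the
  closed sets \<open>{x. h x \<le> h y}\<close> at once, so compactness makes the whole family meet
  \<open>Q\<close>.\<close>

lemma lsc_attains_inf:
  assumes "lsc h" "compact Q" "Q \<noteq> {}"
  obtains x where "x \<in> Q" "\<And>y. y \<in> Q \<Longrightarrow> h x \<le> h y"
proof -
  have "Q \<inter> (\<Inter>y\<in>Q. {x. h x \<le> h y}) \<noteq> {}"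
  proof (rule compact_imp_fip_image[OF assms(2)])
    show "closed {x. h x \<le> h y}" for y by (rule lsc_closed_le[OF assms(1)])
    fix I assume I: "finite I" "I \<subseteq> Q"
    show "Q \<inter> (\<Inter>y\<in>I. {x. h x \<le> h y}) \<noteq> {}"
    proof (cases "I = {}")
      case False
      then have "Min (h ` I) \<in> h ` I" using I by (intro Min_in) auto
      then obtain x where x: "x \<in> I" "h x = Min (h ` I)" by auto
      then have "x \<in> Q \<inter> (\<Inter>y\<in>I. {x. h x \<le> h y})" using I by auto
      then show ?thesis by blast
    qed (use assms(3) in auto)
  qed
  then show ?thesis using that by blast
qed

subsection \<open>Monotonicity of the cone operations\<close>

text \<open>An open set of scalars that is neither empty nor everything is a ray. Both the
  monotonicity of scaling and the room below a positive scalar come from this.\<close>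

lemma openin_scott_nonneg_imp:
  assumes "openin scott_nonneg S" "a \<in> S"
  shows "0 \<le> a" "a \<le> b \<Longrightarrow> b \<in> S" "0 < a \<Longrightarrow> \<exists>c. 0 < c \<and> c < a \<and> c \<in> S"
proof -
  obtain U where U: "openin scott_ennreal U" and S: "S = ennreal -` U \<inter> {0..}"
    using assms(1) unfolding scott_nonneg_def openin_pullback_topology by blast
  show a: "0 \<le> a" using assms(2) S by simp
  consider "U = UNIV" | r where "0 \<le> r" "U = {ennreal r<..}"
    using U assms(2) S unfolding openin_scott_ennreal by blast
  then have "(a \<le> b \<longrightarrow> b \<in> S) \<and> (0 < a \<longrightarrow> (\<exists>c. 0 < c \<and> c < a \<and> c \<in> S))"
  proof cases
    case 1
    then show ?thesis using a by (auto simp: S intro!: exI[of _ "a / 2"])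
  next
    case 2
    then have r: "r < a" using assms(2) by (simp add: S ennreal_less_iff)
    then have "r < (r + a) / 2" "(r + a) / 2 < a" by simp_all
    then show ?thesis
      using 2 r by (auto simp: S ennreal_less_iff intro!: exI[of _ "(r + a) / 2"])
  qed
  then show "a \<le> b \<Longrightarrow> b \<in> S" "0 < a \<Longrightarrow> \<exists>c. 0 < c \<and> c < a \<and> c \<in> S" by blast+
qed

lemma topspace_scott_nonneg: "topspace scott_nonneg = {0..}"
  by (simp add: scott_nonneg_def topspace_pullback_topology)

lemma open_add_vimage: "open U \<Longrightarrow> open {x. x + z \<in> U}" for z :: "'a::topological_cone"
  using open_vimage[of U "\<lambda>x. x + z"] continuous_on_add[OF continuous_on_id continuous_on_const]
  by (auto simp: vimage_def)

lemma open_cscale_vimage: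
  fixes U :: "'a::topological_cone set"
  assumes "open U" "0 \<le> a"
  shows "open {x. a \<cdot> x \<in> U}"
proof -
  have "continuous_map euclidean (prod_topology scott_nonneg euclidean) (\<lambda>x::'a. (a, x))"
    using assms(2) by (intro continuous_map_pairedI) (simp_all add: topspace_scott_nonneg)
  from continuous_map_compose[OF this continuous_cscale]
  have "continuous_map euclidean euclidean (\<lambda>x::'a. a \<cdot> x)" by (simp add: o_def)
  then show ?thesis
    using openin_continuous_map_preimage[of euclidean euclidean "\<lambda>x::'a. a \<cdot> x" U] assms(1) by simp
qed

lemma openin_cscale_scalars:
  fixes U :: "'a::topological_cone set"
  assumes "open U"
  shows "openin scott_nonneg {a \<in> {0..}. a \<cdot> x \<in> U}"
proof -
  have "continuous_map scott_nonneg (prod_topology scott_nonneg euclidean) (\<lambda>a. (a, x))"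
    by (intro continuous_map_pairedI) simp_all
  from continuous_map_compose[OF this continuous_cscale]
  have "continuous_map scott_nonneg euclidean (\<lambda>a. a \<cdot> x)" by (simp add: o_def)
  then show ?thesis
    using openin_continuous_map_preimage[of scott_nonneg euclidean "\<lambda>a. a \<cdot> x" U] assms
    by (simp add: topspace_scott_nonneg)
qed

lemma open_cscale_decrease:
  fixes x :: "'a::topological_cone"
  assumes "open U" "0 < a" "a \<cdot> x \<in> U"
  obtains c where "0 < c" "c < a" "c \<cdot> x \<in> U"
  using openin_scott_nonneg_imp(3)[OF openin_cscale_scalars[OF assms(1), of x], of a] assms by auto

text \<open>The Scott topology on the scalars forces \<open>0\<close> to be the least point.\<close>

lemma open_add_right:
  fixes x :: "'a::topological_cone"
  assumes "open U" "x \<in> U"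
  shows "x + y \<in> U"
proof -
  have o: "open {z. z + x \<in> U}" using open_add_vimage[OF assms(1)] .
  have "(0::real) \<in> {a \<in> {0..}. a \<cdot> y \<in> {z. z + x \<in> U}}"
    using assms(2) by (simp add: cscale_zero_left)
  from openin_scott_nonneg_imp(2)[OF openin_cscale_scalars[OF o] this, of 1]
  show ?thesis by (simp add: cscale_one add.commute)
qed

lemma open_cscale_increase:
  fixes x :: "'a::topological_cone"
  assumes "open U" "0 \<le> a" "a \<le> b" "a \<cdot> x \<in> U"
  shows "b \<cdot> x \<in> U"
  using openin_scott_nonneg_imp(2)[OF openin_cscale_scalars[OF assms(1), of x], of a b] assms by auto

lemma open_zero_UNIV:
  fixes U :: "'a::topological_cone set"
  assumes "open U" "0 \<in> U"
  shows "U = UNIV"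
  using open_add_right[OF assms] by auto

text \<open>Translations are continuous, so the two summands can be replaced by larger points one
  after the other.\<close>

lemma up_set_plus:
  fixes A B :: "'a::topological_cone set"
  shows "up A + up B \<subseteq> up (A + B)"
proof
  fix z assume "z \<in> up A + up B"
  then obtain a b where z: "z = a + b" "a \<in> up A" "b \<in> up B" by (rule set_plus_elim)
  obtain a' where a: "a' \<in> A" "\<And>U. open U \<Longrightarrow> a' \<in> U \<Longrightarrow> a \<in> U" using z(2) by (rule upE_open) blast
  obtain b' where b: "b' \<in> B" "\<And>U. open U \<Longrightarrow> b' \<in> U \<Longrightarrow> b \<in> U" using z(3) by (rule upE_open) blast
  have "a + b \<in> U" if U: "open U" "a' + b' \<in> U" for U
  proof -
    have "b' \<in> {y. y + a' \<in> U}" using U(2) by (simp add: add.commute)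
    then have "b \<in> {y. y + a' \<in> U}" by (rule b(2)[OF open_add_vimage[OF U(1)]])
    then have "a' \<in> {y. y + b \<in> U}" by (simp add: add.commute)
    then have "a \<in> {y. y + b \<in> U}" by (rule a(2)[OF open_add_vimage[OF U(1)]])
    then show ?thesis by simp
  qed
  then show "z \<in> up (A + B)" using a(1) b(1) by (auto simp: up_def z(1))
qed

text \<open>The form in which refinements found separately on the two parts of a splitting are added
  up.\<close>

lemma set_plus_subset_up:
  fixes A B :: "'a::topological_cone set"
  assumes "A \<subseteq> up A'" "B \<subseteq> up B'" "A' + B' \<subseteq> up C"
  shows "A + B \<subseteq> up C"
proof -
  have "A + B \<subseteq> up A' + up B'" using assms by (intro set_plus_mono2)
  also have "\<dots> \<subseteq> up (A' + B')" by (rule up_set_plus)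
  also have "\<dots> \<subseteq> up C" by (rule up_least[OF assms(3)])
  finally show ?thesis .
qed

lemma set_plus_subset_up_left: "A + B \<subseteq> up A" for A B :: "'a::topological_cone set"
  by (auto simp: up_def set_plus_def intro: open_add_right)

lemma cscale_image_subset_up:
  fixes Q :: "'a::topological_cone set"
  assumes "0 \<le> a" "a \<le> b"
  shows "(\<cdot>) b ` Q \<subseteq> up ((\<cdot>) a ` Q)"
  using assms by (auto simp: up_def intro: open_cscale_increase)

lemma up_zero: "up {0 :: 'a::topological_cone} = UNIV"
  using open_zero_UNIV by (auto simp: up_def)

text \<open>This is where convexity of a set pays off: splitting a weight does not leave \<open>(a + b) \<cdot> Q\<close>.\<close>

lemma cone_convex_cscale_plus:
  fixes Q :: "'a::abstract_cone set"
  assumes Q: "cone_convex Q" and ab: "0 \<le> a" "0 \<le> b"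
  shows "(\<cdot>) a ` Q + (\<cdot>) b ` Q \<subseteq> (\<cdot>) (a + b) ` Q"
proof
  fix z assume "z \<in> (\<cdot>) a ` Q + (\<cdot>) b ` Q"
  then obtain x y where xy: "x \<in> Q" "y \<in> Q" and z: "z = a \<cdot> x + b \<cdot> y" by (auto simp: set_plus_def)
  show "z \<in> (\<cdot>) (a + b) ` Q"
  proof (cases "a + b = 0")
    case True
    then have "a = 0" "b = 0" using ab by simp_all
    then show ?thesis using xy z by (auto simp: cscale_zero_left)
  next
    case False
    define t where "t = a / (a + b)"
    have t: "0 \<le> t" "t \<le> 1" using ab False by (simp_all add: t_def field_simps)
    have "1 - t = b / (a + b)" using False by (simp add: t_def field_simps)
    then have e: "(a + b) * t = a" "(a + b) * (1 - t) = b" using False by (simp_all add: t_def)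
    have "t \<cdot> x + (1 - t) \<cdot> y \<in> Q" using Q xy t by (auto simp: cone_convex_def)
    moreover have "(a + b) \<cdot> (t \<cdot> x + (1 - t) \<cdot> y) = ((a + b) * t) \<cdot> x + ((a + b) * (1 - t)) \<cdot> y"
      using ab t by (simp add: cscale_add_right cscale_cscale)
    ultimately show ?thesis unfolding e using z by (metis image_eqI)
  qed
qed

subsection \<open>Separation\<close>

definition lsc_superlinear :: "('a::topological_cone \<Rightarrow> ennreal) \<Rightarrow> bool" where
  "lsc_superlinear p \<longleftrightarrow> lsc p \<and> (\<forall>x y. p x + p y \<le> p (x + y)) \<and>
     (\<forall>a\<ge>0. \<forall>x. p (a \<cdot> x) = ennreal a * p x)"

text \<open>The supremum over \<open>s\<close> of \<open>p (w + s \<cdot> z) - s * q\<close>, written without the truncated subtraction of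
  \<open>ennreal\<close>, which would destroy superadditivity.\<close>

definition shift_sup :: "('a::topological_cone \<Rightarrow> ennreal) \<Rightarrow> 'a \<Rightarrow> ennreal \<Rightarrow> 'a \<Rightarrow> ennreal" where
  "shift_sup p z q w = Sup {t. \<exists>s\<ge>0. t + ennreal s * q \<le> p (w + s \<cdot> z)}"

lemma shift_sup_ge: "0 \<le> s \<Longrightarrow> t + ennreal s * q \<le> p (w + s \<cdot> z) \<Longrightarrow> t \<le> shift_sup p z q w"
  unfolding shift_sup_def by (rule Sup_upper) blast

lemma shift_sup_le:
  assumes "\<And>s t. 0 \<le> s \<Longrightarrow> t + ennreal s * q \<le> p (w + s \<cdot> z) \<Longrightarrow> t \<le> u"
  shows "shift_sup p z q w \<le> u"
  unfolding shift_sup_def by (rule Sup_least) (use assms in blast)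

text \<open>A finite \<open>q\<close> can be cancelled. The strict form exhibits each level set of
  \<open>shift_sup\<close> as a union of translated level sets of \<open>p\<close>, which is where
  its lower semicontinuity comes from.\<close>

lemma less_shift_sup_iff:
  assumes q: "q < top"
  shows "c < shift_sup p z q w \<longleftrightarrow> (\<exists>s\<ge>0. c + ennreal s * q < p (w + s \<cdot> z))"
proof
  assume "c < shift_sup p z q w"
  then obtain t s where ts: "c < t" "0 \<le> s" "t + ennreal s * q \<le> p (w + s \<cdot> z)"
    unfolding shift_sup_def less_Sup_iff by blast
  have "ennreal s * q < top" using q by (simp add: ennreal_mult_less_top)
  then have "c + ennreal s * q < t + ennreal s * q"
    using ts(1) by (simp add: less_top)
  then show "\<exists>s\<ge>0. c + ennreal s * q < p (w + s \<cdot> z)" using ts by (metis order_less_le_trans)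
next
  assume "\<exists>s\<ge>0. c + ennreal s * q < p (w + s \<cdot> z)"
  then obtain s where s: "0 \<le> s" "c + ennreal s * q < p (w + s \<cdot> z)" by blast
  have f: "ennreal s * q < top" using q by (simp add: ennreal_mult_less_top)
  define t where "t = p (w + s \<cdot> z) - ennreal s * q"
  have "ennreal s * q \<le> p (w + s \<cdot> z)" using s(2) order_trans[OF _ less_imp_le, of _ "c + ennreal s * q"] by simp
  then have "t + ennreal s * q = p (w + s \<cdot> z)" unfolding t_def by (rule diff_add_cancel_ennreal)
  then have "c < t" "t \<le> shift_sup p z q w"
    using s f shift_sup_ge[of s t q p w z] by (metis add_right_mono leD leI, simp)
  then show "c < shift_sup p z q w" by simp
qed

lemma lsc_superlinear_shift_sup:
  fixes p :: "'a::topological_cone \<Rightarrow> ennreal"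
  assumes p: "lsc_superlinear p" and q: "q < top" "p z \<le> q"
  shows "lsc_superlinear (shift_sup p z q)"
  unfolding lsc_superlinear_def
proof (intro conjI allI impI)
  have plsc: "lsc p" using p by (simp add: lsc_superlinear_def)
  have "{w. c < shift_sup p z q w} = (\<Union>s\<in>{0..}. {w. w + s \<cdot> z \<in> {y. c + ennreal s * q < p y}})" for c
    unfolding less_shift_sup_iff[OF q(1)] by auto
  moreover have "open (\<Union>s\<in>{0..}. {w. w + s \<cdot> z \<in> {y. c + ennreal s * q < p y}})" for c
    by (intro open_UN ballI open_add_vimage) (use plsc in \<open>simp add: lsc_iff\<close>)
  ultimately show "lsc (shift_sup p z q)" by (simp add: lsc_iff)
next
  have padd: "p x + p y \<le> p (x + y)" for x y using p by (simp add: lsc_superlinear_def)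
  fix x y
  define S where "S w = {t. \<exists>s\<ge>0. t + ennreal s * q \<le> p (w + s \<cdot> z)}" for w
  have S0: "0 \<in> S w" for w by (auto simp: S_def intro!: exI[of _ 0])
  have le: "t + t' \<le> shift_sup p z q (x + y)" if tt: "t \<in> S x" "t' \<in> S y" for t t'
  proof -
    obtain s where s: "0 \<le> s" "t + ennreal s * q \<le> p (x + s \<cdot> z)" using tt(1) by (auto simp: S_def)
    obtain s' where s': "0 \<le> s'" "t' + ennreal s' * q \<le> p (y + s' \<cdot> z)" using tt(2) by (auto simp: S_def)
    have "t + t' + ennreal (s + s') * q = (t + ennreal s * q) + (t' + ennreal s' * q)"
      unfolding ennreal_plus[OF s(1) s'(1)] distrib_right by (simp only: add_ac)
    also have "\<dots> \<le> p (x + s \<cdot> z) + p (y + s' \<cdot> z)" using s s' by (intro add_mono)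
    also have "\<dots> \<le> p ((x + s \<cdot> z) + (y + s' \<cdot> z))" by (rule padd)
    also have "(x + s \<cdot> z) + (y + s' \<cdot> z) = x + y + (s + s') \<cdot> z"
      using s(1) s'(1) by (simp add: cscale_add_left ac_simps)
    finally show ?thesis using s(1) s'(1) by (intro shift_sup_ge[of "s + s'"]) simp_all
  qed
  have "Sup (S x) + Sup (S y) = (SUP t'\<in>S y. Sup (S x) + t')"
    using S0[of y] by (subst ennreal_SUP_add_right[symmetric]) auto
  also have "\<dots> = (SUP t'\<in>S y. SUP t\<in>S x. t + t')"
  proof (rule SUP_cong[OF refl])
    have "S x \<noteq> {}" using S0[of x] by blast
    from ennreal_SUP_add_left[OF this, of "\<lambda>t. t"]
    show "Sup (S x) + t' = (SUP t\<in>S x. t + t')" for t' by simp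
  qed
  also have "\<dots> \<le> shift_sup p z q (x + y)" by (intro SUP_least le)
  finally show "shift_sup p z q x + shift_sup p z q y \<le> shift_sup p z q (x + y)"
    by (simp add: shift_sup_def S_def)
next
  have phom: "p (a \<cdot> x) = ennreal a * p x" if "0 \<le> a" for a x using p that by (simp add: lsc_superlinear_def)
  fix a :: real and x assume a: "0 \<le> a"
  have le: "ennreal b * shift_sup p z q y \<le> shift_sup p z q (b \<cdot> y)" if b: "0 \<le> b" for b y
  proof -
    show "ennreal b * shift_sup p z q y \<le> shift_sup p z q (b \<cdot> y)"
      unfolding shift_sup_def[of p z q y] SUP_mult_left_ennreal[of _ "\<lambda>x. x", simplified]
    proof (rule SUP_least)
      fix t assume "t \<in> {t. \<exists>s\<ge>0. t + ennreal s * q \<le> p (y + s \<cdot> z)}"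
      then obtain s where s: "0 \<le> s" "t + ennreal s * q \<le> p (y + s \<cdot> z)" by blast
      have "ennreal b * t + ennreal (b * s) * q = ennreal b * (t + ennreal s * q)"
        using b s(1) by (simp add: ennreal_mult distrib_left mult.assoc)
      also have "\<dots> \<le> ennreal b * p (y + s \<cdot> z)" using s by (intro mult_left_mono) simp_all
      also have "\<dots> = p (b \<cdot> y + (b * s) \<cdot> z)"
        using b s(1) by (simp add: phom[symmetric] cscale_add_right cscale_cscale)
      finally show "ennreal b * t \<le> shift_sup p z q (b \<cdot> y)"
        using b s(1) by (intro shift_sup_ge[of "b * s"]) simp_all
    qed
  qed
  show "shift_sup p z q (a \<cdot> x) = ennreal a * shift_sup p z q x"
  proof (cases "a = 0")
    case True
    have "shift_sup p z q 0 \<le> 0"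
    proof (rule shift_sup_le)
      fix s t assume s: "0 \<le> (s::real)" "t + ennreal s * q \<le> p (0 + s \<cdot> z)"
      \<comment> \<open>The bound \<open>p z \<le> q\<close> keeps the value at the origin down to
        0: moving along \<open>z\<close> never gains more than it costs.\<close>
      have "p (0 + s \<cdot> z) \<le> ennreal s * q" using s(1) q(2) by (simp add: phom mult_left_mono)
      with s(2) have "t + ennreal s * q \<le> 0 + ennreal s * q" unfolding add_0 by (rule order_trans)
      moreover have "ennreal s * q \<noteq> top" using q(1) by (simp add: ennreal_mult_eq_top_iff)
      ultimately show "t \<le> 0" by simp
    qed
    then show ?thesis using True by (simp add: cscale_zero_left)
  next
    case False
    then have a': "0 < a" using a by simp
    \<comment> \<open>The converse inequality is \<open>le\<close> again, for the scalar
      \<open>1 / a\<close> at the point \<open>a \<cdot> x\<close>.\<close>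
    have "ennreal (1 / a) * shift_sup p z q (a \<cdot> x) \<le> shift_sup p z q x"
      using le[of "1 / a" "a \<cdot> x"] a' by (simp add: cscale_cscale[symmetric] cscale_one)
    then have "ennreal a * (ennreal (1 / a) * shift_sup p z q (a \<cdot> x)) \<le> ennreal a * shift_sup p z q x"
      by (rule mult_left_mono) simp
    moreover have "ennreal a * (ennreal (1 / a) * shift_sup p z q (a \<cdot> x)) = shift_sup p z q (a \<cdot> x)"
      using a' by (simp add: mult.assoc[symmetric] ennreal_mult[symmetric])
    ultimately show ?thesis using le[OF a, of x] by simp
  qed
qed

text \<open>Superadditivity needs one index that serves both summands; a chain provides it.\<close>

lemma lsc_superlinear_chain_SUP:
  assumes "C \<noteq> {}" and p: "\<And>p. p \<in> C \<Longrightarrow> lsc_superlinear p"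
    and chain: "\<And>p p'. p \<in> C \<Longrightarrow> p' \<in> C \<Longrightarrow> p \<le> p' \<or> p' \<le> p"
  shows "lsc_superlinear (\<lambda>x. SUP p\<in>C. p x)"
  unfolding lsc_superlinear_def
proof (intro conjI allI impI)
  have "{x. c < (SUP p\<in>C. p x)} = (\<Union>p\<in>C. {x. c < p x})" for c by (auto simp: less_SUP_iff)
  moreover have "open (\<Union>p\<in>C. {x. c < p x})" for c
    using p by (intro open_UN ballI) (auto simp: lsc_superlinear_def lsc_iff)
  ultimately show "lsc (\<lambda>x. SUP p\<in>C. p x)" by (simp add: lsc_iff)
next
  fix x y
  have "(SUP p\<in>C. p x) + (SUP p\<in>C. p y) = (SUP p\<in>C. p x + p y)"
  proof (rule SUP_add_directed_ennreal[symmetric])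
    fix p p' assume pp: "p \<in> C" "p' \<in> C"
    then consider "p \<le> p'" | "p' \<le> p" using chain by blast
    then show "\<exists>r\<in>C. p x + p' y \<le> r x + r y"
    proof cases
      case 1
      then show ?thesis using pp by (intro bexI[of _ p'] add_mono) (auto dest: le_funD)
    next
      case 2
      then show ?thesis using pp by (intro bexI[of _ p] add_mono) (auto dest: le_funD)
    qed
  qed
  also have "\<dots> \<le> (SUP p\<in>C. p (x + y))"
    using p by (intro SUP_mono) (auto simp: lsc_superlinear_def)
  finally show "(SUP p\<in>C. p x) + (SUP p\<in>C. p y) \<le> (SUP p\<in>C. p (x + y))" .
next
  fix a :: real and x assume "0 \<le> a"
  then have "(SUP p\<in>C. p (a \<cdot> x)) = (SUP p\<in>C. ennreal a * p x)"
    using p by (intro SUP_cong) (auto simp: lsc_superlinear_def)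
  then show "(SUP p\<in>C. p (a \<cdot> x)) = ennreal a * (SUP p\<in>C. p x)"
    by (simp only: SUP_mult_left_ennreal)
qed

text \<open>A Hahn-Banach theorem in which lower semicontinuity comes for free: a maximal lower
  semicontinuous superlinear functional below the given bound is additive, since otherwise
  \<open>shift_sup\<close> would enlarge it, first with \<open>z = x\<close> and \<open>q = 1\<close>, then with arbitrary \<open>z\<close> and \<open>q = p z\<close>.\<close>

theorem superlinear_extension:
  fixes p\<^sub>0 :: "'a::topological_cone \<Rightarrow> ennreal"
  assumes p0: "lsc_superlinear p\<^sub>0" "p\<^sub>0 x \<le> 1"
  obtains \<Lambda> where "\<Lambda> \<in> cone_dual" "p\<^sub>0 \<le> \<Lambda>" "\<Lambda> x \<le> 1"
proof -
  define P where "P = {p. lsc_superlinear p \<and> p\<^sub>0 \<le> p \<and> p x \<le> 1}"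
  have "\<exists>m\<in>P. \<forall>p\<in>P. m \<le> p \<longrightarrow> p = m"
  proof (rule predicate_Zorn)
    show "partial_order_on P (relation_of (\<le>) P)"
      by (rule partial_order_on_relation_ofI) auto
  next
    fix C assume C: "C \<in> Chains (relation_of (\<le>) P)"
    show "\<exists>u\<in>P. \<forall>p\<in>C. p \<le> u"
    proof (cases "C = {}")
      case True
      then show ?thesis using p0 by (auto simp: P_def)
    next
      case False
      have CP: "p \<in> P" if "p \<in> C" for p using C that by (auto simp: Chains_def relation_of_def)
      have chain: "p \<le> p' \<or> p' \<le> p" if "p \<in> C" "p' \<in> C" for p p'
        using C that by (auto simp: Chains_def relation_of_def)
      have up: "p \<le> (\<lambda>y. SUP p\<in>C. p y)" if "p \<in> C" for p
        using that by (intro le_funI SUP_upper)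
      have "(\<lambda>y. SUP p\<in>C. p y) \<in> P"
        unfolding P_def
      proof (intro CollectI conjI)
        show "lsc_superlinear (\<lambda>y. SUP p\<in>C. p y)"
          using CP chain by (intro lsc_superlinear_chain_SUP[OF False]) (auto simp: P_def)
        obtain p where "p \<in> C" using False by blast
        then show "p\<^sub>0 \<le> (\<lambda>y. SUP p\<in>C. p y)" using CP[of p] up[of p] by (auto simp: P_def)
        show "(SUP p\<in>C. p x) \<le> 1" using CP by (intro SUP_least) (auto simp: P_def)
      qed
      then show ?thesis using up by blast
    qed
  qed
  then obtain p where pP: "p \<in> P" and max: "\<And>p'. p' \<in> P \<Longrightarrow> p \<le> p' \<Longrightarrow> p' = p" by blast
  have sup: "lsc_superlinear p" and p0p: "p\<^sub>0 \<le> p" and px: "p x \<le> 1" using pP by (auto simp: P_def)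
  have padd: "\<And>x y. p x + p y \<le> p (x + y)" and phom: "\<And>a x. 0 \<le> a \<Longrightarrow> p (a \<cdot> x) = ennreal a * p x"
    using sup by (auto simp: lsc_superlinear_def)
  \<comment> \<open>An enlargement that stays at most 1 at \<open>x\<close> belongs to
    \<open>P\<close>, so it equals \<open>p\<close> by maximality; its term with
    \<open>s = 1\<close> then bounds \<open>p (w + z)\<close>.\<close>
  have bound: "p (w + z) \<le> p w + q"
    if q: "q < top" "p z \<le> q" and le1: "shift_sup p z q x \<le> 1" for w z q
  proof -
    have ge: "p \<le> shift_sup p z q"
      by (rule le_funI, rule shift_sup_ge[of 0]) (simp_all add: cscale_zero_left)
    have "shift_sup p z q \<in> P"
      using lsc_superlinear_shift_sup[OF sup q] order_trans[OF p0p ge] le1 by (simp add: P_def)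
    then have eq: "shift_sup p z q = p" using max ge by blast
    show ?thesis
    proof (cases "q \<le> p (w + z)")
      case True
      have "p (w + z) - q \<le> shift_sup p z q w"
        by (rule shift_sup_ge[of 1]) (simp_all add: diff_add_cancel_ennreal True cscale_one)
      then have "p (w + z) - q + q \<le> p w + q" unfolding eq by (rule add_right_mono)
      then show ?thesis by (simp add: diff_add_cancel_ennreal True)
    next
      case False
      then show ?thesis by (simp add: add_increasing)
    qed
  qed
  have bx: "p (w + x) \<le> p w + 1" for w
  proof (rule bound)
    show "shift_sup p x 1 x \<le> 1"
    proof (rule shift_sup_le)
      fix s t assume s: "0 \<le> (s::real)" "t + ennreal s * 1 \<le> p (x + s \<cdot> x)"
      have "x + s \<cdot> x = (1 + s) \<cdot> x" using s(1) by (simp add: cscale_add_left cscale_one)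
      then have "p (x + s \<cdot> x) = ennreal (1 + s) * p x" using s(1) phom[of "1 + s" x] by simp
      also have "\<dots> \<le> ennreal (1 + s) * 1" by (rule mult_left_mono[OF px]) simp
      finally have "p (x + s \<cdot> x) \<le> ennreal (1 + s)" by (simp only: mult_1_right)
      with s(2) have "t + ennreal s * 1 \<le> ennreal (1 + s)" by (rule order_trans)
      also have "\<dots> = 1 + ennreal s" using s(1) by simp
      finally show "t \<le> 1" by simp
    qed
  qed (use px in simp_all)
  have padd': "p (w + z) = p w + p z" for w z
  proof (cases "p z = top")
    case True
    then show ?thesis using padd[of w z] by (simp add: top_unique)
  next
    case False
    have "p (w + z) \<le> p w + p z"
    proof (rule bound)
      show "shift_sup p z (p z) x \<le> 1"
      proof (rule shift_sup_le)
        fix s t assume s: "0 \<le> (s::real)" "t + ennreal s * p z \<le> p (x + s \<cdot> z)"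
        \<comment> \<open>The bound \<open>bx\<close> takes \<open>x\<close> out of the argument, so
          enlargement in an arbitrary direction \<open>z\<close> respects the constraint at
          \<open>x\<close>. This is why the direction \<open>x\<close> comes first.\<close>
        have "p (x + s \<cdot> z) \<le> 1 + ennreal s * p z"
          using bx[of "s \<cdot> z"] unfolding phom[OF s(1)] by (simp only: add.commute)
        with s(2) have "t + ennreal s * p z \<le> 1 + ennreal s * p z" by (rule order_trans)
        moreover have "ennreal s * p z \<noteq> top" using False by (simp add: ennreal_mult_eq_top_iff)
        ultimately show "t \<le> 1" by simp
      qed
    qed (use False in \<open>simp_all add: less_top\<close>)
    then show ?thesis using padd by (intro antisym)
  qed
  have "p \<in> cone_dual" using sup padd' by (simp add: cone_dual_def lsc_superlinear_def)
  then show ?thesis using p0p px by (rule that)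
qed

text \<open>The Minkowski functional for an upper set: the scalars r with \<open>x\<close> in r
  times \<open>V\<close> are closed downwards when \<open>V\<close> is open, so a supremum takes the
  place of the usual infimum.\<close>

definition gauge_above :: "'a::topological_cone set \<Rightarrow> 'a \<Rightarrow> ennreal" where
  "gauge_above V x = (SUP r\<in>{r. 0 < r \<and> (1 / r) \<cdot> x \<in> V}. ennreal r)"

text \<open>If x / r and y / s lie in \<open>V\<close>, then (x + y) / (r + s) is their convex
  combination with weight r / (r + s); hence the superadditivity. \<open>0 \<notin> V\<close> makes
  the gauge vanish at the origin.\<close>

lemma lsc_superlinear_gauge_above:
  fixes V :: "'a::topological_cone set"
  assumes V: "open V" "cone_convex V" "0 \<notin> V"
  shows "lsc_superlinear (gauge_above V)"
  unfolding lsc_superlinear_def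
proof (intro conjI allI impI)
  have "{x. c < gauge_above V x} = (\<Union>r\<in>{r. 0 < r \<and> c < ennreal r}. {x. (1 / r) \<cdot> x \<in> V})" for c
    by (auto simp: gauge_above_def less_SUP_iff)
  moreover have "open (\<Union>r\<in>{r. 0 < r \<and> c < ennreal r}. {x. (1 / r) \<cdot> x \<in> V})" for c
    using V(1) by (intro open_UN ballI open_cscale_vimage) auto
  ultimately show "lsc (gauge_above V)" by (simp add: lsc_iff)
next
  fix x y
  define S where "S x = {r. 0 < r \<and> (1 / r) \<cdot> x \<in> V}" for x
  have g: "gauge_above V x = (SUP r\<in>S x. ennreal r)" for x by (simp add: gauge_above_def S_def)
  have up: "S x \<subseteq> S (x + y)" for x y
    using open_add_right[OF V(1)] by (auto simp: S_def cscale_add_right)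
  have add: "r + s \<in> S (x + y)" if "r \<in> S x" "s \<in> S y" for r s
  proof -
    have rs: "0 < r" "0 < s" "(1 / r) \<cdot> x \<in> V" "(1 / s) \<cdot> y \<in> V" using that by (auto simp: S_def)
    define t where "t = r / (r + s)"
    have t: "t \<in> {0..1}" "1 - t = s / (r + s)" using rs by (auto simp: t_def field_simps)
    have "t \<cdot> (1 / r) \<cdot> x + (1 - t) \<cdot> (1 / s) \<cdot> y \<in> V"
      using V(2) rs t(1) by (auto simp: cone_convex_def)
    moreover have "t \<cdot> (1 / r) \<cdot> x = (1 / (r + s)) \<cdot> x" "(1 - t) \<cdot> (1 / s) \<cdot> y = (1 / (r + s)) \<cdot> y"
      using rs by (simp_all add: t(2) cscale_cscale[symmetric]) (simp add: t_def cscale_cscale[symmetric])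
    ultimately show ?thesis using rs by (simp add: S_def cscale_add_right)
  qed
  \<comment> \<open>An empty index set contributes 0, and the other summand alone is bounded because
    adding a point only moves upwards. Otherwise the two suprema combine into one.\<close>
  show "gauge_above V x + gauge_above V y \<le> gauge_above V (x + y)"
  proof (cases "S x = {} \<or> S y = {}")
    case True
    then show ?thesis
      using SUP_subset_mono[OF up[of x y], of ennreal ennreal] SUP_subset_mono[OF up[of y x], of ennreal ennreal]
      by (auto simp: g add.commute bot_ennreal)
  next
    case False
    then have "gauge_above V x + gauge_above V y = (SUP s\<in>S y. SUP r\<in>S x. ennreal r + ennreal s)"
      unfolding g by (simp add: ennreal_SUP_add_left ennreal_SUP_add_right)
    also have "\<dots> \<le> gauge_above V (x + y)"
    proof (intro SUP_least)
      fix r s assume "s \<in> S y" "r \<in> S x"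
      then have "ennreal r + ennreal s = ennreal (r + s)" by (auto simp: S_def)
      also have "\<dots> \<le> gauge_above V (x + y)"
        unfolding g using add[OF \<open>r \<in> S x\<close> \<open>s \<in> S y\<close>] by (rule SUP_upper)
      finally show "ennreal r + ennreal s \<le> gauge_above V (x + y)" .
    qed
    finally show ?thesis .
  qed
next
  fix a :: real and x assume a: "0 \<le> a"
  show "gauge_above V (a \<cdot> x) = ennreal a * gauge_above V x"
  proof (cases "a = 0")
    case True
    have "{r. 0 < r \<and> (1 / r) \<cdot> (0::'a) \<in> V} = {}" using V(3) by (auto simp: cscale_zero_right)
    then have "gauge_above V 0 = 0" by (simp only: gauge_above_def) (simp add: bot_ennreal)
    then show ?thesis using True by (simp add: cscale_zero_left)
  next
    case False
    then have a': "0 < a" using a by simp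
    have e: "(1 / r) \<cdot> (a \<cdot> x) = (1 / (r / a)) \<cdot> x" if "0 < r" for r
      using that a' cscale_cscale[of "1 / r" a x] by simp
    have "{r. 0 < r \<and> (1 / r) \<cdot> (a \<cdot> x) \<in> V} = (*) a ` {r. 0 < r \<and> (1 / r) \<cdot> x \<in> V}" (is "?L = ?R")
    proof (intro set_eqI iffI)
      fix r assume "r \<in> ?L"
      then show "r \<in> ?R" using a' e[of r] by (intro image_eqI[of _ _ "r / a"]) auto
    next
      fix r assume "r \<in> ?R"
      then show "r \<in> ?L" using a' e[of r] by (auto simp: e)
    qed
    then have "gauge_above V (a \<cdot> x) = (SUP r\<in>{r. 0 < r \<and> (1 / r) \<cdot> x \<in> V}. ennreal (a * r))"
      by (simp add: gauge_above_def image_image)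
    also have "\<dots> = ennreal a * gauge_above V x"
      unfolding gauge_above_def SUP_mult_left_ennreal using a by (intro SUP_cong) (auto simp: ennreal_mult)
    finally show ?thesis .
  qed
qed

text \<open>The threshold 1 is that of the gauge. A point of \<open>V\<close> stays in
  \<open>V\<close> after shrinking by some c < 1, so its gauge exceeds 1; at \<open>x\<close> a
  scalar r > 1 would put \<open>x\<close> itself into the upper set \<open>V\<close>.\<close>

theorem separation:
  fixes V :: "'a::topological_cone set"
  assumes V: "open V" "cone_convex V" and x: "x \<notin> V"
  obtains \<Lambda> where "\<Lambda> \<in> cone_dual" "\<Lambda> x \<le> 1" "\<And>y. y \<in> V \<Longrightarrow> 1 < \<Lambda> y"
proof -
  have "0 \<notin> V" using open_zero_UNIV[OF V(1)] x by auto
  then have sup: "lsc_superlinear (gauge_above V)" using V by (intro lsc_superlinear_gauge_above)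
  have "gauge_above V x \<le> 1"
    unfolding gauge_above_def
  proof (rule SUP_least)
    fix r assume "r \<in> {r. 0 < r \<and> (1 / r) \<cdot> x \<in> V}"
    then have r: "0 < r" "(1 / r) \<cdot> x \<in> V" by auto
    have "\<not> 1 / r \<le> 1" using open_cscale_increase[OF V(1) _ _ r(2), of 1] r(1) x by (auto simp: cscale_one)
    then show "ennreal r \<le> 1" using r(1) by (simp add: field_simps)
  qed
  with sup obtain \<Lambda> where L: "\<Lambda> \<in> cone_dual" "gauge_above V \<le> \<Lambda>" "\<Lambda> x \<le> 1"
    by (rule superlinear_extension)
  have "1 < \<Lambda> y" if y: "y \<in> V" for y
  proof -
    have "1 \<cdot> y \<in> V" using y by (simp add: cscale_one)
    then obtain c where c: "0 < c" "c < 1" "c \<cdot> y \<in> V" using open_cscale_decrease[OF V(1)] by (metis zero_less_one)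
    have "1 < ennreal (1 / c)" using c by (simp flip: ennreal_1 add: ennreal_less_iff)
    also have "\<dots> \<le> gauge_above V y" unfolding gauge_above_def using c by (intro SUP_upper) simp
    also have "\<dots> \<le> \<Lambda> y" using L(2) by (rule le_funD)
    finally show ?thesis .
  qed
  then show ?thesis using L that by blast
qed

text \<open>In a locally convex cone the functionals determine the specialization order.\<close>

lemma cone_dual_separates:
  fixes x y :: "'a::topological_cone"
  assumes lc: "locally_convex TYPE('a)" and le: "\<And>\<Lambda>. \<Lambda> \<in> cone_dual \<Longrightarrow> \<Lambda> x \<le> \<Lambda> y"
    and U: "open U" "x \<in> U"
  shows "y \<in> U"
proof (rule ccontr)
  assume y: "y \<notin> U"
  obtain V where V: "open V" "cone_convex V" "x \<in> V" "V \<subseteq> U"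
    using lc U unfolding locally_convex_def neighbourhood_base_of open_openin[symmetric] by blast
  then have "y \<notin> V" using y by blast
  then obtain \<Lambda> where L: "\<Lambda> \<in> cone_dual" "\<Lambda> y \<le> 1" "\<And>z. z \<in> V \<Longrightarrow> 1 < \<Lambda> z"
    using separation[OF V(1,2)] by blast
  from L(3)[OF V(3)] le[OF L(1)] L(2) show False by simp
qed

lemma cone_dual_eqI:
  fixes x y :: "'a::topological_cone"
  assumes lc: "locally_convex TYPE('a)" and eq: "\<And>\<Lambda>. \<Lambda> \<in> cone_dual \<Longrightarrow> \<Lambda> x = \<Lambda> y"
  shows "x = y"
proof (rule ccontr)
  assume "x \<noteq> y"
  then obtain U where "open U" "\<not> (x \<in> U \<longleftrightarrow> y \<in> U)" using separation_t0 by blast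
  moreover have "\<And>\<Lambda>. \<Lambda> \<in> cone_dual \<Longrightarrow> \<Lambda> x \<le> \<Lambda> y" "\<And>\<Lambda>. \<Lambda> \<in> cone_dual \<Longrightarrow> \<Lambda> y \<le> \<Lambda> x"
    by (simp_all only: eq order_refl)
  ultimately show False using cone_dual_separates[OF lc] by blast
qed

section \<open>Filtered families of compact sets in sober spaces\<close>

text \<open>A minimal closed subset of \<open>F\<close> that meets every member is irreducible
  because the family is filtered. Its generic point lies in every saturation: any point of
  \<open>A\<close> in the closure of \<open>x\<close> is below \<open>x\<close>.\<close>

lemma sober_filtered_compact_meets:
  fixes \<K> :: "'a::topological_space set set"
  assumes sober: "sober TYPE('a)" and ne: "\<K> \<noteq> {}"
    and comp: "\<And>A. A \<in> \<K> \<Longrightarrow> compact A"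
    and filt: "\<And>A B. A \<in> \<K> \<Longrightarrow> B \<in> \<K> \<Longrightarrow> \<exists>C\<in>\<K>. C \<subseteq> up A \<inter> up B"
    and F: "closed F" "\<And>A. A \<in> \<K> \<Longrightarrow> A \<inter> F \<noteq> {}"
  obtains x where "x \<in> F" "\<And>A. A \<in> \<K> \<Longrightarrow> x \<in> up A"
proof -
  define P where "P = {E. closed E \<and> E \<subseteq> F \<and> (\<forall>A\<in>\<K>. A \<inter> E \<noteq> {})}"
  have "\<exists>M\<in>P. \<forall>E\<in>P. E \<subseteq> M \<longrightarrow> E = M"
  proof (rule predicate_Zorn)
    show "partial_order_on P (relation_of (\<lambda>M E. E \<subseteq> M) P)"
      by (rule partial_order_on_relation_ofI) auto
  next
    fix C assume C: "C \<in> Chains (relation_of (\<lambda>M E. E \<subseteq> M) P)"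
    have CP: "E \<in> P" if "E \<in> C" for E using C that by (auto simp: Chains_def relation_of_def)
    have chain: "D \<subseteq> E \<or> E \<subseteq> D" if "D \<in> C" "E \<in> C" for D E
      using C that by (auto simp: Chains_def relation_of_def)
    have FP: "F \<in> P" using F by (simp add: P_def)
    \<comment> \<open>Adjoining \<open>F\<close> to the chain also covers the empty chain and keeps
      the intersection inside \<open>F\<close>.\<close>
    have chain': "D \<subseteq> E \<or> E \<subseteq> D" if DE: "D \<in> insert F C" "E \<in> insert F C" for D E
    proof -
      have "D \<subseteq> F" "E \<subseteq> F" using DE CP by (auto simp: P_def)
      then show ?thesis using DE chain by (elim insertE) blast+
    qed
    have below: "\<exists>E\<in>insert F C. E \<subseteq> \<Inter>C'" if "finite C'" "C' \<subseteq> insert F C" for C'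
      using that
    proof (induction C' rule: finite_induct)
      case empty
      show ?case by blast
    next
      case (insert D C')
      then obtain E where E: "E \<in> insert F C" "E \<subseteq> \<Inter>C'" by blast
      have D: "D \<in> insert F C" using insert.prems by simp
      from chain'[OF D E(1)] show ?case
      proof
        assume "D \<subseteq> E"
        then show ?thesis using D E(2) by (intro bexI[of _ D]) auto
      next
        assume "E \<subseteq> D"
        then show ?thesis using E by (intro bexI[of _ E]) auto
      qed
    qed
    have "F \<inter> \<Inter>C \<in> P"
      unfolding P_def
    proof (intro CollectI conjI ballI)
      show "closed (F \<inter> \<Inter>C)" using F(1) CP by (intro closed_Int closed_Inter) (auto simp: P_def)
      fix A assume A: "A \<in> \<K>"
      have "A \<inter> \<Inter>(insert F C) \<noteq> {}"
      proof (rule compact_imp_fip[OF comp[OF A]])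
        show "closed E" if "E \<in> insert F C" for E using that F(1) CP by (auto simp: P_def)
        fix C' assume C': "finite C'" "C' \<subseteq> insert F C"
        then obtain E where "E \<in> insert F C" "E \<subseteq> \<Inter>C'" using below by blast
        moreover from this have "E \<in> P" using FP CP by blast
        then have "A \<inter> E \<noteq> {}" using A by (simp add: P_def)
        ultimately show "A \<inter> \<Inter>C' \<noteq> {}" by blast
      qed
      then show "A \<inter> (F \<inter> \<Inter>C) \<noteq> {}" by simp
    qed blast
    then show "\<exists>M\<in>P. \<forall>E\<in>C. M \<subseteq> E" by (rule bexI[rotated]) auto
  qed
  then obtain M where "M \<in> P" and min': "\<And>E. E \<in> P \<Longrightarrow> E \<subseteq> M \<Longrightarrow> E = M" by blast
  then have M: "closed M" "M \<subseteq> F" "\<And>A. A \<in> \<K> \<Longrightarrow> A \<inter> M \<noteq> {}"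
    by (auto simp: P_def)
  have min: "E = M" if "closed E" "E \<subseteq> M" "\<And>A. A \<in> \<K> \<Longrightarrow> A \<inter> E \<noteq> {}" for E
    using min'[of E] that M(2) by (auto simp: P_def)
  have "irreducible_closed M"
    unfolding irreducible_closed_def
  proof (intro conjI allI impI)
    show "closed M" by fact
    show "M \<noteq> {}" using ne M(3) by blast
    fix X Y :: "'a set" assume XY: "closed X" "closed Y" "M \<subseteq> X \<union> Y"
    show "M \<subseteq> X \<or> M \<subseteq> Y"
    proof (rule ccontr)
      \<comment> \<open>By minimality, a closed set that does not contain \<open>M\<close> cuts out
        of \<open>M\<close> a part that some member misses.\<close>
      have miss: "\<exists>A\<in>\<K>. A \<inter> (M \<inter> Z) = {}" if "closed Z" "\<not> M \<subseteq> Z" for Z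
        using min[of "M \<inter> Z"] closed_Int[OF M(1) that(1)] that(2) by auto
      assume "\<not> ?thesis"
      then have XY': "\<not> M \<subseteq> X" "\<not> M \<subseteq> Y" by blast+
      obtain A where A: "A \<in> \<K>" "A \<inter> (M \<inter> X) = {}" using miss[OF XY(1) XY'(1)] ..
      obtain B where B: "B \<in> \<K>" "B \<inter> (M \<inter> Y) = {}" using miss[OF XY(2) XY'(2)] ..
      obtain C where C: "C \<in> \<K>" "C \<subseteq> up A \<inter> up B" using filt[OF A(1) B(1)] ..
      obtain z where z: "z \<in> C" "z \<in> M" using M(3)[OF C(1)] by blast
      then have zA: "z \<in> up A" and zB: "z \<in> up B" using C(2) by blast+
      have "z \<in> X \<or> z \<in> Y" using XY(3) z(2) by blast
      then show False
        using up_Int_closed[OF zA closed_Int[OF M(1) XY(1)]] up_Int_closed[OF zB closed_Int[OF M(1) XY(2)]]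
          z(2) A(2) B(2) by auto
    qed
  qed
  then obtain x where x: "M = closure {x}" using sober by (auto simp: sober_def)
  have "x \<in> up A" if A: "A \<in> \<K>" for A
  proof -
    obtain k where k: "k \<in> A" "k \<in> closure {x}" using M(3)[OF A] x by blast
    have "x \<in> U" if "open U" "k \<in> U" for U
    proof (rule ccontr)
      assume "x \<notin> U"
      then have "closure {x} \<subseteq> - U" using that(1) by (intro closure_minimal) auto
      then show False using k(2) that(2) by blast
    qed
    then show ?thesis using k(1) by (auto simp: up_def)
  qed
  moreover have "x \<in> F" using M(2) x closure_subset[of "{x}"] by blast
  ultimately show ?thesis by (rule that[rotated])
qed

lemma sober_well_filtered:
  fixes \<K> :: "'a::topological_space set set"
  assumes "sober TYPE('a)" "\<K> \<noteq> {}" "\<And>A. A \<in> \<K> \<Longrightarrow> compact A"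
    and "\<And>A B. A \<in> \<K> \<Longrightarrow> B \<in> \<K> \<Longrightarrow> \<exists>C\<in>\<K>. C \<subseteq> up A \<inter> up B"
    and U: "open U" "(\<Inter>A\<in>\<K>. up A) \<subseteq> U"
  obtains A where "A \<in> \<K>" "A \<subseteq> U"
proof -
  have "\<exists>A\<in>\<K>. A \<subseteq> U"
  proof (rule ccontr)
    assume "\<not> ?thesis"
    then have "A \<inter> - U \<noteq> {}" if "A \<in> \<K>" for A using that by blast
    moreover have "closed (- U)" using U(1) by (rule closed_Compl)
    ultimately obtain x where "x \<in> - U" "\<And>A. A \<in> \<K> \<Longrightarrow> x \<in> up A"
      using sober_filtered_compact_meets[OF assms(1-4)] by blast
    then show False using U(2) by blast
  qed
  then show ?thesis using that by blast
qed

text \<open>By well-filteredness an open cover of the intersection already covers some member.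
  Finitely many sets of the cover suffice there, and being open they cover its saturation
  too.\<close>

lemma compact_Inter_up:
  fixes \<K> :: "'a::topological_space set set"
  assumes "sober TYPE('a)" "\<K> \<noteq> {}" and comp: "\<And>A. A \<in> \<K> \<Longrightarrow> compact A"
    and "\<And>A B. A \<in> \<K> \<Longrightarrow> B \<in> \<K> \<Longrightarrow> \<exists>C\<in>\<K>. C \<subseteq> up A \<inter> up B"
  shows "compact (\<Inter>A\<in>\<K>. up A)"
proof (rule compactI)
  fix \<C> assume \<C>: "\<forall>U\<in>\<C>. open U" "(\<Inter>A\<in>\<K>. up A) \<subseteq> \<Union>\<C>"
  then have "open (\<Union>\<C>)" by (intro open_Union) simp
  then obtain A where A: "A \<in> \<K>" "A \<subseteq> \<Union>\<C>" using sober_well_filtered[OF assms _ \<C>(2)] by blast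
  then obtain \<D> where D: "\<D> \<subseteq> \<C>" "finite \<D>" "A \<subseteq> \<Union>\<D>"
    using compactE[OF comp[OF A(1)] A(2)] \<C>(1) by metis
  then have "up A \<subseteq> \<Union>\<D>" using \<C>(1) by (intro up_subset_open) blast+
  then show "\<exists>\<D>\<subseteq>\<C>. finite \<D> \<and> (\<Inter>A\<in>\<K>. up A) \<subseteq> \<Union>\<D>" using A(1) D by blast
qed

section \<open>Splitting a valuation along an open set\<close>

lemma ennreal_SUP_add_SUP_le:
  fixes f :: "'i \<Rightarrow> ennreal" and g :: "'j \<Rightarrow> ennreal"
  assumes "I \<noteq> {}" "J \<noteq> {}" and le: "\<And>i j. i \<in> I \<Longrightarrow> j \<in> J \<Longrightarrow> f i + g j \<le> c"
  shows "(SUP i\<in>I. f i) + (SUP j\<in>J. g j) \<le> c"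
proof -
  have "(SUP i\<in>I. f i) + (SUP j\<in>J. g j) = (SUP j\<in>J. SUP i\<in>I. f i + g j)"
    using assms(1,2) by (simp add: ennreal_SUP_add_left ennreal_SUP_add_right)
  also have "\<dots> \<le> c" by (intro SUP_least le)
  finally show ?thesis .
qed

lift_definition val_in :: "'a::topological_space set \<Rightarrow> 'a valuation \<Rightarrow> 'a valuation"
  is "\<lambda>V \<nu> U. if open V \<and> open U then \<nu> (U \<inter> V) else 0"
proof (intro conjI allI impI)
  fix V :: "'a set" and \<nu> :: "'a set \<Rightarrow> ennreal"
  assume "continuous_valuation \<nu> \<and> (\<forall>U. \<not> open U \<longrightarrow> \<nu> U = 0)"
  then have c: "continuous_valuation \<nu>" by (rule conjunct1)
  show "continuous_valuation (\<lambda>U. if open V \<and> open U then \<nu> (U \<inter> V) else 0)"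
  proof (cases "open V")
    case V: True
    show ?thesis
      unfolding continuous_valuation_def
    proof (intro conjI allI impI)
      fix U U' :: "'a set" assume "open U" "open U'"
      moreover have "(U \<union> U') \<inter> V = (U \<inter> V) \<union> (U' \<inter> V)" "(U \<inter> U') \<inter> V = (U \<inter> V) \<inter> (U' \<inter> V)" by blast+
      ultimately show "(if open V \<and> open (U \<union> U') then \<nu> ((U \<union> U') \<inter> V) else 0) +
          (if open V \<and> open (U \<inter> U') then \<nu> (U \<inter> U' \<inter> V) else 0) =
          (if open V \<and> open U then \<nu> (U \<inter> V) else 0) + (if open V \<and> open U' then \<nu> (U' \<inter> V) else 0)"
        using V c by (simp add: open_Un open_Int continuous_valuation_def)
    next
      fix D :: "'a set set" assume D: "directed_opens D"
      have oD: "open U" if "U \<in> D" for U using D that by (simp add: directed_opens_def)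
      have "directed_opens ((\<lambda>U. U \<inter> V) ` D)"
        unfolding directed_opens_def
      proof (intro conjI ballI)
        fix U U' assume "U \<in> (\<lambda>U. U \<inter> V) ` D" "U' \<in> (\<lambda>U. U \<inter> V) ` D"
        then obtain X Y where XY: "X \<in> D" "Y \<in> D" "U = X \<inter> V" "U' = Y \<inter> V" by blast
        then obtain Z where "Z \<in> D" "X \<subseteq> Z" "Y \<subseteq> Z" using D unfolding directed_opens_def by metis
        then show "\<exists>W\<in>(\<lambda>U. U \<inter> V) ` D. U \<subseteq> W \<and> U' \<subseteq> W" using XY by blast
      qed (use D V oD in \<open>auto simp: directed_opens_def\<close>)
      then have "\<nu> (\<Union>((\<lambda>U. U \<inter> V) ` D)) = (SUP U\<in>(\<lambda>U. U \<inter> V) ` D. \<nu> U)"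
        using c unfolding continuous_valuation_def by blast
      moreover have "\<Union>((\<lambda>U. U \<inter> V) ` D) = \<Union>D \<inter> V" by blast
      ultimately have "\<nu> (\<Union>D \<inter> V) = (SUP U\<in>D. \<nu> (U \<inter> V))" by (simp only: image_image)
      moreover have "(SUP U\<in>D. if open V \<and> open U then \<nu> (U \<inter> V) else 0) = (SUP U\<in>D. \<nu> (U \<inter> V))"
        using V oD by (intro SUP_cong) simp_all
      ultimately show "(if open V \<and> open (\<Union>D) then \<nu> (\<Union>D \<inter> V) else 0) =
          (SUP U\<in>D. if open V \<and> open U then \<nu> (U \<inter> V) else 0)"
        using V oD by (simp add: open_Union)
    next
      fix U U' :: "'a set" assume "open U" "open U'" "U \<subseteq> U'"
      moreover from this have "open (U \<inter> V)" "open (U' \<inter> V)" "U \<inter> V \<subseteq> U' \<inter> V"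
        using V by (auto simp: open_Int)
      ultimately show "(if open V \<and> open U then \<nu> (U \<inter> V) else 0) \<le> (if open V \<and> open U' then \<nu> (U' \<inter> V) else 0)"
        using V c by (auto simp: continuous_valuation_def)
    qed (use c in \<open>simp add: continuous_valuation_def\<close>)
  next
    case False
    then show ?thesis by (simp add: continuous_valuation_def directed_opens_def)
  qed
qed simp

lemma val_val_in: "open V \<Longrightarrow> open U \<Longrightarrow> val (val_in V \<nu>) U = val \<nu> (U \<inter> V)"
  by transfer simp

text \<open>The part of \<open>\<nu>\<close> outside \<open>V\<close>. On open sets \<open>U\<close> with \<open>\<nu> (U \<inter> V) = \<infinity>\<close> the mass of \<open>U - V\<close> is not
  determined by \<open>\<nu>\<close>; the supremum selects the least possible value.\<close>

definition diff_opens :: "'a::topological_space valuation \<Rightarrow> 'a set \<Rightarrow> 'a set \<Rightarrow> 'a set set" where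
  "diff_opens \<nu> V U = {W. open W \<and> W \<subseteq> U \<and> val \<nu> (W \<inter> V) < top}"

definition diff_val :: "'a::topological_space valuation \<Rightarrow> 'a set \<Rightarrow> 'a set \<Rightarrow> ennreal" where
  "diff_val \<nu> V U = (SUP W\<in>diff_opens \<nu> V U. val \<nu> W - val \<nu> (W \<inter> V))"

context
  fixes \<nu> :: "'a::topological_space valuation" and V :: "'a set"
  assumes V: "open V"
begin

lemma diff_opens_nonempty: "diff_opens \<nu> V U \<noteq> {}"
  using val_empty[of \<nu>] by (auto simp: diff_opens_def intro!: exI[of _ "{}"])

lemma val_eq_diff:
  assumes "open W"
  shows "val \<nu> W = (val \<nu> W - val \<nu> (W \<inter> V)) + val \<nu> (W \<inter> V)"
  using assms V by (intro diff_add_cancel_ennreal[symmetric] val_mono) auto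

text \<open>The mass of W - V is at most that of W' - V: modularity is applied to \<open>W\<close>
  and \<open>W' \<inter> V\<close>, whose intersection is \<open>W \<inter> V\<close>, and the
  finite masses inside \<open>V\<close> are cancelled.\<close>

lemma diff_mono:
  assumes W: "open W" "W \<subseteq> W'" "open W'" and fin: "val \<nu> (W' \<inter> V) < top"
  shows "val \<nu> W - val \<nu> (W \<inter> V) \<le> val \<nu> W' - val \<nu> (W' \<inter> V)"
proof -
  define a b a' b' where ab: "a = val \<nu> W - val \<nu> (W \<inter> V)" "b = val \<nu> (W \<inter> V)"
    "a' = val \<nu> W' - val \<nu> (W' \<inter> V)" "b' = val \<nu> (W' \<inter> V)"
  have e: "W \<inter> (W' \<inter> V) = W \<inter> V" using W(2) by blast
  have "b \<le> b'" unfolding ab using W V by (intro val_mono) auto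
  then have f: "b < top" "b' < top" using fin by (auto simp: ab)
  have "val \<nu> W + val \<nu> (W' \<inter> V) = val \<nu> (W \<union> (W' \<inter> V)) + val \<nu> (W \<inter> V)"
    using val_modular[of W "W' \<inter> V" \<nu>] W V by (simp add: e open_Int)
  also have "\<dots> \<le> val \<nu> W' + val \<nu> (W \<inter> V)"
    using W V by (intro add_right_mono val_mono) auto
  finally have "(a + b) + b' \<le> (a' + b') + b"
    unfolding ab using val_eq_diff[OF W(1)] val_eq_diff[OF W(3)] by simp
  then have "a + (b + b') \<le> a' + (b + b')" by (simp only: add_ac)
  then have "(b + b') + a \<le> (b + b') + a'" by (simp only: add.commute)
  moreover have "b + b' \<noteq> top" using f by auto
  ultimately have "a \<le> a'" by (simp only: ennreal_add_left_cancel_le infinity_ennreal_def) blast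
  then show ?thesis by (simp only: ab)
qed

lemma diff_val_fin:
  assumes "open U" "val \<nu> (U \<inter> V) < top"
  shows "diff_val \<nu> V U = val \<nu> U - val \<nu> (U \<inter> V)"
  unfolding diff_val_def
proof (rule antisym)
  show "(SUP W\<in>diff_opens \<nu> V U. val \<nu> W - val \<nu> (W \<inter> V)) \<le> val \<nu> U - val \<nu> (U \<inter> V)"
    using assms by (intro SUP_least diff_mono) (auto simp: diff_opens_def)
  show "val \<nu> U - val \<nu> (U \<inter> V) \<le> (SUP W\<in>diff_opens \<nu> V U. val \<nu> W - val \<nu> (W \<inter> V))"
    using assms by (intro SUP_upper) (auto simp: diff_opens_def)
qed

lemma val_eq_in_plus_diff:
  assumes "open U"
  shows "val \<nu> U = val \<nu> (U \<inter> V) + diff_val \<nu> V U"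
proof (cases "val \<nu> (U \<inter> V) < top")
  case True
  then show ?thesis using val_eq_diff[OF assms] diff_val_fin[OF assms] by (simp add: add.commute)
next
  case False
  moreover have "val \<nu> (U \<inter> V) \<le> val \<nu> U" using assms V by (intro val_mono) auto
  ultimately show ?thesis by (simp add: less_top[symmetric] top_unique)
qed

lemma diff_val_mono: "U \<subseteq> U' \<Longrightarrow> diff_val \<nu> V U \<le> diff_val \<nu> V U'"
  unfolding diff_val_def by (rule SUP_subset_mono) (auto simp: diff_opens_def)

lemma diff_val_eq_SUP: "diff_val \<nu> V U = (SUP W\<in>diff_opens \<nu> V U. diff_val \<nu> V W)"
  unfolding diff_val_def[of \<nu> V U] by (intro SUP_cong refl) (simp add: diff_opens_def diff_val_fin)

lemma diff_opens_Un:
  assumes "W \<in> diff_opens \<nu> V U" "W' \<in> diff_opens \<nu> V U'"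
  shows "W \<union> W' \<in> diff_opens \<nu> V (U \<union> U')"
proof -
  have W: "open W" "W \<subseteq> U" "val \<nu> (W \<inter> V) < top" and W': "open W'" "W' \<subseteq> U'" "val \<nu> (W' \<inter> V) < top"
    using assms by (auto simp: diff_opens_def)
  have e: "(W \<union> W') \<inter> V = (W \<inter> V) \<union> (W' \<inter> V)" by blast
  have "val \<nu> ((W \<union> W') \<inter> V) \<le> val \<nu> ((W \<inter> V) \<union> (W' \<inter> V)) + val \<nu> ((W \<inter> V) \<inter> (W' \<inter> V))"
    unfolding e by simp
  also have "\<dots> = val \<nu> (W \<inter> V) + val \<nu> (W' \<inter> V)"
    using W W' V by (intro val_modular) (simp_all add: open_Int)
  also have "\<dots> < top" using W W' by simp
  finally show ?thesis using W W' by (auto simp: diff_opens_def)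
qed

lemma diff_opens_mono: "W \<in> diff_opens \<nu> V U \<Longrightarrow> open W' \<Longrightarrow> W' \<subseteq> W \<Longrightarrow> W' \<subseteq> U' \<Longrightarrow> W' \<in> diff_opens \<nu> V U'"
  unfolding diff_opens_def
proof (intro CollectI conjI; elim CollectE conjE)
  assume "open W" "open W'" "W' \<subseteq> W" "val \<nu> (W \<inter> V) < top"
  moreover from this have "val \<nu> (W' \<inter> V) \<le> val \<nu> (W \<inter> V)" using V by (intro val_mono) auto
  ultimately show "val \<nu> (W' \<inter> V) < top" by simp
qed

lemma diff_val_modular_fin:
  assumes "W \<in> diff_opens \<nu> V UNIV" "W' \<in> diff_opens \<nu> V UNIV"
  shows "diff_val \<nu> V (W \<union> W') + diff_val \<nu> V (W \<inter> W') = diff_val \<nu> V W + diff_val \<nu> V W'"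
proof -
  have o: "open W" "open W'" using assms by (auto simp: diff_opens_def)
  have e: "(W \<union> W') \<inter> V = (W \<inter> V) \<union> (W' \<inter> V)" "(W \<inter> W') \<inter> V = (W \<inter> V) \<inter> (W' \<inter> V)" by blast+
  define a b where ab: "a = val \<nu> (W \<inter> V)" "b = val \<nu> (W' \<inter> V)"
  have f: "a + b \<noteq> top" using assms by (auto simp: diff_opens_def ab)
  have m: "val \<nu> ((W \<union> W') \<inter> V) + val \<nu> ((W \<inter> W') \<inter> V) = a + b"
    unfolding e ab using o V by (intro val_modular) (simp_all add: open_Int)
  have "(a + b) + (diff_val \<nu> V (W \<union> W') + diff_val \<nu> V (W \<inter> W')) = val \<nu> (W \<union> W') + val \<nu> (W \<inter> W')"
    using val_eq_in_plus_diff[of "W \<union> W'"] val_eq_in_plus_diff[of "W \<inter> W'"] o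
    unfolding m[symmetric] by (simp add: open_Un open_Int ac_simps)
  also have "\<dots> = val \<nu> W + val \<nu> W'" using o by (rule val_modular)
  also have "\<dots> = (a + b) + (diff_val \<nu> V W + diff_val \<nu> V W')"
    using val_eq_in_plus_diff[of W] val_eq_in_plus_diff[of W'] o by (simp add: ab ac_simps)
  finally show ?thesis using f by (metis ennreal_add_left_cancel infinity_ennreal_def)
qed

text \<open>On sets with finite mass inside \<open>V\<close> each law is obtained from that of
  \<open>\<nu>\<close> by cancellation; the supremum over such sets carries it to all open
  sets.\<close>

lemma continuous_valuation_diff:
  "continuous_valuation (\<lambda>U. if open U then diff_val \<nu> V U else 0)"
  unfolding continuous_valuation_def
proof (intro conjI allI impI)
  show "(if open {} then diff_val \<nu> V {} else 0) = 0"
    using diff_val_fin[of "{}"] by simp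
next
  fix U U' :: "'a set" assume U: "open U" "open U'"
  have "diff_val \<nu> V (U \<union> U') + diff_val \<nu> V (U \<inter> U') = diff_val \<nu> V U + diff_val \<nu> V U'"
  proof (rule antisym)
    show "diff_val \<nu> V (U \<union> U') + diff_val \<nu> V (U \<inter> U') \<le> diff_val \<nu> V U + diff_val \<nu> V U'"
      unfolding diff_val_eq_SUP[of "U \<union> U'"] diff_val_eq_SUP[of "U \<inter> U'"]
    proof (intro ennreal_SUP_add_SUP_le diff_opens_nonempty)
      fix W W' assume WW: "W \<in> diff_opens \<nu> V (U \<union> U')" "W' \<in> diff_opens \<nu> V (U \<inter> U')"
      \<comment> \<open>One set \<open>X\<close> replaces both test sets:
        \<open>X \<inter> U\<close> and \<open>X \<inter> U'\<close> have union \<open>X\<close>,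
        which contains \<open>W\<close>, and their intersection contains \<open>W'\<close>.\<close>
      define X where "X = W \<union> W'"
      have "X \<in> diff_opens \<nu> V ((U \<union> U') \<union> (U \<inter> U'))" unfolding X_def by (rule diff_opens_Un[OF WW])
      then have X: "X \<in> diff_opens \<nu> V (U \<union> U')" by (simp add: Un_absorb2 le_infI1)
      then have oX: "open X" and XU: "X = (X \<inter> U) \<union> (X \<inter> U')" by (auto simp: diff_opens_def)
      have fin: "X \<inter> U \<in> diff_opens \<nu> V UNIV" "X \<inter> U' \<in> diff_opens \<nu> V UNIV"
        using oX U by (auto intro!: diff_opens_mono[OF X] open_Int)
      have "diff_val \<nu> V W + diff_val \<nu> V W' \<le> diff_val \<nu> V ((X \<inter> U) \<union> (X \<inter> U')) + diff_val \<nu> V ((X \<inter> U) \<inter> (X \<inter> U'))"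
        using WW XU by (intro add_mono diff_val_mono) (auto simp: X_def diff_opens_def)
      also have "\<dots> = diff_val \<nu> V (X \<inter> U) + diff_val \<nu> V (X \<inter> U')"
        by (rule diff_val_modular_fin[OF fin])
      also have "\<dots> \<le> diff_val \<nu> V U + diff_val \<nu> V U'" by (intro add_mono diff_val_mono) auto
      finally show "diff_val \<nu> V W + diff_val \<nu> V W' \<le> diff_val \<nu> V U + diff_val \<nu> V U'" .
    qed
    show "diff_val \<nu> V U + diff_val \<nu> V U' \<le> diff_val \<nu> V (U \<union> U') + diff_val \<nu> V (U \<inter> U')"
      unfolding diff_val_eq_SUP[of U] diff_val_eq_SUP[of U']
    proof (intro ennreal_SUP_add_SUP_le diff_opens_nonempty)
      fix W W' assume WW: "W \<in> diff_opens \<nu> V U" "W' \<in> diff_opens \<nu> V U'"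
      then have "diff_val \<nu> V W + diff_val \<nu> V W' = diff_val \<nu> V (W \<union> W') + diff_val \<nu> V (W \<inter> W')"
        by (intro diff_val_modular_fin[symmetric]) (auto simp: diff_opens_def)
      also have "\<dots> \<le> diff_val \<nu> V (U \<union> U') + diff_val \<nu> V (U \<inter> U')"
        using WW by (intro add_mono diff_val_mono) (auto simp: diff_opens_def)
      finally show "diff_val \<nu> V W + diff_val \<nu> V W' \<le> diff_val \<nu> V (U \<union> U') + diff_val \<nu> V (U \<inter> U')" .
    qed
  qed
  then show "(if open (U \<union> U') then diff_val \<nu> V (U \<union> U') else 0) +
      (if open (U \<inter> U') then diff_val \<nu> V (U \<inter> U') else 0) =
      (if open U then diff_val \<nu> V U else 0) + (if open U' then diff_val \<nu> V U' else 0)"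
    using U by (simp add: open_Un open_Int)
next
  fix U U' :: "'a set" assume "open U" "open U'" "U \<subseteq> U'"
  then show "(if open U then diff_val \<nu> V U else 0) \<le> (if open U' then diff_val \<nu> V U' else 0)"
    by (simp add: diff_val_mono)
next
  fix D :: "'a set set" assume D: "directed_opens D"
  have oD: "open U" if "U \<in> D" for U using D that by (simp add: directed_opens_def)
  have ne: "D \<noteq> {}" using D by (simp add: directed_opens_def)
  have "diff_val \<nu> V (\<Union>D) = (SUP U\<in>D. diff_val \<nu> V U)"
  proof (rule antisym)
    show "(SUP U\<in>D. diff_val \<nu> V U) \<le> diff_val \<nu> V (\<Union>D)"
      by (intro SUP_least diff_val_mono) blast
    show "diff_val \<nu> V (\<Union>D) \<le> (SUP U\<in>D. diff_val \<nu> V U)"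
      unfolding diff_val_eq_SUP[of "\<Union>D"]
    proof (rule SUP_least)
      fix W assume W: "W \<in> diff_opens \<nu> V (\<Union>D)"
      then have oW: "open W" and WD: "W = (\<Union>U\<in>D. W \<inter> U)" and f: "val \<nu> (W \<inter> V) \<noteq> top"
        by (auto simp: diff_opens_def)
      \<comment> \<open>Continuity of \<open>\<nu>\<close> itself is used along the sets
        \<open>W \<inter> U\<close>; the mass of \<open>W \<inter> V\<close>, which is finite, is
        cancelled at the end.\<close>
      have "val \<nu> (W \<inter> V) + diff_val \<nu> V W = val \<nu> (\<Union>U\<in>D. W \<inter> U)"
        using val_eq_in_plus_diff[OF oW] WD by simp
      also have "\<dots> = (SUP U\<in>D. val \<nu> (W \<inter> U))"
      proof (rule val_SUP_directed[OF ne])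
        fix U U' assume "U \<in> D" "U' \<in> D"
        then obtain X where "X \<in> D" "U \<subseteq> X" "U' \<subseteq> X" using D unfolding directed_opens_def by metis
        then show "\<exists>X\<in>D. W \<inter> U \<subseteq> W \<inter> X \<and> W \<inter> U' \<subseteq> W \<inter> X" by blast
      qed (use oW oD in \<open>simp add: open_Int\<close>)
      also have "\<dots> \<le> (SUP U\<in>D. diff_val \<nu> V U + val \<nu> (W \<inter> V))"
      proof (rule SUP_mono)
        fix U assume U: "U \<in> D"
        have "val \<nu> (W \<inter> U) = val \<nu> (W \<inter> U \<inter> V) + diff_val \<nu> V (W \<inter> U)"
          using oW oD[OF U] by (intro val_eq_in_plus_diff open_Int)
        also have "\<dots> \<le> val \<nu> (W \<inter> V) + diff_val \<nu> V U"
          using oW oD[OF U] V by (intro add_mono val_mono diff_val_mono) auto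
        finally show "\<exists>U'\<in>D. val \<nu> (W \<inter> U) \<le> diff_val \<nu> V U' + val \<nu> (W \<inter> V)"
          using U by (auto simp: add.commute)
      qed
      also have "\<dots> = val \<nu> (W \<inter> V) + (SUP U\<in>D. diff_val \<nu> V U)"
        by (simp add: ennreal_SUP_add_left[OF ne] add.commute)
      finally show "diff_val \<nu> V W \<le> (SUP U\<in>D. diff_val \<nu> V U)" using f by simp
    qed
  qed
  moreover have "(SUP U\<in>D. if open U then diff_val \<nu> V U else 0) = (SUP U\<in>D. diff_val \<nu> V U)"
    using oD by (intro SUP_cong) simp_all
  ultimately show "(if open (\<Union>D) then diff_val \<nu> V (\<Union>D) else 0) = (SUP U\<in>D. if open U then diff_val \<nu> V U else 0)"
    using oD by (simp add: open_Union)
qed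

end

definition val_out :: "'a::topological_space set \<Rightarrow> 'a valuation \<Rightarrow> 'a valuation" where
  "val_out V \<nu> = Abs_valuation (\<lambda>U. if open U then diff_val \<nu> V U else 0)"

lemma val_val_out:
  assumes "open V" "open U"
  shows "val (val_out V \<nu>) U = diff_val \<nu> V U"
  unfolding val_out_def
  using continuous_valuation_diff[OF assms(1), of \<nu>] assms(2) by (subst Abs_valuation_inverse) simp_all

lemma val_split: "open V \<Longrightarrow> open U \<Longrightarrow> val \<nu> U = val (val_in V \<nu>) U + val (val_out V \<nu>) U"
  by (simp add: val_val_in val_val_out val_eq_in_plus_diff[symmetric])

lemma val_out_self: "open V \<Longrightarrow> val (val_out V \<nu>) V = 0"
  unfolding val_val_out diff_val_def by (auto simp: diff_opens_def inf_absorb1 bot_ennreal intro!: SUP_eq_const)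

lemma val_plus: "val (\<nu> + \<mu>) U = val \<nu> U + val \<mu> U"
  by transfer simp

lemma val_cscale: "val (a \<cdot> \<nu>) U = ennreal a * val \<nu> U"
  by transfer simp

lemma valuation_split: "open V \<Longrightarrow> \<nu> = val_in V \<nu> + val_out V \<nu>"
  by (rule valuation_eqI) (simp only: val_plus val_split[symmetric])

section \<open>Commutation of splittings\<close>

lemma val_in_in: "open V \<Longrightarrow> open W \<Longrightarrow> val_in V (val_in W \<nu>) = val_in W (val_in V \<nu>)"
  by (rule valuation_eqI) (simp add: val_val_in open_Int Int_ac)

text \<open>A test set on one side becomes one on the other side by intersection with
  \<open>W\<close>. Together with the commutation of two inner and of two outer parts, this allows a
  splitting to be pushed through another one.\<close>

lemma val_out_in:
  assumes V: "open V" and W: "open W"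
  shows "val_out V (val_in W \<nu>) = val_in W (val_out V \<nu>)"
proof (rule valuation_eqI)
  fix U :: "'a set" assume U: "open U"
  have e: "X \<inter> V \<inter> W = X \<inter> W \<inter> V" for X by blast
  have "diff_val (val_in W \<nu>) V U = diff_val \<nu> V (U \<inter> W)"
    unfolding diff_val_def
  proof (rule antisym)
    show "(SUP X\<in>diff_opens (val_in W \<nu>) V U. val (val_in W \<nu>) X - val (val_in W \<nu>) (X \<inter> V))
        \<le> (SUP X\<in>diff_opens \<nu> V (U \<inter> W). val \<nu> X - val \<nu> (X \<inter> V))"
    proof (rule SUP_mono)
      fix X assume "X \<in> diff_opens (val_in W \<nu>) V U"
      then show "\<exists>Y\<in>diff_opens \<nu> V (U \<inter> W). val (val_in W \<nu>) X - val (val_in W \<nu>) (X \<inter> V) \<le> val \<nu> Y - val \<nu> (Y \<inter> V)"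
        using V W by (intro bexI[of _ "X \<inter> W"]) (auto simp: diff_opens_def val_val_in open_Int e)
    qed
    show "(SUP X\<in>diff_opens \<nu> V (U \<inter> W). val \<nu> X - val \<nu> (X \<inter> V))
        \<le> (SUP X\<in>diff_opens (val_in W \<nu>) V U. val (val_in W \<nu>) X - val (val_in W \<nu>) (X \<inter> V))"
    proof (rule SUP_mono)
      fix X assume X: "X \<in> diff_opens \<nu> V (U \<inter> W)"
      then have "X \<inter> W = X" "X \<inter> V \<inter> W = X \<inter> V" by (auto simp: diff_opens_def)
      then show "\<exists>Y\<in>diff_opens (val_in W \<nu>) V U. val \<nu> X - val \<nu> (X \<inter> V) \<le> val (val_in W \<nu>) Y - val (val_in W \<nu>) (Y \<inter> V)"
        using X V W by (intro bexI[of _ X]) (auto simp: diff_opens_def val_val_in open_Int)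
    qed
  qed
  then show "val (val_out V (val_in W \<nu>)) U = val (val_in W (val_out V \<nu>)) U"
    using U V W by (simp add: val_val_out val_val_in open_Int)
qed

text \<open>Inclusion-exclusion for removing \<open>W\<close> and then \<open>V\<close>. With finite
  mass on \<open>X \<inter> (V \<union> W)\<close> it is an identity of reals, except that both
  sides are infinite when \<open>X\<close> has infinite mass.\<close>

lemma diff_val_Un:
  assumes V: "open V" and W: "open W" and X: "open X" and fin: "val \<nu> (X \<inter> (V \<union> W)) < top"
  shows "val (val_out W \<nu>) X - val (val_out W \<nu>) (X \<inter> V) = val \<nu> X - val \<nu> (X \<inter> (V \<union> W))"
proof -
  have o: "open (X \<inter> V)" "open (X \<inter> W)" "open (X \<inter> (V \<union> W))" using V W X by auto
  have le: "val \<nu> (X \<inter> W) \<le> val \<nu> (X \<inter> (V \<union> W))" "val \<nu> (X \<inter> V) \<le> val \<nu> (X \<inter> (V \<union> W))"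
    "val \<nu> (X \<inter> V \<inter> W) \<le> val \<nu> (X \<inter> (V \<union> W))" "val \<nu> (X \<inter> V \<inter> W) \<le> val \<nu> (X \<inter> V)"
    "val \<nu> (X \<inter> (V \<union> W)) \<le> val \<nu> X" "val \<nu> (X \<inter> W) \<le> val \<nu> X"
    using V W X by (auto intro!: val_mono)
  have f: "val \<nu> (X \<inter> W) < top" "val \<nu> (X \<inter> V \<inter> W) < top" "val \<nu> (X \<inter> V) < top"
    using le fin by (auto intro: le_less_trans)
  have e: "X \<inter> (V \<union> W) = (X \<inter> V) \<union> (X \<inter> W)" "X \<inter> V \<inter> W = (X \<inter> V) \<inter> (X \<inter> W)" by blast+
  have m: "val \<nu> (X \<inter> (V \<union> W)) + val \<nu> (X \<inter> V \<inter> W) = val \<nu> (X \<inter> V) + val \<nu> (X \<inter> W)"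
    unfolding e using o by (intro val_modular)
  have "val (val_out W \<nu>) X = val \<nu> X - val \<nu> (X \<inter> W)"
    using W X f by (simp add: val_val_out diff_val_fin)
  moreover have "val (val_out W \<nu>) (X \<inter> V) = val \<nu> (X \<inter> V) - val \<nu> (X \<inter> V \<inter> W)"
    using W o f by (simp add: val_val_out diff_val_fin)
  moreover have "val \<nu> X - val \<nu> (X \<inter> W) - (val \<nu> (X \<inter> V) - val \<nu> (X \<inter> V \<inter> W)) = val \<nu> X - val \<nu> (X \<inter> (V \<union> W))"
  proof (cases "val \<nu> X = top")
    case True
    then show ?thesis using f fin by (simp add: less_top)
  next
    case False
    then obtain r where r: "val \<nu> X = ennreal r" "0 \<le> r" by (cases "val \<nu> X") auto
    obtain s where s: "val \<nu> (X \<inter> W) = ennreal s" "0 \<le> s" using f(1) by (cases "val \<nu> (X \<inter> W)") auto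
    obtain t where t: "val \<nu> (X \<inter> V) = ennreal t" "0 \<le> t" using f(3) by (cases "val \<nu> (X \<inter> V)") auto
    obtain u where u: "val \<nu> (X \<inter> V \<inter> W) = ennreal u" "0 \<le> u" using f(2) by (cases "val \<nu> (X \<inter> V \<inter> W)") auto
    obtain v where v: "val \<nu> (X \<inter> (V \<union> W)) = ennreal v" "0 \<le> v" using fin by (cases "val \<nu> (X \<inter> (V \<union> W))") auto
    have "v + u = t + s" using m s t u v by (simp flip: ennreal_plus)
    moreover have "u \<le> t" "v \<le> r" "s \<le> r" using le s t u v r by (simp_all add: ennreal_le_iff)
    ultimately show ?thesis unfolding r(1) s(1) t(1) u(1) v(1) using s t u v r
      by (simp add: ennreal_minus algebra_simps)
  qed
  ultimately show ?thesis by simp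
qed

text \<open>The right-hand side is symmetric in \<open>V\<close> and \<open>W\<close>, so outer
  parts commute. The delicate inequality concerns test sets of the iterated part, which may have
  infinite mass inside \<open>W\<close>.\<close>

lemma val_out_out_Un:
  assumes V: "open V" and W: "open W"
  shows "val_out V (val_out W \<nu>) = val_out (V \<union> W) \<nu>"
proof (rule valuation_eqI)
  fix U :: "'a set" assume U: "open U"
  have VW: "open (V \<union> W)" using V W by (rule open_Un)
  have "diff_val (val_out W \<nu>) V U = diff_val \<nu> (V \<union> W) U"
  proof (rule antisym)
    show "diff_val \<nu> (V \<union> W) U \<le> diff_val (val_out W \<nu>) V U"
      unfolding diff_val_def
    proof (rule SUP_mono)
      fix X assume X: "X \<in> diff_opens \<nu> (V \<union> W) U"
      have o: "open X" and f: "val \<nu> (X \<inter> (V \<union> W)) < top" using X by (auto simp: diff_opens_def)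
      have "val (val_out W \<nu>) (X \<inter> V) \<le> val \<nu> (X \<inter> V)"
        using val_split[OF W, of "X \<inter> V" \<nu>] o V by (simp add: open_Int)
      also have "\<dots> \<le> val \<nu> (X \<inter> (V \<union> W))" using o V VW by (intro val_mono) auto
      finally have "X \<in> diff_opens (val_out W \<nu>) V U"
        using X f by (auto simp: diff_opens_def)
      then show "\<exists>Y\<in>diff_opens (val_out W \<nu>) V U.
          val \<nu> X - val \<nu> (X \<inter> (V \<union> W)) \<le> val (val_out W \<nu>) Y - val (val_out W \<nu>) (Y \<inter> V)"
        using diff_val_Un[OF V W o f] by (intro bexI[of _ X]) simp_all
    qed
    show "diff_val (val_out W \<nu>) V U \<le> diff_val \<nu> (V \<union> W) U"
      unfolding diff_val_eq_SUP[OF V, of _ U]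
    proof (rule SUP_least)
      fix X assume X: "X \<in> diff_opens (val_out W \<nu>) V U"
      then have oX: "open X" and f: "val (val_out W \<nu>) (X \<inter> V) < top" by (auto simp: diff_opens_def)
      have "diff_val (val_out W \<nu>) V X + val (val_out W \<nu>) (X \<inter> V) = val (val_out W \<nu>) X"
        using val_eq_in_plus_diff[OF V oX, of "val_out W \<nu>"] by (simp add: add.commute)
      \<comment> \<open>\<open>X\<close> is exhausted by sets \<open>Y\<close> with finite mass
        inside \<open>W\<close>; on these \<open>diff_val_Un\<close> applies.\<close>
      also have "\<dots> = (SUP Y\<in>diff_opens \<nu> W X. diff_val \<nu> W Y)"
        using W oX by (simp add: val_val_out diff_val_eq_SUP[symmetric])
      also have "\<dots> \<le> diff_val \<nu> (V \<union> W) U + val (val_out W \<nu>) (X \<inter> V)"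
      proof (rule SUP_least)
        fix Y assume Y: "Y \<in> diff_opens \<nu> W X"
        then have oY: "open Y" and YX: "Y \<subseteq> X" and fY: "val \<nu> (Y \<inter> W) < top" by (auto simp: diff_opens_def)
        have o: "open (Y \<inter> V)" "open (X \<inter> V)" using oX oY V by auto
        have le: "val (val_out W \<nu>) (Y \<inter> V) \<le> val (val_out W \<nu>) (X \<inter> V)"
          using o YX by (intro val_mono) auto
        have "val (val_in W \<nu>) (Y \<inter> V) \<le> val \<nu> (Y \<inter> W)"
          using o oY W by (simp add: val_val_in) (intro val_mono, auto)
        then have "val \<nu> (Y \<inter> V) < top"
          using le f fY val_split[OF W o(1), of \<nu>] by (auto intro: le_less_trans)
        moreover have "val \<nu> (Y \<inter> (V \<union> W)) \<le> val \<nu> (Y \<inter> V) + val \<nu> (Y \<inter> W)"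
        proof -
          have "Y \<inter> (V \<union> W) = (Y \<inter> V) \<union> (Y \<inter> W)" by blast
          then have "val \<nu> (Y \<inter> (V \<union> W)) \<le> val \<nu> ((Y \<inter> V) \<union> (Y \<inter> W)) + val \<nu> ((Y \<inter> V) \<inter> (Y \<inter> W))" by simp
          also have "\<dots> = val \<nu> (Y \<inter> V) + val \<nu> (Y \<inter> W)" using o oY W by (intro val_modular) auto
          finally show ?thesis .
        qed
        ultimately have f': "val \<nu> (Y \<inter> (V \<union> W)) < top" using fY by (auto intro: le_less_trans)
        have "diff_val \<nu> W Y = val (val_out W \<nu>) Y" using W oY by (simp add: val_val_out)
        also have "\<dots> = (val (val_out W \<nu>) Y - val (val_out W \<nu>) (Y \<inter> V)) + val (val_out W \<nu>) (Y \<inter> V)"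
          by (rule val_eq_diff[OF V oY])
        also have "\<dots> = (val \<nu> Y - val \<nu> (Y \<inter> (V \<union> W))) + val (val_out W \<nu>) (Y \<inter> V)"
          using diff_val_Un[OF V W oY f'] by simp
        also have "\<dots> \<le> diff_val \<nu> (V \<union> W) U + val (val_out W \<nu>) (X \<inter> V)"
        proof (rule add_mono[OF _ le])
          show "val \<nu> Y - val \<nu> (Y \<inter> (V \<union> W)) \<le> diff_val \<nu> (V \<union> W) U"
            unfolding diff_val_def using oY f' YX X by (intro SUP_upper) (auto simp: diff_opens_def)
        qed
        finally show "diff_val \<nu> W Y \<le> diff_val \<nu> (V \<union> W) U + val (val_out W \<nu>) (X \<inter> V)" .
      qed
      finally show "diff_val (val_out W \<nu>) V X \<le> diff_val \<nu> (V \<union> W) U"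
        using f by auto
    qed
  qed
  then show "val (val_out V (val_out W \<nu>)) U = val (val_out (V \<union> W) \<nu>) U"
    using U V W VW by (simp add: val_val_out)
qed

lemma val_out_out: "open V \<Longrightarrow> open W \<Longrightarrow> val_out V (val_out W \<nu>) = val_out W (val_out V \<nu>)"
  by (simp add: val_out_out_Un Un_commute)

section \<open>Linear functionals on the cone of valuations\<close>

subsection \<open>Lower semicontinuous functions\<close>

lemma lsc_SUP:
  assumes "\<And>i. i \<in> I \<Longrightarrow> lsc (f i)"
  shows "lsc (\<lambda>x. SUP i\<in>I. f i x)"
proof -
  have "{x. c < (SUP i\<in>I. f i x)} = (\<Union>i\<in>I. {x. c < f i x})" for c by (auto simp: less_SUP_iff)
  moreover have "open (\<Union>i\<in>I. {x. c < f i x})" for c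
    using assms by (intro open_UN ballI) (auto simp: lsc_iff)
  ultimately show ?thesis by (simp add: lsc_iff)
qed

lemma lsc_add:
  assumes f: "lsc f" and g: "lsc g"
  shows "lsc (\<lambda>x. f x + g x)"
proof -
  \<comment> \<open>The alternatives \<open>a = 0\<close> and \<open>b = 0\<close> are for summands
    with value 0, below which there is no strictly smaller number.\<close>
  have dec: "\<exists>a b. c < a + b \<and> (a < u \<or> a = 0) \<and> (b < v \<or> b = 0)" if c: "c < u + v" for c u v :: ennreal
  proof (cases "u = 0 \<or> v = 0")
    case True
    then show ?thesis
    proof
      assume "u = 0"
      with c obtain b where "c < b" "b < v" using dense[of c v] by auto
      then show ?thesis by (intro exI[of _ 0] exI[of _ b]) auto
    next
      assume "v = 0"
      with c obtain a where "c < a" "a < u" using dense[of c u] by auto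
      then show ?thesis by (intro exI[of _ a] exI[of _ 0]) auto
    qed
  next
    case False
    then have "0 \<in> {..<u}" "0 \<in> {..<v}" by (auto simp: zero_less_iff_neq_zero)
    then have ne: "{..<u} \<noteq> {}" "{..<v} \<noteq> {}" by blast+
    have s: "(SUP a\<in>{..<w}. a) = w" for w :: ennreal
      by (rule antisym) (auto intro!: SUP_least dense_le SUP_upper2)
    have "u + v \<le> (SUP b\<in>{..<v}. SUP a\<in>{..<u}. a + b)"
    proof -
      have "(SUP b\<in>{..<v}. SUP a\<in>{..<u}. a + b) = (SUP a\<in>{..<u}. a) + (SUP b\<in>{..<v}. b)"
        using ne ennreal_SUP_add_left[OF ne(1), of "\<lambda>a. a"] ennreal_SUP_add_right[OF ne(2), of u "\<lambda>b. b"]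
        by (simp add: s)
      then show ?thesis by (simp only: s)
    qed
    with c have "c < (SUP b\<in>{..<v}. SUP a\<in>{..<u}. a + b)" by (rule order_less_le_trans)
    then show ?thesis by (auto simp: less_SUP_iff)
  qed
  have "{x. c < f x + g x} = (\<Union>(a, b)\<in>{(a, b). c < a + b}. {x. a < f x \<or> a = 0} \<inter> {x. b < g x \<or> b = 0})" for c
  proof (intro set_eqI iffI)
    fix x assume "x \<in> {x. c < f x + g x}"
    then show "x \<in> (\<Union>(a, b)\<in>{(a, b). c < a + b}. {x. a < f x \<or> a = 0} \<inter> {x. b < g x \<or> b = 0})"
      using dec[of c "f x" "g x"] by auto
  next
    fix x assume "x \<in> (\<Union>(a, b)\<in>{(a, b). c < a + b}. {x. a < f x \<or> a = 0} \<inter> {x. b < g x \<or> b = 0})"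
    then obtain a b where ab: "c < a + b" "a < f x \<or> a = 0" "b < g x \<or> b = 0" by auto
    then have "a + b \<le> f x + g x" by (intro add_mono) auto
    then show "x \<in> {x. c < f x + g x}" using ab(1) by auto
  qed
  moreover have "open {x. a < f x \<or> a = 0}" "open {x. a < g x \<or> a = 0}" for a
    using f g by (cases "a = 0"; simp add: lsc_iff)+
  ultimately show ?thesis
    by (auto simp: lsc_iff intro!: open_UN open_Int)
qed

lemma lsc_zero: "lsc (\<lambda>_. 0)"
  by (simp add: lsc_iff)

lemma lsc_sum: "(\<And>i. i \<in> I \<Longrightarrow> lsc (f i)) \<Longrightarrow> lsc (\<lambda>x. \<Sum>i\<in>I. f i x)"
  by (induction I rule: infinite_finite_induct) (simp_all add: lsc_zero lsc_add)

lemma lsc_cmult: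
  assumes "lsc f"
  shows "lsc (\<lambda>x. ennreal a * f x)"
proof (cases "0 < a")
  case True
  have "c < ennreal a * y \<longleftrightarrow> ennreal (1 / a) * c < y" for c y
  proof -
    have e: "ennreal a * (ennreal (1 / a) * z) = z" "ennreal (1 / a) * (ennreal a * z) = z" for z
      using True by (simp_all add: mult.assoc[symmetric] ennreal_mult[symmetric])
    show ?thesis
      using ennreal_mult_strict_left_mono[of c "ennreal a * y" "ennreal (1 / a)"]
        ennreal_mult_strict_left_mono[of "ennreal (1 / a) * c" y "ennreal a"] True by (auto simp: e)
  qed
  then show ?thesis using assms by (simp add: lsc_iff)
next
  case False
  then show ?thesis by (simp add: ennreal_neg lsc_zero)
qed

text \<open>The dyadic formula writes the integral as a supremum of finite nonnegative combinations
  of masses of fixed open sets, each of them lower semicontinuous in \<open>x\<close>.\<close>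

lemma lsc_val_integral:
  assumes T: "\<And>U. open U \<Longrightarrow> lsc (\<lambda>x. val (T x) U)" and h: "lsc h"
  shows "lsc (\<lambda>x. val_integral (T x) h)"
  unfolding val_integral_eq_SUP[OF h]
  by (intro lsc_SUP lsc_cmult lsc_sum T lsc_open[OF h])

lemma open_vimage_valuation:
  fixes T :: "'b::topological_space \<Rightarrow> 'a::topological_space valuation"
  assumes T: "\<And>U. open U \<Longrightarrow> lsc (\<lambda>x. val (T x) U)" and S: "open S"
  shows "open (T -` S)"
  using S unfolding open_valuation_def
proof (induction rule: generate_topology.induct)
  case (Basis S)
  then obtain r U where "S = {\<nu>. ennreal r < val \<nu> U}" "open U" by blast
  then show ?case using T[of U] by (simp add: lsc_iff vimage_def)
qed (auto simp: vimage_Union vimage_Int)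

lemma open_valuation_basic:
  fixes \<nu> :: "'a::topological_space valuation"
  assumes "open S" "\<nu> \<in> S"
  obtains F where "finite F" "\<And>U r. (U, r) \<in> F \<Longrightarrow> open U \<and> 0 \<le> r \<and> ennreal r < val \<nu> U"
    and "\<And>\<mu>. (\<And>U r. (U, r) \<in> F \<Longrightarrow> ennreal r < val \<mu> U) \<Longrightarrow> \<mu> \<in> S"
proof -
  have "\<exists>F. finite F \<and> (\<forall>(U, r)\<in>F. open U \<and> 0 \<le> r \<and> ennreal r < val \<nu> U) \<and>
      (\<forall>\<mu>. (\<forall>(U, r)\<in>F. ennreal r < val \<mu> U) \<longrightarrow> \<mu> \<in> S)"
    using assms unfolding open_valuation_def
  proof (induction rule: generate_topology.induct)
    case UNIV
    show ?case by (intro exI[of _ "{}"]) auto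
  next
    case (Int A B)
    then obtain F G where "finite F" "\<forall>(U, r)\<in>F. open U \<and> 0 \<le> r \<and> ennreal r < val \<nu> U"
      "\<forall>\<mu>. (\<forall>(U, r)\<in>F. ennreal r < val \<mu> U) \<longrightarrow> \<mu> \<in> A"
      "finite G" "\<forall>(U, r)\<in>G. open U \<and> 0 \<le> r \<and> ennreal r < val \<nu> U"
      "\<forall>\<mu>. (\<forall>(U, r)\<in>G. ennreal r < val \<mu> U) \<longrightarrow> \<mu> \<in> B" by auto
    then show ?case by (intro exI[of _ "F \<union> G"]) (simp add: ball_Un)
  next
    case (UN K)
    then obtain A where A: "A \<in> K" "\<nu> \<in> A" by blast
    from UN.IH[OF A] obtain F where "finite F" "\<forall>(U, r)\<in>F. open U \<and> 0 \<le> r \<and> ennreal r < val \<nu> U"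
      "\<forall>\<mu>. (\<forall>(U, r)\<in>F. ennreal r < val \<mu> U) \<longrightarrow> \<mu> \<in> A" by blast
    then show ?case using A(1) by (intro exI[of _ F]) blast
  next
    case (Basis A)
    then obtain r U where "A = {\<nu>. ennreal r < val \<nu> U}" "0 \<le> r" "open U" by blast
    then show ?case using Basis by (intro exI[of _ "{(U, r)}"]) auto
  qed
  then obtain F where "finite F" "\<forall>(U, r)\<in>F. open U \<and> 0 \<le> r \<and> ennreal r < val \<nu> U"
    "\<forall>\<mu>. (\<forall>(U, r)\<in>F. ennreal r < val \<mu> U) \<longrightarrow> \<mu> \<in> S" by (elim exE conjE)
  then show ?thesis by (intro that[of F]) auto
qed

subsection \<open>Integrals as functions of the valuation\<close>

lemma borel_measurable_levels [measurable]:
  "lsc h \<Longrightarrow> (\<lambda>t. val \<nu> (h -` {ennreal t<..})) \<in> borel_measurable lborel"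
  using measurable_levels by simp

lemma val_integral_plus:
  assumes "lsc h"
  shows "val_integral (\<nu> + \<mu>) h = val_integral \<nu> h + val_integral \<mu> h"
  unfolding val_integral_def val_plus distrib_right
  using borel_measurable_levels[OF assms] by (intro nn_integral_add) simp_all

lemma val_integral_cscale:
  assumes "lsc h"
  shows "val_integral (a \<cdot> \<nu>) h = ennreal a * val_integral \<nu> h"
  unfolding val_integral_def val_cscale mult.assoc
  using borel_measurable_levels[OF assms] by (intro nn_integral_cmult) simp_all

lemma emeasure_below:
  "{t. 0 < t \<and> ennreal t < c} \<in> sets lborel" "emeasure lborel {t. 0 < t \<and> ennreal t < c} = c"
proof -
  have "{t. 0 < t \<and> ennreal t < c} \<in> sets lborel \<and> emeasure lborel {t. 0 < t \<and> ennreal t < c} = c"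
  proof (cases c)
    case (real r)
    then have "{t. 0 < t \<and> ennreal t < c} = {0<..<r}" by (auto simp: ennreal_less_iff)
    then show ?thesis using real by simp
  next
    case top
    then have "{t. 0 < t \<and> ennreal t < c} = {0<..}" by auto
    moreover have "emeasure lborel {0::real<..} = \<infinity>"
    proof -
      have "ennreal (real n) \<le> emeasure lborel {0::real<..}" for n
      proof -
        have "emeasure lborel {0<..<real n} \<le> emeasure lborel {0::real<..}" by (rule emeasure_mono) auto
        then show ?thesis by simp
      qed
      then have "(SUP n. ennreal (real n)) \<le> emeasure lborel {0::real<..}" by (intro SUP_least)
      then show ?thesis by (simp add: ennreal_SUP_of_nat_eq_top ennreal_of_nat_eq_real_of_nat[symmetric] top_unique)
    qed
    ultimately show ?thesis using top by simp
  qed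
  then show "{t. 0 < t \<and> ennreal t < c} \<in> sets lborel" "emeasure lborel {t. 0 < t \<and> ennreal t < c} = c"
    by blast+
qed

text \<open>Layer-cake comparison: \<open>a i * c i\<close> is the integral of the constant
  \<open>a i\<close> over the scalars t with 0 < t < \<open>c i\<close>, so it suffices to compare
  with the mass of each level set. Infinite values need no separate treatment.\<close>

lemma sum_mult_le_val_integral:
  fixes a c :: "'i \<Rightarrow> ennreal"
  assumes "finite I" and le: "\<And>t. (\<Sum>i\<in>{i\<in>I. t < c i}. a i) \<le> val \<nu> (h -` {t<..})"
  shows "(\<Sum>i\<in>I. a i * c i) \<le> val_integral \<nu> h"
proof -
  let ?A = "\<lambda>i. {t. 0 < t \<and> ennreal t < c i}"
  have "(\<Sum>i\<in>I. a i * c i) = (\<integral>\<^sup>+ t. (\<Sum>i\<in>I. a i * indicator (?A i) t) \<partial>lborel)"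
    by (subst nn_integral_sum) (simp_all add: nn_integral_cmult_indicator emeasure_below)
  also have "\<dots> \<le> val_integral \<nu> h"
    unfolding val_integral_def
  proof (rule nn_integral_mono)
    fix t :: real
    have "(\<Sum>i\<in>I. a i * indicator (?A i) t) = (\<Sum>i\<in>{i\<in>I. ennreal t < c i}. a i) * indicator {0<..} t"
      unfolding sum_distrib_right sum.inter_filter[OF assms(1)]
      by (intro sum.cong refl) (auto simp: indicator_def)
    also have "\<dots> \<le> val \<nu> (h -` {ennreal t<..}) * indicator {0<..} t" by (intro mult_right_mono le) simp
    finally show "(\<Sum>i\<in>I. a i * indicator (?A i) t) \<le> val \<nu> (h -` {ennreal t<..}) * indicator {0<..} t" .
  qed
  finally show ?thesis .
qed

lemma val_dirac: "open U \<Longrightarrow> val (dirac x) U = (if x \<in> U then 1 else 0)"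
  by transfer simp

lemma val_integral_dirac:
  assumes "lsc h"
  shows "val_integral (dirac x) h = h x"
proof -
  have "val_integral (dirac x) h = (\<integral>\<^sup>+ t. indicator {t. 0 < t \<and> ennreal t < h x} t \<partial>lborel)"
    unfolding val_integral_def
    by (intro nn_integral_cong) (auto simp: val_dirac lsc_open[OF assms] indicator_def)
  then show ?thesis by (simp add: emeasure_below)
qed

lemma lsc_val_dirac: "open U \<Longrightarrow> lsc (\<lambda>x. val (dirac x) U)"
proof -
  assume U: "open U"
  have "{x. c < val (dirac x) U} = (if c < 0 then UNIV else if c < 1 then U else {})" for c
    using U by (auto simp: val_dirac)
  then show ?thesis using U by (simp add: lsc_iff)
qed

text \<open>The outer part has no mass on \<open>V\<close>, so it gives \<open>V \<union> W\<close>
  and \<open>W\<close> the same mass.\<close>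

lemma val_Un_out:
  assumes V: "open V" and W: "open W"
  shows "val \<nu> (V \<union> W) = val \<nu> V + val (val_out V \<nu>) W"
proof -
  have "val (val_out V \<nu>) (V \<inter> W) \<le> val (val_out V \<nu>) V"
    using V W by (intro val_mono) auto
  then have "val (val_out V \<nu>) (V \<union> W) = val (val_out V \<nu>) W"
    using val_modular[OF V W, of "val_out V \<nu>"] by (simp add: val_out_self[OF V])
  then show ?thesis
    using val_split[OF V open_Un[OF V W], of \<nu>] V W by (simp add: val_val_in open_Un Int_absorb1)
qed

text \<open>A functional that is superadditive along splittings dominates an integral as soon as it does so
  locally: the integrand is built up from its level sets, and each of these from small open sets.\<close>

lemma local_domination:
  fixes E :: "'a::topological_space valuation \<Rightarrow> ennreal"
  assumes h: "lsc h"
    and split: "\<And>V \<kappa>. open V \<Longrightarrow> E (val_in V \<kappa>) + E (val_out V \<kappa>) \<le> E \<kappa>"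
    and loc: "\<And>x t. 0 \<le> t \<Longrightarrow> ennreal t < h x \<Longrightarrow>
      \<exists>W. open W \<and> x \<in> W \<and> (\<forall>\<kappa>. ennreal t * val \<kappa> W \<le> E \<kappa>)"
  shows "val_integral \<nu> h \<le> E \<nu>"
proof -
  have level: "ennreal t * val \<kappa> G \<le> E \<kappa>"
    if t: "0 \<le> t" and G: "open G" "\<And>x. x \<in> G \<Longrightarrow> ennreal t < h x" for t G \<kappa>
  proof -
    define D where "D = {W. open W \<and> (\<forall>\<kappa>. ennreal t * val \<kappa> W \<le> E \<kappa>)}"
    \<comment> \<open>Splitting along \<open>V\<close> charges \<open>V\<close> to the inner part
      and the rest of \<open>W\<close> to the outer part. Closure under unions makes
      \<open>D\<close> directed, so small sets add up to all of \<open>G\<close>.\<close>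
    have un: "V \<union> W \<in> D" if VW: "V \<in> D" "W \<in> D" for V W
    proof -
      have o: "open V" "open W" using VW by (auto simp: D_def)
      have "ennreal t * val \<kappa> (V \<union> W) \<le> E \<kappa>" for \<kappa>
      proof -
        have "ennreal t * val \<kappa> (V \<union> W) = ennreal t * val (val_in V \<kappa>) V + ennreal t * val (val_out V \<kappa>) W"
          using o by (simp add: val_Un_out val_val_in distrib_left)
        also have "\<dots> \<le> E (val_in V \<kappa>) + E (val_out V \<kappa>)"
          using VW by (intro add_mono) (auto simp: D_def)
        also have "\<dots> \<le> E \<kappa>" using o(1) by (rule split)
        finally show ?thesis .
      qed
      then show ?thesis using o by (auto simp: D_def)
    qed
    have "directed_opens D"
      unfolding directed_opens_def
    proof (intro conjI ballI)
      have "{} \<in> D" by (simp add: D_def)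
      then show "D \<noteq> {}" by blast
      show "open U" if "U \<in> D" for U using that by (simp add: D_def)
      show "\<exists>W\<in>D. U \<subseteq> W \<and> V \<subseteq> W" if "U \<in> D" "V \<in> D" for U V
        using un[OF that] by (intro bexI[of _ "U \<union> V"]) auto
    qed
    moreover have "G \<subseteq> \<Union>D" using loc[OF t] G(2) by (fastforce simp: D_def)
    moreover have "open (\<Union>D)" by (intro open_Union) (simp add: D_def)
    ultimately have "val \<kappa> G \<le> (SUP W\<in>D. val \<kappa> W)"
      using val_mono[OF G(1), of "\<Union>D" \<kappa>] by (simp add: val_Union_directed)
    then have "ennreal t * val \<kappa> G \<le> (SUP W\<in>D. ennreal t * val \<kappa> W)"
      by (simp add: SUP_mult_left_ennreal[symmetric] mult_left_mono)
    also have "\<dots> \<le> E \<kappa>" by (rule SUP_least) (simp add: D_def)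
    finally show ?thesis .
  qed
  have "ennreal (1 / 2 ^ n) * (\<Sum>k<m. val \<kappa> (h -` {ennreal (1 / 2 ^ n * real (Suc k))<..})) \<le> E \<kappa>" for n m \<kappa>
  proof (induction m arbitrary: \<kappa>)
    case 0
    then show ?case by simp
  next
    case (Suc m)
    define e where "e = 1 / (2 ^ n :: real)"
    \<comment> \<open>The highest level set \<open>V m\<close> lies inside all the others. Splitting
      along it collects its mass at the full height \<open>e * real (Suc m)\<close>, and the outer
      part is left with one level less.\<close>
    define V where "V k = h -` {ennreal (e * real (Suc k))<..}" for k
    have e0: "0 \<le> e" by (simp add: e_def)
    have oV: "open (V k)" for k unfolding V_def by (rule lsc_open[OF h])
    have "V m \<subseteq> V k" if "k \<le> m" for k
    proof -
      have "ennreal (e * real (Suc k)) \<le> ennreal (e * real (Suc m))"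
        using that e0 by (intro ennreal_leI mult_left_mono) simp_all
      then show ?thesis unfolding V_def by (auto intro: le_less_trans)
    qed
    then have vk: "val \<kappa> (V k) = val \<kappa> (V m) + val (val_out (V m) \<kappa>) (V k)" if "k \<le> m" for k
      using val_Un_out[OF oV oV, of \<kappa> m k] that by (simp add: Un_absorb1)
    have "(\<Sum>k<Suc m. val \<kappa> (V k)) = (\<Sum>k<m. val \<kappa> (V m) + val (val_out (V m) \<kappa>) (V k)) + val \<kappa> (V m)"
      unfolding sum.lessThan_Suc by (intro arg_cong2[where f = "(+)"] sum.cong refl vk) simp_all
    also have "\<dots> = of_nat (Suc m) * val \<kappa> (V m) + (\<Sum>k<m. val (val_out (V m) \<kappa>) (V k))"
      by (simp add: sum.distrib algebra_simps)
    finally have "ennreal e * (\<Sum>k<Suc m. val \<kappa> (V k)) =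
        ennreal (e * real (Suc m)) * val (val_in (V m) \<kappa>) (V m) + ennreal e * (\<Sum>k<m. val (val_out (V m) \<kappa>) (V k))"
      using e0 oV by (simp only: distrib_left mult.assoc[symmetric] ennreal_mult'[OF e0] ennreal_of_nat_eq_real_of_nat
          val_val_in inf.idem)
    also have "\<dots> \<le> E (val_in (V m) \<kappa>) + E (val_out (V m) \<kappa>)"
    proof (rule add_mono)
      show "ennreal (e * real (Suc m)) * val (val_in (V m) \<kappa>) (V m) \<le> E (val_in (V m) \<kappa>)"
        by (rule level) (use e0 oV in \<open>auto simp: V_def\<close>)
      show "ennreal e * (\<Sum>k<m. val (val_out (V m) \<kappa>) (V k)) \<le> E (val_out (V m) \<kappa>)"
        using Suc.IH by (simp only: e_def V_def)
    qed
    also have "\<dots> \<le> E \<kappa>" using oV by (rule split)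
    finally show ?case by (simp only: e_def V_def)
  qed
  then show ?thesis unfolding val_integral_eq_SUP[OF h] by (intro SUP_least)
qed

subsection \<open>The Schroeder-Simpson theorem\<close>

lemma ennreal_min_add_le: "min (a + b) m \<le> min a m + min b m" for a b m :: ennreal
proof (cases "a \<le> m \<and> b \<le> m")
  case True
  then show ?thesis by (simp add: min.coboundedI1)
next
  case False
  then have "m \<le> min a m + min b m" by (auto simp: min_def add_increasing add_increasing2)
  then show ?thesis by (rule min.coboundedI2)
qed

lemma ennreal_mult_le_dense:
  fixes t v e :: ennreal
  assumes "\<And>a. 0 < a \<Longrightarrow> ennreal a < v \<Longrightarrow> t * ennreal a \<le> e"
  shows "t * v \<le> e"
proof -
  have "v \<le> (SUP a\<in>{a. 0 < a \<and> ennreal a < v}. ennreal a)" (is "_ \<le> ?S")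
  proof (rule dense_le)
    fix z assume z: "z < v"
    then obtain a where a: "z = ennreal a" "0 \<le> a" by (cases z) auto
    show "z \<le> ?S"
      using a z by (cases "a = 0") (auto intro!: SUP_upper2[of a])
  qed
  then have "t * v \<le> t * ?S" by (rule mult_left_mono) simp
  also have "\<dots> \<le> e" unfolding SUP_mult_left_ennreal by (intro SUP_least) (use assms in auto)
  finally show ?thesis .
qed

context
  fixes f :: "'a::topological_space valuation \<Rightarrow> ennreal"
  assumes f_lsc: "lsc f" and f_add: "\<And>\<mu> \<nu>. f (\<mu> + \<nu>) = f \<mu> + f \<nu>"
    and f_scale: "\<And>a \<nu>. 0 \<le> a \<Longrightarrow> f (a \<cdot> \<nu>) = ennreal a * f \<nu>"
begin

lemma lsc_linear_dirac: "lsc (\<lambda>x. f (dirac x))"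
proof -
  have "open (dirac -` {\<nu>. c < f \<nu>})" for c
    using f_lsc by (intro open_vimage_valuation lsc_val_dirac) (simp_all add: lsc_iff)
  then show ?thesis by (simp add: lsc_iff vimage_def)
qed

text \<open>A basic neighbourhood of \<open>dirac x\<close> asks only for masses above numbers less
  than 1 on finitely many neighbourhoods of \<open>x\<close>. Mass at least 1 on their intersection
  is enough to lie in it, and homogeneity reduces any smaller positive mass to this case.\<close>

lemma integral_le_linear: "val_integral \<nu> (\<lambda>x. f (dirac x)) \<le> f \<nu>"
proof (rule local_domination[OF lsc_linear_dirac])
  show "f (val_in V \<kappa>) + f (val_out V \<kappa>) \<le> f \<kappa>" if "open V" for V \<kappa>
    using valuation_split[OF that, of \<kappa>] by (metis f_add order_refl)
next
  fix x t assume t: "0 \<le> (t::real)" "ennreal t < f (dirac x)"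
  have "open {\<nu>. ennreal t < f \<nu>}" using f_lsc by (simp add: lsc_iff)
  then obtain F where F: "finite F" "\<And>U r. (U, r) \<in> F \<Longrightarrow> open U \<and> 0 \<le> r \<and> ennreal r < val (dirac x) U"
    and sub: "\<And>\<mu>. (\<And>U r. (U, r) \<in> F \<Longrightarrow> ennreal r < val \<mu> U) \<Longrightarrow> \<mu> \<in> {\<nu>. ennreal t < f \<nu>}"
    using t(2) by (elim open_valuation_basic[where \<nu> = "dirac x"]) auto
  define W where "W = (\<Inter>(U, r)\<in>F. U)"
  have W: "open W" unfolding W_def using F by (intro open_INT) auto
  have xr: "x \<in> U \<and> ennreal r < 1" if "(U, r) \<in> F" for U r
    using F(2)[OF that] by (auto simp: val_dirac split: if_splits)
  have "x \<in> W" using xr by (auto simp: W_def)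
  moreover have "ennreal t * val \<kappa> W \<le> f \<kappa>" for \<kappa>
  proof -
    have a: "ennreal t * ennreal a \<le> f \<kappa>" if a: "0 < a" "ennreal a \<le> val \<kappa> W" for a
    proof -
      have "(1 / a) \<cdot> \<kappa> \<in> {\<nu>. ennreal t < f \<nu>}"
      proof (rule sub)
        fix U r assume Ur: "(U, r) \<in> F"
        have "1 = ennreal (1 / a) * ennreal a" using a(1) by (simp flip: ennreal_mult)
        also have "\<dots> \<le> ennreal (1 / a) * val \<kappa> W" using a(2) by (intro mult_left_mono) simp_all
        also have "\<dots> \<le> ennreal (1 / a) * val \<kappa> U"
          using W F(2)[OF Ur] Ur by (intro mult_left_mono val_mono) (auto simp: W_def)
        also have "\<dots> = val ((1 / a) \<cdot> \<kappa>) U" by (simp only: val_cscale)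
        finally have "1 \<le> val ((1 / a) \<cdot> \<kappa>) U" .
        moreover have "ennreal r < 1" using xr[OF Ur] by (rule conjunct2)
        ultimately show "ennreal r < val ((1 / a) \<cdot> \<kappa>) U" by (rule order_less_le_trans[rotated])
      qed
      then have "ennreal t \<le> ennreal (1 / a) * f \<kappa>" using a(1) by (simp add: f_scale)
      then have "ennreal a * ennreal t \<le> ennreal a * (ennreal (1 / a) * f \<kappa>)" by (rule mult_left_mono) simp
      also have "\<dots> = f \<kappa>" using a(1) by (simp add: mult.assoc[symmetric] ennreal_mult[symmetric])
      finally show ?thesis by (simp add: mult.commute)
    qed
    show ?thesis by (rule ennreal_mult_le_dense) (intro a less_imp_le)
  qed
  ultimately show "\<exists>W. open W \<and> x \<in> W \<and> (\<forall>\<kappa>. ennreal t * val \<kappa> W \<le> f \<kappa>)" using W by blast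
qed

text \<open>The valuation \<open>s\<close> obtained here is a finite combination of Dirac valuations, one in each cell of
  the Boolean algebra generated by \<open>\<U>\<close>.\<close>

lemma finite_dirac_approximation:
  assumes "finite \<U>" "\<And>U. U \<in> \<U> \<Longrightarrow> open U" "open G" and M: "0 \<le> M" and e: "0 < e"
  shows "\<exists>s. f s \<le> val_integral \<kappa> (\<lambda>x. f (dirac x)) + ennreal e \<and>
    (\<forall>V\<in>insert UNIV \<U>. min (val \<kappa> (V \<inter> G)) (ennreal M) \<le> val s (V \<inter> G))"
  using assms(1,2,3) e
proof (induction \<U> arbitrary: \<kappa> G e rule: finite_induct)
  case empty
  define h where "h = (\<lambda>x. f (dirac x))"
  \<comment> \<open>The truncation at \<open>M\<close> keeps the weight of the Dirac valuation
    finite.\<close>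
  define c where "c = min (val \<kappa> G) (ennreal M)"
  have "c \<le> ennreal M" by (simp add: c_def)
  then have "c < top" using ennreal_less_top order_le_less_trans by blast
  then obtain r where r: "c = ennreal r" "0 \<le> r" by (cases c) auto
  show ?case
  proof (cases "r = 0")
    case True
    have "f 0 = 0" using f_scale[of 0 0] by (simp add: cscale_zero_left)
    then show ?thesis using r True by (intro exI[of _ 0]) (auto simp: c_def)
  next
    case False
    then have r0: "0 < r" using r by simp
    then have G: "G \<noteq> {}" using r by (auto simp: c_def)
    define i where "i = (INF x\<in>G. h x)"
    have "(\<Sum>j\<in>{()}. c * i) \<le> val_integral \<kappa> h"
    proof (rule sum_mult_le_val_integral)
      fix t
      show "(\<Sum>j\<in>{j\<in>{()}. t < i}. c) \<le> val \<kappa> (h -` {t<..})"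
      proof (cases "t < i")
        case True
        then have "G \<subseteq> h -` {t<..}" unfolding i_def by (auto dest: less_INF_D)
        moreover have "open (h -` {t<..})" unfolding h_def by (rule lsc_open[OF lsc_linear_dirac])
        ultimately have "val \<kappa> G \<le> val \<kappa> (h -` {t<..})" using \<open>open G\<close> by (intro val_mono)
        then show ?thesis using True by (simp add: c_def min.coboundedI1)
      qed simp
    qed simp
    then have le: "c * i \<le> val_integral \<kappa> h" by simp
    obtain x where x: "x \<in> G" "c * h x \<le> val_integral \<kappa> h + ennreal e"
    proof (cases "i = top")
      case True
      then have "val_integral \<kappa> h = top" using le r r0 by (simp add: ennreal_mult_top top_unique)
      then show ?thesis using G that by auto
    next
      case False
      \<comment> \<open>The slack \<open>e / r\<close> in the choice of a nearly minimal point costs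
        exactly \<open>e\<close> once it is multiplied by the weight \<open>r\<close>.\<close>
      then have "i < i + ennreal (e / r)" using r0 \<open>0 < e\<close> by (simp add: less_top)
      then obtain x where x: "x \<in> G" "h x < i + ennreal (e / r)"
        unfolding i_def by (auto simp: INF_less_iff)
      have "c * h x \<le> c * (i + ennreal (e / r))" using x by (intro mult_left_mono) simp_all
      also have "\<dots> = c * i + ennreal e" using r0 \<open>0 < e\<close> by (simp add: r distrib_left flip: ennreal_mult)
      also have "\<dots> \<le> val_integral \<kappa> h + ennreal e" using le by simp
      finally show ?thesis using x(1) that by blast
    qed
    have "f (r \<cdot> dirac x) = c * h x" using r by (simp add: f_scale h_def)
    moreover have "val (r \<cdot> dirac x) G = c" using r x(1) \<open>open G\<close> by (simp add: val_cscale val_dirac)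
    ultimately show ?thesis using x(2) by (intro exI[of _ "r \<cdot> dirac x"]) (simp add: c_def h_def)
  qed
next
  case (insert U \<U>)
  have U: "open U" and o: "\<And>V. V \<in> \<U> \<Longrightarrow> open V" using insert.prems by auto
  let ?h = "\<lambda>x. f (dirac x)"
  \<comment> \<open>The inner part is approximated within \<open>G \<inter> U\<close>, so that the
    new set \<open>U\<close> is tested through the member \<open>UNIV\<close> of the smaller family.
    Each part may use half of the error.\<close>
  have "\<exists>s. f s \<le> val_integral (val_in U \<kappa>) ?h + ennreal (e / 2) \<and>
      (\<forall>V\<in>insert UNIV \<U>. min (val (val_in U \<kappa>) (V \<inter> (G \<inter> U))) (ennreal M) \<le> val s (V \<inter> (G \<inter> U)))"
    using o \<open>open G\<close> U \<open>0 < e\<close> by (intro insert.IH open_Int) simp_all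
  then obtain s1 where s1: "f s1 \<le> val_integral (val_in U \<kappa>) ?h + ennreal (e / 2)"
    "\<forall>V\<in>insert UNIV \<U>. min (val (val_in U \<kappa>) (V \<inter> (G \<inter> U))) (ennreal M) \<le> val s1 (V \<inter> (G \<inter> U))"
    by (elim exE conjE)
  have "\<exists>s. f s \<le> val_integral (val_out U \<kappa>) ?h + ennreal (e / 2) \<and>
      (\<forall>V\<in>insert UNIV \<U>. min (val (val_out U \<kappa>) (V \<inter> G)) (ennreal M) \<le> val s (V \<inter> G))"
    using o \<open>open G\<close> \<open>0 < e\<close> by (intro insert.IH) simp_all
  then obtain s2 where s2: "f s2 \<le> val_integral (val_out U \<kappa>) ?h + ennreal (e / 2)"
    "\<forall>V\<in>insert UNIV \<U>. min (val (val_out U \<kappa>) (V \<inter> G)) (ennreal M) \<le> val s2 (V \<inter> G)"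
    by (elim exE conjE)
  have "f (s1 + s2) \<le> val_integral \<kappa> ?h + ennreal e"
  proof -
    have "f (s1 + s2) \<le> (val_integral (val_in U \<kappa>) ?h + ennreal (e / 2)) + (val_integral (val_out U \<kappa>) ?h + ennreal (e / 2))"
      unfolding f_add using s1(1) s2(1) by (rule add_mono)
    also have "\<dots> = val_integral (val_in U \<kappa> + val_out U \<kappa>) ?h + (ennreal (e / 2) + ennreal (e / 2))"
      unfolding val_integral_plus[OF lsc_linear_dirac] by (simp only: add_ac)
    also have "ennreal (e / 2) + ennreal (e / 2) = ennreal e" using \<open>0 < e\<close> by (simp flip: ennreal_plus)
    finally show ?thesis using valuation_split[OF U, of \<kappa>] by simp
  qed
  moreover have "min (val \<kappa> (V \<inter> G)) (ennreal M) \<le> val (s1 + s2) (V \<inter> G)" if V: "V \<in> insert UNIV (insert U \<U>)" for V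
  proof -
    have oV: "open V" using V U o by auto
    have le1: "val s1 (V \<inter> (G \<inter> U)) \<le> val s1 (V \<inter> G)" using oV \<open>open G\<close> U by (intro val_mono) auto
    have in_eq: "val (val_in U \<kappa>) (V \<inter> (G \<inter> U)) = val (val_in U \<kappa>) (V \<inter> G)"
      using oV \<open>open G\<close> U by (simp add: val_val_in open_Int Int_ac)
    show ?thesis
    proof (cases "V = U")
      case True
      have "val (val_in U \<kappa>) (UNIV \<inter> (G \<inter> U)) = val \<kappa> (U \<inter> G)"
        using \<open>open G\<close> U by (simp add: val_val_in open_Int Int_ac)
      then have "min (val \<kappa> (U \<inter> G)) (ennreal M) \<le> val s1 (G \<inter> U)" using bspec[OF s1(2), of UNIV] by simp
      then show ?thesis using True by (simp add: val_plus Int_commute add_increasing2)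
    next
      case False
      then have V': "V \<in> insert UNIV \<U>" using V by blast
      have "min (val \<kappa> (V \<inter> G)) (ennreal M) =
          min (val (val_in U \<kappa>) (V \<inter> G) + val (val_out U \<kappa>) (V \<inter> G)) (ennreal M)"
        using val_split[OF U, of "V \<inter> G" \<kappa>] oV \<open>open G\<close> by (simp add: open_Int)
      also have "\<dots> \<le> min (val (val_in U \<kappa>) (V \<inter> G)) (ennreal M) + min (val (val_out U \<kappa>) (V \<inter> G)) (ennreal M)"
        by (rule ennreal_min_add_le)
      also have "\<dots> \<le> val s1 (V \<inter> G) + val s2 (V \<inter> G)"
        using bspec[OF s1(2) V'] bspec[OF s2(2) V'] le1 unfolding in_eq by (intro add_mono) (auto intro: order_trans)
      finally show ?thesis by (simp add: val_plus)
    qed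
  qed
  ultimately show ?case by blast
qed

theorem linear_eq_integral: "f \<nu> = val_integral \<nu> (\<lambda>x. f (dirac x))"
proof (rule antisym)
  show "f \<nu> \<le> val_integral \<nu> (\<lambda>x. f (dirac x))"
  proof (rule dense_le)
    fix c assume c: "c < f \<nu>"
    have "open {\<mu>. c < f \<mu>}" using f_lsc by (simp add: lsc_iff)
    then obtain F where F: "finite F" "\<And>U r. (U, r) \<in> F \<Longrightarrow> open U \<and> 0 \<le> r \<and> ennreal r < val \<nu> U"
      and sub: "\<And>\<mu>. (\<And>U r. (U, r) \<in> F \<Longrightarrow> ennreal r < val \<mu> U) \<Longrightarrow> \<mu> \<in> {\<mu>. c < f \<mu>}"
      using c by (elim open_valuation_basic[where \<nu> = \<nu>]) auto
    \<comment> \<open>\<open>M\<close> exceeds every bound \<open>r\<close> in the neighbourhood, so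
      the truncated masses still satisfy its conditions.\<close>
    define M where "M = (\<Sum>(U, r)\<in>F. r) + 1"
    have rM: "r < M" if "(U, r) \<in> F" for U r
    proof -
      have "(\<lambda>(U, r). r) (U, r) \<le> (\<Sum>(U, r)\<in>F. r)"
        using that F by (intro member_le_sum) auto
      then show ?thesis by (simp add: M_def)
    qed
    have M0: "0 \<le> M" using F(2) by (auto simp: M_def intro!: add_nonneg_nonneg sum_nonneg)
    show "c \<le> val_integral \<nu> (\<lambda>x. f (dirac x))"
    proof (rule ennreal_le_epsilon)
      fix e :: real assume "0 < e"
      have "\<exists>s. f s \<le> val_integral \<nu> (\<lambda>x. f (dirac x)) + ennreal e \<and>
          (\<forall>V\<in>insert UNIV (fst ` F). min (val \<nu> (V \<inter> UNIV)) (ennreal M) \<le> val s (V \<inter> UNIV))"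
        using F M0 \<open>0 < e\<close> by (intro finite_dirac_approximation) auto
      then obtain s where s: "f s \<le> val_integral \<nu> (\<lambda>x. f (dirac x)) + ennreal e"
        "\<And>V. V \<in> fst ` F \<Longrightarrow> min (val \<nu> V) (ennreal M) \<le> val s V"
        by (simp only: Int_UNIV_right) blast
      have "s \<in> {\<mu>. c < f \<mu>}"
      proof (rule sub)
        fix U r assume Ur: "(U, r) \<in> F"
        then have "ennreal r < min (val \<nu> U) (ennreal M)"
          using F(2)[OF Ur] rM[OF Ur] by (simp add: ennreal_less_iff)
        also have "\<dots> \<le> val s U" using Ur by (intro s(2)) force
        finally show "ennreal r < val s U" .
      qed
      then show "c \<le> val_integral \<nu> (\<lambda>x. f (dirac x)) + ennreal e" using s(1) by auto
    qed
  qed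
qed (rule integral_le_linear)

end

subsection \<open>Integrals and the monad structure\<close>

lemma val_val_join: "open U \<Longrightarrow> val (val_join \<phi>) U = val_integral \<phi> (\<lambda>\<nu>. val \<nu> U)"
  by (simp add: val_join.rep_eq)

lemma val_val_map: "continuous_on UNIV g \<Longrightarrow> open V \<Longrightarrow> val (val_map g \<nu>) V = val \<nu> (g -` V)"
  by (simp add: val_map.rep_eq)

lemma val_integral_map:
  assumes "continuous_on UNIV g" "lsc h"
  shows "val_integral (val_map g \<nu>) h = val_integral \<nu> (h \<circ> g)"
  unfolding val_integral_def using assms by (simp add: val_val_map lsc_open vimage_comp)

lemma val_join_plus: "val_join (\<phi> + \<psi>) = val_join \<phi> + val_join \<psi>"
  by (rule valuation_eqI) (simp only: val_val_join val_plus val_integral_plus[OF lsc_val])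

lemma val_join_cscale: "val_join (a \<cdot> \<phi>) = a \<cdot> val_join \<phi>"
  by (rule valuation_eqI) (simp only: val_val_join val_cscale val_integral_cscale[OF lsc_val])

lemma val_join_dirac: "val_join (dirac \<nu>) = \<nu>"
  by (rule valuation_eqI) (simp only: val_val_join val_integral_dirac[OF lsc_val])

lemma val_map_plus: "continuous_on UNIV g \<Longrightarrow> val_map g (\<mu> + \<nu>) = val_map g \<mu> + val_map g \<nu>"
  by (rule valuation_eqI) (simp add: val_val_map val_plus)

lemma val_map_cscale: "continuous_on UNIV g \<Longrightarrow> val_map g (a \<cdot> \<nu>) = a \<cdot> val_map g \<nu>"
  by (rule valuation_eqI) (simp add: val_val_map val_cscale)

lemma val_map_dirac: "continuous_on UNIV g \<Longrightarrow> val_map g (dirac x) = dirac (g x)"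
  by (rule valuation_eqI) (simp add: val_val_map val_dirac open_vimage)

lemma lsc_val_integral_id: "lsc h \<Longrightarrow> lsc (\<lambda>\<nu>. val_integral \<nu> h)"
  by (rule lsc_val_integral) (simp_all add: lsc_val)

text \<open>The Schroeder-Simpson theorem one level up: the left side is linear and lower
  semicontinuous in \<open>\<phi>\<close>, and its value at \<open>dirac \<nu>\<close> is
  \<open>val_integral \<nu> h\<close>.\<close>

lemma val_integral_join:
  assumes h: "lsc h"
  shows "val_integral (val_join \<phi>) h = val_integral \<phi> (\<lambda>\<nu>. val_integral \<nu> h)"
proof -
  have "lsc (\<lambda>\<phi>. val_integral (val_join \<phi>) h)"
    by (rule lsc_val_integral[OF _ h]) (simp add: val_val_join lsc_val_integral_id lsc_val)
  from linear_eq_integral[OF this, of \<phi>] show ?thesis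
    by (simp add: val_join_plus val_join_cscale val_join_dirac val_integral_plus val_integral_cscale h)
qed

section \<open>Compact sets that approximate the barycenter\<close>

text \<open>\<open>approximant \<nu> A\<close> means that \<open>A\<close> is a sum of sets \<open>a\<^sub>i \<cdot> Q\<^sub>i\<close>, where \<open>\<nu>\<close> has been split into
  pieces that give mass more than \<open>a\<^sub>i\<close> to the interior of the compact convex set \<open>Q\<^sub>i\<close>. The
  barycenter of \<open>\<nu>\<close> will be the least point of the intersection of all \<open>up A\<close>.\<close>

inductive approximant :: "'a::topological_cone valuation \<Rightarrow> 'a set \<Rightarrow> bool" where
  zero: "approximant \<nu> {0}"
| scale: "compact Q \<Longrightarrow> cone_convex Q \<Longrightarrow> 0 \<le> a \<Longrightarrow> ennreal a < val \<nu> (interior Q) \<Longrightarrow>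
    approximant \<nu> ((\<cdot>) a ` Q)"
| split: "open V \<Longrightarrow> approximant (val_in V \<nu>) A \<Longrightarrow> approximant (val_out V \<nu>) B \<Longrightarrow>
    approximant \<nu> (A + B)"

lemma compact_set_plus:
  fixes A B :: "'a::topological_cone set"
  assumes "compact A" "compact B"
  shows "compact (A + B)"
proof -
  have "continuous_on (A \<times> B) (\<lambda>p. fst p + snd p :: 'a)"
    by (intro continuous_on_add continuous_on_fst continuous_on_snd continuous_on_id)
  then have "compact ((\<lambda>p. fst p + snd p) ` (A \<times> B))"
    using assms by (intro compact_continuous_image compact_Times)
  moreover have "(\<lambda>p. fst p + snd p) ` (A \<times> B) = A + B" by (force simp: set_plus_def)
  ultimately show ?thesis by simp
qed

lemma compact_cscale:
  fixes Q :: "'a::topological_cone set"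
  assumes "compact Q" "0 \<le> a"
  shows "compact ((\<cdot>) a ` Q)"
proof -
  have "continuous_on UNIV ((\<cdot>) a :: 'a \<Rightarrow> 'a)"
    unfolding continuous_on_open_vimage[OF open_UNIV]
    by (simp add: vimage_def open_cscale_vimage[OF _ assms(2)])
  then show ?thesis
    using assms(1) continuous_on_subset by (blast intro: compact_continuous_image)
qed

lemma approximant_compact: "approximant \<nu> A \<Longrightarrow> compact A"
  by (induction rule: approximant.induct) (simp_all add: compact_set_plus compact_cscale)

lemma interior_nonempty_of_less:
  assumes "c < val \<nu> (interior Q)"
  shows "Q \<noteq> {}"
  using assms by auto

text \<open>Distributes a weight over the two parts of a splitting. Zero is a separate alternative
  because a part may have no mass, and nothing is strictly below that.\<close>

lemma ennreal_less_add_split: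
  assumes a: "0 \<le> a" "ennreal a < u + v \<or> a = 0"
  obtains b c where "0 \<le> b" "0 \<le> c" "a = b + c" "ennreal b < u \<or> b = 0" "ennreal c < v \<or> c = 0"
proof -
  consider "a = 0" | "ennreal a < u" | "u = 0" "ennreal a < v" | "u \<noteq> 0" "u \<le> ennreal a" "ennreal a < u + v"
    using a by (cases "a = 0"; cases "u = 0"; cases "ennreal a < u") (auto simp: not_less)
  then show ?thesis
  proof cases
    case 4
    have "u < top" using 4(2) ennreal_less_top order_le_less_trans by blast
    then obtain r where r: "u = ennreal r" "0 \<le> r" by (cases u) auto
    have ra: "0 < r" "r \<le> a" using 4 r a by (auto simp: order_less_le)
    have "ennreal (a - r) < v"
    proof (rule ccontr)
      assume "\<not> ?thesis"
      then have "u + v \<le> ennreal r + ennreal (a - r)" unfolding r(1) by (intro add_left_mono) simp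
      also have "\<dots> = ennreal a" using ra by (simp flip: ennreal_plus)
      finally show False using 4(3) by simp
    qed
    then obtain z where z: "ennreal (a - r) < z" "z < v" using dense by blast
    then obtain y where y: "z = ennreal y" "0 \<le> y" by (cases z) auto
    \<comment> \<open>An amount \<open>d\<close> of weight is moved from the first part to the
      second to make the first bound strict. The bound \<open>r\<close> keeps the first weight
      nonnegative, the other one keeps the second weight below \<open>v\<close>.\<close>
    define d where "d = min r (y - (a - r))"
    have "a - r < y" using z(1) y ra by (simp add: ennreal_less_iff)
    then have d: "0 < d" "d \<le> r" "a - r + d \<le> y" using ra by (auto simp: d_def)
    have "ennreal (a - r + d) \<le> z" unfolding y(1) using d by (intro ennreal_leI)
    then have "ennreal (a - r + d) < v" using z(2) by simp
    moreover have "ennreal (r - d) < u" using d ra by (simp add: r(1) ennreal_less_iff)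
    ultimately show ?thesis using d ra by (intro that[of "r - d" "a - r + d"]) simp_all
  qed (use a that[of a 0] that[of 0 a] that[of 0 0] in auto)
qed

section \<open>Common refinements of approximants\<close>

lemma approximant_scale:
  assumes "compact Q" "cone_convex Q" "Q \<noteq> {}" "0 \<le> a" "ennreal a < val \<nu> (interior Q) \<or> a = 0"
  obtains A where "approximant \<nu> A" "A \<subseteq> up ((\<cdot>) a ` Q)"
proof (cases "a = 0")
  case True
  then have "(\<cdot>) a ` Q = {0}" using assms(3) by (auto simp: cscale_zero_left)
  then show ?thesis by (intro that[OF approximant.zero]) (simp add: up_zero)
next
  case False
  then have "ennreal a < val \<nu> (interior Q)" using assms(5) by simp
  then show ?thesis by (rule that[OF approximant.scale[OF assms(1,2,4)] up_superset])
qed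

text \<open>Since splittings commute, the one along \<open>V\<close> can be moved to the root. At a
  leaf the weight is divided between the two parts, and convexity of \<open>Q\<close> puts the two
  pieces together again.\<close>

lemma approximant_restrict:
  assumes "approximant \<nu> B" "open V"
  shows "\<exists>B1 B2. approximant (val_in V \<nu>) B1 \<and> approximant (val_out V \<nu>) B2 \<and> B1 + B2 \<subseteq> up B"
  using assms(1)
proof (induction rule: approximant.induct)
  case (zero \<nu>)
  show ?case by (intro exI[of _ "{0}"]) (simp add: approximant.zero up_zero)
next
  case (scale Q a \<nu>)
  have "val \<nu> (interior Q) = val (val_in V \<nu>) (interior Q) + val (val_out V \<nu>) (interior Q)"
    using assms(2) by (intro val_split) simp_all
  then obtain b c where bc: "0 \<le> b" "0 \<le> c" "a = b + c" "ennreal b < val (val_in V \<nu>) (interior Q) \<or> b = 0"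
    "ennreal c < val (val_out V \<nu>) (interior Q) \<or> c = 0"
    using ennreal_less_add_split[OF scale(3), of "val (val_in V \<nu>) (interior Q)" "val (val_out V \<nu>) (interior Q)"]
      scale(4) by auto
  note ne = interior_nonempty_of_less[OF scale(4)]
  obtain B1 where B1: "approximant (val_in V \<nu>) B1" "B1 \<subseteq> up ((\<cdot>) b ` Q)"
    using approximant_scale[OF scale(1,2) ne bc(1,4)] .
  obtain B2 where B2: "approximant (val_out V \<nu>) B2" "B2 \<subseteq> up ((\<cdot>) c ` Q)"
    using approximant_scale[OF scale(1,2) ne bc(2,5)] .
  have "(\<cdot>) b ` Q + (\<cdot>) c ` Q \<subseteq> up ((\<cdot>) a ` Q)"
    using cone_convex_cscale_plus[OF scale(2) bc(1,2)] up_superset unfolding bc(3) by (rule order_trans)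
  then have "B1 + B2 \<subseteq> up ((\<cdot>) a ` Q)" by (rule set_plus_subset_up[OF B1(2) B2(2)])
  then show ?case using B1(1) B2(1) by blast
next
  case (split W \<nu> A B)
  obtain A1 A2 where A: "approximant (val_in V (val_in W \<nu>)) A1" "approximant (val_out V (val_in W \<nu>)) A2"
    "A1 + A2 \<subseteq> up A" using split.IH(1) by blast
  obtain B1 B2 where B: "approximant (val_in V (val_out W \<nu>)) B1" "approximant (val_out V (val_out W \<nu>)) B2"
    "B1 + B2 \<subseteq> up B" using split.IH(2) by blast
  note W = split.hyps(1)
  have "approximant (val_in V \<nu>) (A1 + B1)"
  proof (rule approximant.split[OF W])
    show "approximant (val_in W (val_in V \<nu>)) A1" using A(1) by (simp only: val_in_in[OF W assms(2)])
    show "approximant (val_out W (val_in V \<nu>)) B1" using B(1) by (simp only: val_out_in[OF W assms(2)])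
  qed
  moreover have "approximant (val_out V \<nu>) (A2 + B2)"
  proof (rule approximant.split[OF W])
    show "approximant (val_in W (val_out V \<nu>)) A2" using A(2) by (simp only: val_out_in[OF assms(2) W])
    show "approximant (val_out W (val_out V \<nu>)) B2" using B(2) by (simp only: val_out_out[OF W assms(2)])
  qed
  moreover have "(A1 + B1) + (A2 + B2) \<subseteq> up (A + B)"
  proof -
    have "(A1 + A2) + (B1 + B2) \<subseteq> up (A + B)"
      using A(3) B(3) up_superset by (rule set_plus_subset_up)
    then show ?thesis by (simp only: add_ac)
  qed
  ultimately show ?case by blast
qed

lemma compact_convex_nbhd:
  fixes x :: "'a::topological_cone"
  assumes "locally_convex_compact TYPE('a)" "open U" "x \<in> U"
  obtains Q where "compact Q" "cone_convex Q" "x \<in> interior Q" "Q \<subseteq> U"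
proof -
  have "\<exists>V Q. open V \<and> (compact Q \<and> cone_convex Q) \<and> x \<in> V \<and> V \<subseteq> Q \<and> Q \<subseteq> U"
    using assms(1)[unfolded locally_convex_compact_def neighbourhood_base_of open_openin[symmetric]]
      assms(2,3) by simp
  then obtain V Q where Q: "open V" "compact Q" "cone_convex Q" "x \<in> V" "V \<subseteq> Q" "Q \<subseteq> U"
    by (elim exE conjE)
  then have "x \<in> interior Q" using interior_maximal[of V Q] by blast
  then show ?thesis by (rule that[OF Q(2,3) _ Q(6)])
qed

text \<open>The intersection of two compact sets need not be compact, so
  \<open>Q \<inter> Q'\<close> cannot serve as a common piece. Instead \<open>G\<close> is filled
  with small compact convex sets, each of which lies in both.\<close>

lemma approximant_cover:
  fixes \<kappa> :: "'a::topological_cone valuation"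
  assumes lcc: "locally_convex_compact TYPE('a)" and G: "open G"
    and Q: "cone_convex Q" "Q \<noteq> {}" "G \<subseteq> Q" and Q': "cone_convex Q'" "Q' \<noteq> {}" "G \<subseteq> Q'"
    and c: "0 \<le> c" "ennreal c < val \<kappa> G \<or> c = 0"
  obtains A where "approximant \<kappa> A" "A \<subseteq> up ((\<cdot>) c ` Q)" "A \<subseteq> up ((\<cdot>) c ` Q')"
proof (cases "c = 0")
  case True
  then have "(\<cdot>) c ` Q = {0}" "(\<cdot>) c ` Q' = {0}" using Q(2) Q'(2) by (auto simp: cscale_zero_left)
  then show ?thesis by (intro that[OF approximant.zero]) (simp_all add: up_zero)
next
  case False
  \<comment> \<open>The weights that some approximant below both sets can carry. They add up along
    splittings because \<open>Q\<close> and \<open>Q'\<close> are convex, so their supremum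
    \<open>E\<close> is superadditive.\<close>
  define S where "S \<kappa> = {c. 0 \<le> c \<and> (\<exists>A. approximant \<kappa> A \<and> A \<subseteq> up ((\<cdot>) c ` Q) \<and> A \<subseteq> up ((\<cdot>) c ` Q'))}"
    for \<kappa> :: "'a valuation"
  define E where "E \<kappa> = (SUP c\<in>S \<kappa>. ennreal c)" for \<kappa> :: "'a valuation"
  have "(\<cdot>) 0 ` Q = {0}" "(\<cdot>) 0 ` Q' = {0}" using Q(2) Q'(2) by (auto simp: cscale_zero_left)
  then have S0: "0 \<in> S \<kappa>" for \<kappa>
    unfolding S_def using approximant.zero[of \<kappa>] by (auto simp: up_zero)
  have plus: "c1 + c2 \<in> S \<kappa>" if V: "open V" and c12: "c1 \<in> S (val_in V \<kappa>)" "c2 \<in> S (val_out V \<kappa>)" for V c1 c2 \<kappa>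
  proof -
    obtain A1 where A1: "0 \<le> c1" "approximant (val_in V \<kappa>) A1" "A1 \<subseteq> up ((\<cdot>) c1 ` Q)" "A1 \<subseteq> up ((\<cdot>) c1 ` Q')"
      using c12 by (auto simp: S_def)
    obtain A2 where A2: "0 \<le> c2" "approximant (val_out V \<kappa>) A2" "A2 \<subseteq> up ((\<cdot>) c2 ` Q)" "A2 \<subseteq> up ((\<cdot>) c2 ` Q')"
      using c12 by (auto simp: S_def)
    have "(\<cdot>) c1 ` P + (\<cdot>) c2 ` P \<subseteq> up ((\<cdot>) (c1 + c2) ` P)" if "cone_convex P" for P :: "'a set"
      using cone_convex_cscale_plus[OF that A1(1) A2(1)] up_superset by (rule order_trans)
    then have "A1 + A2 \<subseteq> up ((\<cdot>) (c1 + c2) ` Q)" "A1 + A2 \<subseteq> up ((\<cdot>) (c1 + c2) ` Q')"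
      using set_plus_subset_up[OF A1(3) A2(3)] set_plus_subset_up[OF A1(4) A2(4)] Q(1) Q'(1) by simp_all
    moreover have "approximant \<kappa> (A1 + A2)" using V A1(2) A2(2) by (rule approximant.split)
    ultimately show ?thesis using A1(1) A2(1) by (auto simp: S_def)
  qed
  \<comment> \<open>The mass of \<open>G\<close> enters as the integral of its characteristic
    function, written \<open>val (dirac x) G\<close>, in order to apply
    \<open>local_domination\<close>.\<close>
  have "val \<kappa> G = (\<Sum>i\<in>{()}. val \<kappa> G * 1)" by simp
  also have "\<dots> \<le> val_integral \<kappa> (\<lambda>x. val (dirac x) G)"
  proof (rule sum_mult_le_val_integral)
    fix t :: ennreal
    have "(\<lambda>x. val (dirac x) G) -` {t<..} = G" if "t < 1" using that G by (auto simp: val_dirac split: if_splits)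
    then show "(\<Sum>i\<in>{i\<in>{()}. t < 1}. val \<kappa> G) \<le> val \<kappa> ((\<lambda>x. val (dirac x) G) -` {t<..})"
      by (cases "t < 1") simp_all
  qed simp
  also have "\<dots> \<le> E \<kappa>"
  proof (rule local_domination[OF lsc_val_dirac[OF G]])
    fix V :: "'a set" and \<kappa> :: "'a valuation" assume V: "open V"
    show "E (val_in V \<kappa>) + E (val_out V \<kappa>) \<le> E \<kappa>"
      unfolding E_def[of "val_in V \<kappa>"] E_def[of "val_out V \<kappa>"]
    proof (rule ennreal_SUP_add_SUP_le)
      fix c1 c2 assume c12: "c1 \<in> S (val_in V \<kappa>)" "c2 \<in> S (val_out V \<kappa>)"
      then have "ennreal c1 + ennreal c2 = ennreal (c1 + c2)" by (simp add: S_def)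
      also have "\<dots> \<le> E \<kappa>" unfolding E_def using plus[OF V c12] by (rule SUP_upper)
      finally show "ennreal c1 + ennreal c2 \<le> E \<kappa>" .
    qed (use S0 in blast)+
  next
    fix x :: 'a and t :: real assume t: "0 \<le> t" "ennreal t < val (dirac x) G"
    then have x: "x \<in> G" and t1: "ennreal t \<le> 1" using G by (auto simp: val_dirac split: if_splits)
    obtain P where P: "compact P" "cone_convex P" "x \<in> interior P" "P \<subseteq> G"
      using lcc G x by (rule compact_convex_nbhd)
    have "ennreal t * val \<kappa> (interior P) \<le> E \<kappa>" for \<kappa>
    proof (rule ennreal_mult_le_dense)
      fix a assume a: "0 < a" "ennreal a < val \<kappa> (interior P)"
      have "(\<cdot>) a ` P \<subseteq> up ((\<cdot>) a ` Q)" "(\<cdot>) a ` P \<subseteq> up ((\<cdot>) a ` Q')"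
        using order_trans[OF image_mono up_superset] order_trans[OF P(4) Q(3)] order_trans[OF P(4) Q'(3)]
      by metis+
      then have "a \<in> S \<kappa>"
        unfolding S_def using approximant.scale[OF P(1,2) _ a(2)] a(1) by auto
      then have "ennreal a \<le> E \<kappa>" unfolding E_def by (rule SUP_upper)
      moreover have "ennreal t * ennreal a \<le> 1 * ennreal a" using t1 by (rule mult_right_mono) simp
      ultimately show "ennreal t * ennreal a \<le> E \<kappa>" by simp
    qed
    then show "\<exists>W. open W \<and> x \<in> W \<and> (\<forall>\<kappa>. ennreal t * val \<kappa> W \<le> E \<kappa>)"
      using P(3) open_interior by blast
  qed
  finally have "ennreal c < E \<kappa>" using c False by simp
  then obtain d where d: "d \<in> S \<kappa>" "ennreal c < ennreal d" unfolding E_def less_SUP_iff by blast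
  then have cd: "c \<le> d" using c(1) by (simp add: ennreal_less_iff)
  obtain A where A: "approximant \<kappa> A" "A \<subseteq> up ((\<cdot>) d ` Q)" "A \<subseteq> up ((\<cdot>) d ` Q')" using d(1) by (auto simp: S_def)
  have "up ((\<cdot>) d ` P) \<subseteq> up ((\<cdot>) c ` P)" for P :: "'a set"
    by (rule up_least[OF cscale_image_subset_up[OF c(1) cd]])
  then show ?thesis using A(2,3) by (intro that[OF A(1)]) (blast intro: order_trans)+
qed

text \<open>Weights are divided along the splittings of \<open>B\<close> until a single piece of
  \<open>B\<close> is compared with \<open>Q\<close>; that case carries the work.\<close>

lemma approximant_scale_filtered:
  fixes \<nu> :: "'a::topological_cone valuation"
  assumes lcc: "locally_convex_compact TYPE('a)"
    and Q: "compact Q" "cone_convex Q" "Q \<noteq> {}"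
    and B: "approximant \<nu> B" and a: "0 \<le> a" "ennreal a < val \<nu> (interior Q) \<or> a = 0"
  shows "\<exists>C. approximant \<nu> C \<and> C \<subseteq> up ((\<cdot>) a ` Q) \<and> C \<subseteq> up B"
  using B a
proof (induction arbitrary: a rule: approximant.induct)
  case (zero \<nu>)
  then show ?case using approximant_scale[OF Q, of a \<nu>] by (auto simp: up_zero)
next
  case (split V \<nu> A B)
  have "val \<nu> (interior Q) = val (val_in V \<nu>) (interior Q) + val (val_out V \<nu>) (interior Q)"
    using split.hyps(1) by (intro val_split) simp_all
  then obtain b c where bc: "0 \<le> b" "0 \<le> c" "a = b + c" "ennreal b < val (val_in V \<nu>) (interior Q) \<or> b = 0"
    "ennreal c < val (val_out V \<nu>) (interior Q) \<or> c = 0"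
    using ennreal_less_add_split[OF split.prems(1), of "val (val_in V \<nu>) (interior Q)" "val (val_out V \<nu>) (interior Q)"]
      split.prems(2) by auto
  obtain C where C: "approximant (val_in V \<nu>) C" "C \<subseteq> up ((\<cdot>) b ` Q)" "C \<subseteq> up A"
    using split.IH(1)[OF bc(1,4)] by blast
  obtain D where D: "approximant (val_out V \<nu>) D" "D \<subseteq> up ((\<cdot>) c ` Q)" "D \<subseteq> up B"
    using split.IH(2)[OF bc(2,5)] by blast
  have "(\<cdot>) b ` Q + (\<cdot>) c ` Q \<subseteq> up ((\<cdot>) a ` Q)"
    using cone_convex_cscale_plus[OF Q(2) bc(1,2)] up_superset unfolding bc(3) by (rule order_trans)
  then have "C + D \<subseteq> up ((\<cdot>) a ` Q)" by (rule set_plus_subset_up[OF C(2) D(2)])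
  moreover have "C + D \<subseteq> up (A + B)" using C(3) D(3) up_superset by (rule set_plus_subset_up)
  moreover have "approximant \<nu> (C + D)" using split.hyps(1) C(1) D(1) by (rule approximant.split)
  ultimately show ?case by blast
next
  case (scale Q' a' \<nu>)
  define G G' where "G = interior Q" "G' = interior Q'"
  have G: "open G" "open G'" by (simp_all add: G_G'_def)
  note ne' = interior_nonempty_of_less[OF scale(4)]
  \<comment> \<open>Three parts: \<open>?\<nu>11\<close> lives on \<open>G \<inter> G'\<close>,
    \<open>?\<nu>12\<close> on \<open>G\<close> outside \<open>G'\<close>, and
    \<open>?\<nu>2\<close> outside \<open>G\<close>. The weight of \<open>Q\<close> is shared by the
    first two, that of \<open>Q'\<close> by the first and the third.\<close>
  let ?\<nu>1 = "val_in G \<nu>" and ?\<nu>2 = "val_out G \<nu>"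
  let ?\<nu>11 = "val_in G' ?\<nu>1" and ?\<nu>12 = "val_out G' ?\<nu>1"
  have "val \<nu> G = val ?\<nu>11 G + val ?\<nu>12 G"
    using val_split[OF G(2,1), of ?\<nu>1] G by (simp add: val_val_in)
  then obtain a1 a2 where a12: "0 \<le> a1" "0 \<le> a2" "a = a1 + a2" "ennreal a1 < val ?\<nu>11 G \<or> a1 = 0"
    "ennreal a2 < val ?\<nu>12 G \<or> a2 = 0"
    using ennreal_less_add_split[OF scale(5), of "val ?\<nu>11 G" "val ?\<nu>12 G"] scale(6) by (auto simp: G_G'_def)
  have "val \<nu> G' = val ?\<nu>11 G' + val ?\<nu>2 G'"
    using val_split[OF G(1,2), of \<nu>] G by (simp add: val_val_in open_Int)
  then obtain b1 b2 where b12: "0 \<le> b1" "0 \<le> b2" "a' = b1 + b2" "ennreal b1 < val ?\<nu>11 G' \<or> b1 = 0"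
    "ennreal b2 < val ?\<nu>2 G' \<or> b2 = 0"
    using ennreal_less_add_split[OF scale(3), of "val ?\<nu>11 G'" "val ?\<nu>2 G'"] scale(4) by (auto simp: G_G'_def)
  \<comment> \<open>On the common part one approximant serves both sets, so the larger of the two
    weights is enough, and no mass is claimed twice.\<close>
  define c where "c = max a1 b1"
  have "val ?\<nu>11 G = val ?\<nu>11 (G \<inter> G')" "val ?\<nu>11 G' = val ?\<nu>11 (G \<inter> G')"
    using G by (simp_all add: val_val_in open_Int Int_ac)
  then have c: "0 \<le> c" "a1 \<le> c" "b1 \<le> c" "ennreal c < val ?\<nu>11 (G \<inter> G') \<or> c = 0"
    using a12 b12 by (auto simp: c_def max_def)
  have "G \<inter> G' \<subseteq> Q" "G \<inter> G' \<subseteq> Q'" using interior_subset by (auto simp: G_G'_def)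
  then obtain C where C: "approximant ?\<nu>11 C" "C \<subseteq> up ((\<cdot>) c ` Q)" "C \<subseteq> up ((\<cdot>) c ` Q')"
    using approximant_cover[OF lcc open_Int[OF G] Q(2,3) _ scale(2) ne' _ c(1,4)] by blast
  obtain D where D: "approximant ?\<nu>12 D" "D \<subseteq> up ((\<cdot>) a2 ` Q)"
    using approximant_scale[OF Q a12(2), of ?\<nu>12] a12(5) by (auto simp: G_G'_def)
  obtain F where F: "approximant ?\<nu>2 F" "F \<subseteq> up ((\<cdot>) b2 ` Q')"
    using approximant_scale[OF scale(1,2) ne' b12(2), of ?\<nu>2] b12(5) by (auto simp: G_G'_def)
  note Ca = order_trans[OF C(2) up_least[OF cscale_image_subset_up[OF a12(1) c(2)]]]
  note Cb = order_trans[OF C(3) up_least[OF cscale_image_subset_up[OF b12(1) c(3)]]]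
  have Qa: "(\<cdot>) a1 ` Q + (\<cdot>) a2 ` Q \<subseteq> up ((\<cdot>) a ` Q)"
    using cone_convex_cscale_plus[OF Q(2) a12(1,2)] up_superset unfolding a12(3) by (rule order_trans)
  have Qb: "(\<cdot>) b1 ` Q' + (\<cdot>) b2 ` Q' \<subseteq> up ((\<cdot>) a' ` Q')"
    using cone_convex_cscale_plus[OF scale(2) b12(1,2)] up_superset unfolding b12(3) by (rule order_trans)
  note CD = set_plus_subset_up[OF Ca D(2) Qa] and CF = set_plus_subset_up[OF Cb F(2) Qb]
  have "(C + D) + F \<subseteq> up (C + D)" by (rule set_plus_subset_up_left)
  also have "\<dots> \<subseteq> up ((\<cdot>) a ` Q)" by (rule up_least[OF CD])
  finally have 1: "(C + D) + F \<subseteq> up ((\<cdot>) a ` Q)" .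
  have "(C + F) + D \<subseteq> up (C + F)" by (rule set_plus_subset_up_left)
  also have "\<dots> \<subseteq> up ((\<cdot>) a' ` Q')" by (rule up_least[OF CF])
  finally have 2: "(C + D) + F \<subseteq> up ((\<cdot>) a' ` Q')" by (simp only: add_ac)
  have "approximant \<nu> ((C + D) + F)"
    by (rule approximant.split[OF G(1) approximant.split[OF G(2) C(1) D(1)] F(1)])
  then show ?case using 1 2 by blast
qed

text \<open>Restricting \<open>B\<close> along each splitting of \<open>A\<close> reduces the claim
  to a single piece of \<open>A\<close>.\<close>

lemma approximant_filtered:
  fixes \<nu> :: "'a::topological_cone valuation"
  assumes lcc: "locally_convex_compact TYPE('a)" and "approximant \<nu> A" "approximant \<nu> B"
  shows "\<exists>C. approximant \<nu> C \<and> C \<subseteq> up A \<and> C \<subseteq> up B"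
  using assms(2,3)
proof (induction arbitrary: B rule: approximant.induct)
  case (zero \<nu>)
  then show ?case by (intro exI[of _ B]) (simp add: up_zero up_superset)
next
  case (scale Q a \<nu>)
  then show ?case
    using approximant_scale_filtered[OF lcc scale(1,2) interior_nonempty_of_less[OF scale(4)]] by blast
next
  case (split V \<nu> A1 A2)
  obtain B1 B2 where B: "approximant (val_in V \<nu>) B1" "approximant (val_out V \<nu>) B2" "B1 + B2 \<subseteq> up B"
    using approximant_restrict[OF split.prems split.hyps(1)] by blast
  obtain C1 where C1: "approximant (val_in V \<nu>) C1" "C1 \<subseteq> up A1" "C1 \<subseteq> up B1" using split.IH(1)[OF B(1)] by blast
  obtain C2 where C2: "approximant (val_out V \<nu>) C2" "C2 \<subseteq> up A2" "C2 \<subseteq> up B2" using split.IH(2)[OF B(2)] by blast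
  have "C1 + C2 \<subseteq> up (A1 + A2)" using C1(2) C2(2) up_superset by (rule set_plus_subset_up)
  moreover have "C1 + C2 \<subseteq> up B" using C1(3) C2(3) B(3) by (rule set_plus_subset_up)
  moreover have "approximant \<nu> (C1 + C2)" using split.hyps(1) C1(1) C2(1) by (rule approximant.split)
  ultimately show ?case by blast
qed

text \<open>A Hall-type condition that replaces the splitting behind an approximant. Unlike splitting, which is
  not continuous in \<open>\<nu>\<close>, it survives small changes of \<open>\<nu>\<close>. Subfamilies are given by predicates rather
  than index sets, so that the condition passes to concatenations.\<close>

definition hall :: "'a::topological_space valuation \<Rightarrow> (real \<times> 'a set) list \<Rightarrow> bool" where
  "hall \<nu> qs \<longleftrightarrow> (\<forall>P. filter P qs \<noteq> [] \<longrightarrow>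
     ennreal (\<Sum>q\<leftarrow>filter P qs. fst q) < val \<nu> (\<Union>q\<in>set (filter P qs). interior (snd q)))"

definition weighted_sum :: "(real \<times> 'a::topological_cone set) list \<Rightarrow> 'a set" where
  "weighted_sum qs = (\<Sum>q\<leftarrow>qs. (\<cdot>) (fst q) ` snd q)"

text \<open>At a splitting, the pieces of a subfamily that come from the inner part are paid for by
  its mass, those from the outer part by the mass of the outer part; both masses only grow when
  passing to the union of all the interiors.\<close>

lemma approximant_hall:
  assumes "approximant \<nu> A"
  shows "\<exists>qs. A = weighted_sum qs \<and> (\<forall>q\<in>set qs. 0 \<le> fst q \<and> compact (snd q)) \<and> hall \<nu> qs"
  using assms
proof (induction rule: approximant.induct)
  case (zero \<nu>)
  show ?case by (intro exI[of _ "[]"]) (simp add: weighted_sum_def hall_def set_zero)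
next
  case (scale Q a \<nu>)
  then show ?case by (intro exI[of _ "[(a, Q)]"]) (simp add: weighted_sum_def hall_def)
next
  case (split V \<nu> A B)
  obtain qs where qs: "A = weighted_sum qs" "\<forall>q\<in>set qs. 0 \<le> fst q \<and> compact (snd q)" "hall (val_in V \<nu>) qs"
    using split.IH(1) by blast
  obtain rs where rs: "B = weighted_sum rs" "\<forall>q\<in>set rs. 0 \<le> fst q \<and> compact (snd q)" "hall (val_out V \<nu>) rs"
    using split.IH(2) by blast
  have "hall \<nu> (qs @ rs)"
    unfolding hall_def
  proof (intro allI impI)
    fix P assume ne: "filter P (qs @ rs) \<noteq> []"
    define s t where "s = (\<Sum>q\<leftarrow>filter P qs. fst q)" "t = (\<Sum>q\<leftarrow>filter P rs. fst q)"
    define X Y where "X = (\<Union>q\<in>set (filter P qs). interior (snd q))" "Y = (\<Union>q\<in>set (filter P rs). interior (snd q))"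
    have o: "open X" "open Y" by (auto simp: X_Y_def)
    have st: "0 \<le> s" "0 \<le> t" using qs(2) rs(2) by (auto simp: s_t_def intro!: sum_list_nonneg)
    \<comment> \<open>A subfamily may have no members on one side; that side contributes the sum 0,
      and strictness comes from the other side.\<close>
    have X: "ennreal s < val (val_in V \<nu>) X \<or> s = 0 \<and> filter P qs = []"
      using qs(3)[unfolded hall_def, rule_format, of P]
      by (cases "filter P qs = []") (simp_all add: s_t_def X_Y_def)
    have Y: "ennreal t < val (val_out V \<nu>) Y \<or> t = 0 \<and> filter P rs = []"
      using rs(3)[unfolded hall_def, rule_format, of P]
      by (cases "filter P rs = []") (simp_all add: s_t_def X_Y_def)
    have "ennreal (s + t) < val (val_in V \<nu>) X + val (val_out V \<nu>) Y"
    proof (cases "ennreal s < val (val_in V \<nu>) X \<and> ennreal t < val (val_out V \<nu>) Y")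
      case True
      have "ennreal (s + t) = ennreal s + ennreal t" using st by simp
      also have "\<dots> < ennreal s + val (val_out V \<nu>) Y"
        using True by (simp add: ennreal_add_left_cancel_less)
      also have "\<dots> \<le> val (val_in V \<nu>) X + val (val_out V \<nu>) Y" by (rule add_right_mono[OF less_imp_le[OF conjunct1[OF True]]])
      finally show ?thesis .
    next
      case False
      with X Y ne consider "s = 0" "ennreal t < val (val_out V \<nu>) Y" | "t = 0" "ennreal s < val (val_in V \<nu>) X"
        by auto
      then show ?thesis
        by cases (auto intro: order_less_le_trans add_increasing add_increasing2)
    qed
    also have "\<dots> \<le> val (val_in V \<nu>) (X \<union> Y) + val (val_out V \<nu>) (X \<union> Y)"
      using o by (intro add_mono val_mono) auto
    also have "\<dots> = val \<nu> (X \<union> Y)" using split.hyps(1) o by (intro val_split[symmetric]) auto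
    finally show "ennreal (\<Sum>q\<leftarrow>filter P (qs @ rs). fst q) < val \<nu> (\<Union>q\<in>set (filter P (qs @ rs)). interior (snd q))"
      by (simp add: s_t_def X_Y_def)
  qed
  then show ?case
    using qs(1,2) rs(1,2) by (intro exI[of _ "qs @ rs"]) (auto simp: weighted_sum_def)
qed

lemma open_hall: "open {\<nu>. hall \<nu> qs}"
proof -
  \<comment> \<open>Infinitely many predicates select only finitely many sublists, so the condition
    is a finite intersection of open ones.\<close>
  define S where "S = {filter P qs | P. filter P qs \<noteq> []}"
  have "S \<subseteq> {xs. set xs \<subseteq> set qs \<and> length xs \<le> length qs}" by (auto simp: S_def)
  then have "finite S" by (rule finite_subset) (rule finite_lists_length_le, simp)
  moreover have "{\<nu>. hall \<nu> qs} =
      (\<Inter>xs\<in>S. {\<nu>. ennreal (\<Sum>q\<leftarrow>xs. fst q) < val \<nu> (\<Union>q\<in>set xs. interior (snd q))})"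
    by (auto simp: hall_def S_def simp del: set_filter)
  ultimately show ?thesis by (simp only:) (intro open_INT ballI open_val_greater open_UN open_interior)
qed

section \<open>Functionals evaluated on approximants\<close>

lemma cone_dualD:
  assumes "\<Lambda> \<in> cone_dual"
  shows "lsc \<Lambda>" "\<Lambda> (x + y) = \<Lambda> x + \<Lambda> y" "0 \<le> a \<Longrightarrow> \<Lambda> (a \<cdot> x) = ennreal a * \<Lambda> x" "\<Lambda> 0 = 0"
proof -
  have s: "\<Lambda> (a \<cdot> x) = ennreal a * \<Lambda> x" if "0 \<le> a" for a x
    using assms that by (simp add: cone_dual_def)
  show "lsc \<Lambda>" "\<Lambda> (x + y) = \<Lambda> x + \<Lambda> y" using assms by (auto simp: cone_dual_def)
  show "\<Lambda> 0 = 0" using s[of 0 0] by (simp add: cscale_zero_left)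
  show "0 \<le> a \<Longrightarrow> \<Lambda> (a \<cdot> x) = ennreal a * \<Lambda> x" by (rule s)
qed

lemma weighted_sum_minimizer:
  assumes L: "\<Lambda> \<in> cone_dual" and qs: "\<forall>q\<in>set qs. 0 \<le> fst q \<and> compact (snd q) \<and> snd q \<noteq> {}"
  shows "\<exists>x\<in>weighted_sum qs. \<Lambda> x = (\<Sum>q\<leftarrow>qs. ennreal (fst q) * (INF y\<in>snd q. \<Lambda> y))"
  using qs
proof (induction qs)
  case Nil
  then show ?case using cone_dualD(4)[OF L] by (simp add: weighted_sum_def set_zero)
next
  case (Cons q qs)
  then obtain x where x: "x \<in> weighted_sum qs" "\<Lambda> x = (\<Sum>q\<leftarrow>qs. ennreal (fst q) * (INF y\<in>snd q. \<Lambda> y))" by auto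
  have q: "0 \<le> fst q" "compact (snd q)" "snd q \<noteq> {}" using Cons.prems by auto
  obtain z where z: "z \<in> snd q" "\<And>y. y \<in> snd q \<Longrightarrow> \<Lambda> z \<le> \<Lambda> y"
    using lsc_attains_inf[OF cone_dualD(1)[OF L] q(2,3)] by blast
  have "(INF y\<in>snd q. \<Lambda> y) = \<Lambda> z"
    using z by (intro antisym INF_lower INF_greatest)
  then have "\<Lambda> (fst q \<cdot> z + x) = (\<Sum>q\<leftarrow>q # qs. ennreal (fst q) * (INF y\<in>snd q. \<Lambda> y))"
    using cone_dualD(2,3)[OF L] q(1) x(2) by simp
  moreover have "fst q \<cdot> z + x \<in> weighted_sum (q # qs)"
    using z(1) x(1) by (auto simp: weighted_sum_def)
  ultimately show ?case by blast
qed

text \<open>The minimum of a functional on the sum is the weighted sum of its minima on the pieces.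
  The layer-cake comparison bounds this by the integral, with one instance of the Hall condition for
  each level.\<close>

lemma hall_imp_le_integral:
  assumes L: "\<Lambda> \<in> cone_dual" and qs: "\<forall>q\<in>set qs. 0 \<le> fst q \<and> compact (snd q)" and hall: "hall \<nu> qs"
  shows "\<exists>x\<in>weighted_sum qs. \<Lambda> x \<le> val_integral \<nu> \<Lambda>"
proof -
  have ne: "snd q \<noteq> {}" if "q \<in> set qs" for q
  proof
    assume e: "snd q = {}"
    have "filter (\<lambda>r. r = q) qs \<noteq> []" using that by (auto simp: filter_empty_conv)
    with hall have "ennreal (\<Sum>r\<leftarrow>filter (\<lambda>r. r = q) qs. fst r) <
        val \<nu> (\<Union>r\<in>set (filter (\<lambda>r. r = q) qs). interior (snd r))" unfolding hall_def by blast
    moreover have "(\<Union>r\<in>set (filter (\<lambda>r. r = q) qs). interior (snd r)) = {}" using e by auto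
    ultimately show False by (simp only: val_empty not_less_zero)
  qed
  define m where "m Q = (INF y\<in>Q. \<Lambda> y)" for Q
  obtain x where x: "x \<in> weighted_sum qs" "\<Lambda> x = (\<Sum>q\<leftarrow>qs. ennreal (fst q) * m (snd q))"
    using weighted_sum_minimizer[OF L, of qs] qs ne unfolding m_def by blast
  have "(\<Sum>q\<leftarrow>qs. ennreal (fst q) * m (snd q)) = (\<Sum>i\<in>{..<length qs}. ennreal (fst (qs ! i)) * m (snd (qs ! i)))"
    by (simp add: sum_list_sum_nth atLeast0LessThan)
  also have "\<dots> \<le> val_integral \<nu> \<Lambda>"
  proof (rule sum_mult_le_val_integral)
    fix t
    \<comment> \<open>The subfamily for level \<open>t\<close> consists of the pieces on which the
      infimum of the functional exceeds \<open>t\<close>; their interiors lie inside the level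
      set.\<close>
    define P where "P q \<longleftrightarrow> t < m (snd q)" for q :: "real \<times> 'a set"
    have "(\<Sum>i\<in>{i\<in>{..<length qs}. t < m (snd (qs ! i))}. ennreal (fst (qs ! i))) =
        (\<Sum>i<length qs. if P (qs ! i) then ennreal (fst (qs ! i)) else 0)"
      by (simp only: sum.inter_filter[OF finite_lessThan] P_def)
    also have "\<dots> = (\<Sum>q\<leftarrow>filter P qs. ennreal (fst q))"
      unfolding sum_list_map_filter' by (simp add: sum_list_sum_nth atLeast0LessThan)
    also have "\<dots> = ennreal (\<Sum>q\<leftarrow>filter P qs. fst q)"
    proof -
      have "(\<Sum>q\<leftarrow>rs. ennreal (fst q)) = ennreal (\<Sum>q\<leftarrow>rs. fst q)" if "\<forall>q\<in>set rs. 0 \<le> fst q"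
        for rs :: "(real \<times> 'a set) list"
        using that by (induction rs) (auto intro!: ennreal_plus[symmetric] sum_list_nonneg)
      then show ?thesis by (rule) (use qs in auto)
    qed
    also have "\<dots> \<le> val \<nu> (\<Lambda> -` {t<..})"
    proof (cases "filter P qs = []")
      case False
      have "(\<Union>q\<in>set (filter P qs). interior (snd q)) \<subseteq> \<Lambda> -` {t<..}"
      proof
        fix y assume "y \<in> (\<Union>q\<in>set (filter P qs). interior (snd q))"
        then obtain q where q: "P q" "y \<in> snd q" using interior_subset by fastforce
        have "m (snd q) \<le> \<Lambda> y" unfolding m_def using q(2) by (rule INF_lower)
        with q(1) show "y \<in> \<Lambda> -` {t<..}" by (simp add: P_def)
      qed
      then have "val \<nu> (\<Union>q\<in>set (filter P qs). interior (snd q)) \<le> val \<nu> (\<Lambda> -` {t<..})"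
        using lsc_open[OF cone_dualD(1)[OF L]] by (intro val_mono) auto
      moreover have "ennreal (\<Sum>q\<leftarrow>filter P qs. fst q) < val \<nu> (\<Union>q\<in>set (filter P qs). interior (snd q))"
        using hall False unfolding hall_def by blast
      ultimately show ?thesis by simp
    qed simp
    finally show "(\<Sum>i\<in>{i\<in>{..<length qs}. t < m (snd (qs ! i))}. ennreal (fst (qs ! i))) \<le> val \<nu> (\<Lambda> -` {t<..})" .
  qed simp
  finally show ?thesis using x(1) by (intro bexI[of _ x]) (simp_all only: x(2))
qed

lemma approximant_le_integral:
  assumes "approximant \<nu> A" "\<Lambda> \<in> cone_dual"
  shows "\<exists>x\<in>A. \<Lambda> x \<le> val_integral \<nu> \<Lambda>"
  using approximant_hall[OF assms(1)] hall_imp_le_integral[OF assms(2)] by blast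

text \<open>Approximants of the two parts of a splitting add up to one of the whole, and infima over
  sums are superadditive, so \<open>local_domination\<close> reduces the claim to one small compact
  convex neighbourhood of a point.\<close>

lemma integral_le_SUP_approximant:
  fixes \<nu> :: "'a::topological_cone valuation"
  assumes lcc: "locally_convex_compact TYPE('a)" and L: "\<Lambda> \<in> cone_dual"
  shows "val_integral \<nu> \<Lambda> \<le> (SUP A\<in>{A. approximant \<nu> A}. INF x\<in>A. \<Lambda> x)"
proof -
  define E where "E \<kappa> = (SUP A\<in>{A. approximant \<kappa> A}. INF x\<in>A. \<Lambda> x)" for \<kappa> :: "'a valuation"
  have "val_integral \<nu> \<Lambda> \<le> E \<nu>"
  proof (rule local_domination[OF cone_dualD(1)[OF L]])
    fix V :: "'a set" and \<kappa> :: "'a valuation" assume V: "open V"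
    show "E (val_in V \<kappa>) + E (val_out V \<kappa>) \<le> E \<kappa>"
      unfolding E_def[of "val_in V \<kappa>"] E_def[of "val_out V \<kappa>"]
    proof (rule ennreal_SUP_add_SUP_le)
      fix A B assume AB: "A \<in> {A. approximant (val_in V \<kappa>) A}" "B \<in> {A. approximant (val_out V \<kappa>) A}"
      have "(INF x\<in>A. \<Lambda> x) + (INF x\<in>B. \<Lambda> x) \<le> (INF x\<in>A + B. \<Lambda> x)"
      proof (rule INF_greatest)
        fix z assume "z \<in> A + B"
        then obtain x y where "z = x + y" "x \<in> A" "y \<in> B" by (rule set_plus_elim)
        then show "(INF x\<in>A. \<Lambda> x) + (INF x\<in>B. \<Lambda> x) \<le> \<Lambda> z"
          by (simp add: cone_dualD(2)[OF L] add_mono INF_lower)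
      qed
      also have "\<dots> \<le> E \<kappa>"
        unfolding E_def using AB approximant.split[OF V] by (intro SUP_upper) auto
      finally show "(INF x\<in>A. \<Lambda> x) + (INF x\<in>B. \<Lambda> x) \<le> E \<kappa>" .
    qed (use approximant.zero in blast)+
  next
    fix x t assume t: "0 \<le> (t::real)" "ennreal t < \<Lambda> x"
    have "open {y. ennreal t < \<Lambda> y}" using cone_dualD(1)[OF L] by (simp add: lsc_iff)
    then obtain Q where Q: "compact Q" "cone_convex Q" "x \<in> interior Q" "Q \<subseteq> {y. ennreal t < \<Lambda> y}"
      using compact_convex_nbhd[OF lcc, of "{y. ennreal t < \<Lambda> y}" x] t(2) by auto
    have "ennreal t * val \<kappa> (interior Q) \<le> E \<kappa>" for \<kappa>
    proof (rule ennreal_mult_le_dense)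
      fix a assume a: "0 < a" "ennreal a < val \<kappa> (interior Q)"
      have "ennreal t * ennreal a \<le> (INF y\<in>(\<cdot>) a ` Q. \<Lambda> y)"
      proof (rule INF_greatest)
        fix y assume "y \<in> (\<cdot>) a ` Q"
        then obtain z where z: "z \<in> Q" "y = a \<cdot> z" by blast
        then have "ennreal a * ennreal t \<le> ennreal a * \<Lambda> z" using Q(4) by (intro mult_left_mono) auto
        then show "ennreal t * ennreal a \<le> \<Lambda> y"
          using a(1) by (simp add: z(2) cone_dualD(3)[OF L] mult.commute)
      qed
      also have "\<dots> \<le> E \<kappa>"
        unfolding E_def using approximant.scale[OF Q(1,2) _ a(2)] a(1) by (intro SUP_upper) simp
      finally show "ennreal t * ennreal a \<le> E \<kappa>" .
    qed
    then show "\<exists>W. open W \<and> x \<in> W \<and> (\<forall>\<kappa>. ennreal t * val \<kappa> W \<le> E \<kappa>)"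
      using Q(3) open_interior by blast
  qed
  then show ?thesis by (simp only: E_def)
qed

section \<open>Existence and continuity of barycenters\<close>

definition approximant_Inter :: "'a::topological_cone valuation \<Rightarrow> 'a set" where
  "approximant_Inter \<nu> = (\<Inter>A\<in>{A. approximant \<nu> A}. up A)"

lemma integral_le_approximant_Inter:
  fixes \<nu> :: "'a::topological_cone valuation"
  assumes lcc: "locally_convex_compact TYPE('a)" and L: "\<Lambda> \<in> cone_dual" and x: "x \<in> approximant_Inter \<nu>"
  shows "val_integral \<nu> \<Lambda> \<le> \<Lambda> x"
proof -
  have "(INF y\<in>A. \<Lambda> y) \<le> \<Lambda> x" if A: "approximant \<nu> A" for A
  proof -
    have "x \<in> up A" using x A by (auto simp: approximant_Inter_def)
    then obtain y where "y \<in> A" "\<Lambda> y \<le> \<Lambda> x" using cone_dualD(1)[OF L] by (rule lsc_upE)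
    then show ?thesis by (rule INF_lower2)
  qed
  then have "(SUP A\<in>{A. approximant \<nu> A}. INF x\<in>A. \<Lambda> x) \<le> \<Lambda> x" by (intro SUP_least) simp
  with integral_le_SUP_approximant[OF lcc L] show ?thesis by (rule order_trans)
qed

context
  assumes lc: "locally_convex TYPE('a::topological_cone)"
    and lcc: "locally_convex_compact TYPE('a)"
    and sober: "sober TYPE('a)"
begin

lemma approximant_directed:
  fixes \<nu> :: "'a valuation"
  assumes "A \<in> {A. approximant \<nu> A}" "B \<in> {A. approximant \<nu> A}"
  shows "\<exists>C\<in>{A. approximant \<nu> A}. C \<subseteq> up A \<inter> up B"
  using approximant_filtered[OF lcc, of \<nu> A B] assms by auto

lemma approximant_family_nonempty: "{A. approximant \<nu> A} \<noteq> {}"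
  using approximant.zero by blast

lemma compact_approximant_Inter: "compact (approximant_Inter \<nu> :: 'a set)"
  unfolding approximant_Inter_def
  by (rule compact_Inter_up[OF sober approximant_family_nonempty])
    (use approximant_compact approximant_directed in blast)+

lemma approximant_Inter_meets:
  fixes \<nu> :: "'a valuation"
  assumes F: "closed F" "\<And>A. approximant \<nu> A \<Longrightarrow> A \<inter> F \<noteq> {}"
  obtains x where "x \<in> F" "x \<in> approximant_Inter \<nu>"
proof (rule sober_filtered_compact_meets[OF sober approximant_family_nonempty[of \<nu>] _ _ F(1)])
  show "compact A" if "A \<in> {A. approximant \<nu> A}" for A using that approximant_compact by blast
  show "A \<inter> F \<noteq> {}" if "A \<in> {A. approximant \<nu> A}" for A using that F(2) by blast
  show "thesis" if "x \<in> F" "\<And>A. A \<in> {A. approximant \<nu> A} \<Longrightarrow> x \<in> up A" for x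
    using that by (intro \<open>\<And>x. x \<in> F \<Longrightarrow> x \<in> approximant_Inter \<nu> \<Longrightarrow> thesis\<close>[of x]) (auto simp: approximant_Inter_def)
qed (rule approximant_directed)

lemma approximant_subset_open:
  fixes \<nu> :: "'a valuation"
  assumes U: "open U" "approximant_Inter \<nu> \<subseteq> U"
  obtains A where "approximant \<nu> A" "A \<subseteq> U"
proof (rule sober_well_filtered[OF sober approximant_family_nonempty[of \<nu>] _ _ U(1)])
  show "compact A" if "A \<in> {A. approximant \<nu> A}" for A using that approximant_compact by blast
  show "(\<Inter>A\<in>{A. approximant \<nu> A}. up A) \<subseteq> U" using U(2) by (simp only: approximant_Inter_def)
  show "thesis" if "A \<in> {A. approximant \<nu> A}" "A \<subseteq> U" for A using that \<open>\<And>A. approximant \<nu> A \<Longrightarrow> A \<subseteq> U \<Longrightarrow> thesis\<close> by blast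
qed (rule approximant_directed)

text \<open>On \<open>approximant_Inter \<nu>\<close> every functional is at least its integral, so a point where the sum of
  finitely many functionals is small enough attains equality for all of them at once.\<close>

lemma barycenter_exists:
  fixes \<nu> :: "'a valuation"
  shows "\<exists>x\<in>approximant_Inter \<nu>. is_barycenter \<nu> x"
proof -
  \<comment> \<open>A functional with infinite integral needs no upper bound; leaving it out makes
    the cancellation below possible.\<close>
  define \<F> where "\<F> = {\<Lambda>. \<Lambda> \<in> (cone_dual :: ('a \<Rightarrow> ennreal) set) \<and> val_integral \<nu> \<Lambda> < top}"
  have "approximant_Inter \<nu> \<inter> (\<Inter>\<Lambda>\<in>\<F>. {x. \<Lambda> x \<le> val_integral \<nu> \<Lambda>}) \<noteq> {}"
  proof (rule compact_imp_fip_image)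
    show "compact (approximant_Inter \<nu>)"
      by (rule compact_approximant_Inter)
    show "closed {x. \<Lambda> x \<le> val_integral \<nu> \<Lambda>}" if "\<Lambda> \<in> \<F>" for \<Lambda>
      using that by (intro lsc_closed_le cone_dualD(1)) (simp add: \<F>_def)
    fix I assume I: "finite I" "I \<subseteq> \<F>"
    define S where "S x = (\<Sum>\<Lambda>\<in>I. \<Lambda> x)" for x
    have S: "S \<in> cone_dual \<and> val_integral \<nu> S = (\<Sum>\<Lambda>\<in>I. val_integral \<nu> \<Lambda>)"
      using I unfolding S_def
    proof (induction I rule: finite_induct)
      case empty
      then show ?case by (simp add: cone_dual_def lsc_zero val_integral_def vimage_def)
    next
      case (insert \<Lambda> I)
      have L: "\<Lambda> \<in> cone_dual" using insert.prems by (auto simp: \<F>_def)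
      have IH: "(\<lambda>x. \<Sum>\<Lambda>\<in>I. \<Lambda> x) \<in> cone_dual" "val_integral \<nu> (\<lambda>x. \<Sum>\<Lambda>\<in>I. \<Lambda> x) = (\<Sum>\<Lambda>\<in>I. val_integral \<nu> \<Lambda>)"
        using insert by auto
      have "(\<lambda>x. \<Lambda> x + (\<Sum>\<Lambda>\<in>I. \<Lambda> x)) \<in> cone_dual"
        unfolding cone_dual_def
        using cone_dualD(2,3)[OF L] cone_dualD(2,3)[OF IH(1)] lsc_add[OF cone_dualD(1)[OF L] cone_dualD(1)[OF IH(1)]]
        by (simp add: distrib_left add_ac)
      moreover have "val_integral \<nu> (\<lambda>x. \<Lambda> x + (\<Sum>\<Lambda>\<in>I. \<Lambda> x)) = val_integral \<nu> \<Lambda> + (\<Sum>\<Lambda>\<in>I. val_integral \<nu> \<Lambda>)"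
        using val_integral_add[OF cone_dualD(1)[OF L] cone_dualD(1)[OF IH(1)]] IH(2) by simp
      ultimately show ?case using insert.hyps by simp
    qed
    have "closed {x. S x \<le> val_integral \<nu> S}" using S by (intro lsc_closed_le cone_dualD(1)) simp
    moreover have "A \<inter> {x. S x \<le> val_integral \<nu> S} \<noteq> {}" if "approximant \<nu> A" for A
      using approximant_le_integral[of \<nu> A S] S that by auto
    ultimately obtain x where "x \<in> {x. S x \<le> val_integral \<nu> S}" "x \<in> approximant_Inter \<nu>"
      by (rule approximant_Inter_meets)
    then have x: "S x \<le> val_integral \<nu> S" "x \<in> approximant_Inter \<nu>" by simp_all
    have "\<Lambda> x \<le> val_integral \<nu> \<Lambda>" if L: "\<Lambda> \<in> I" for \<Lambda>
    proof -
      have "(\<Sum>\<Lambda>\<in>I - {\<Lambda>}. val_integral \<nu> \<Lambda>) \<le> (\<Sum>\<Lambda>\<in>I - {\<Lambda>}. \<Lambda> x)"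
        using I x(2) by (intro sum_mono integral_le_approximant_Inter[OF lcc]) (auto simp: \<F>_def)
      then have "(\<Sum>\<Lambda>\<in>I - {\<Lambda>}. val_integral \<nu> \<Lambda>) + \<Lambda> x \<le> S x"
        unfolding S_def sum.remove[OF I(1) L] by (simp add: add.commute add_left_mono)
      also have "\<dots> \<le> (\<Sum>\<Lambda>\<in>I - {\<Lambda>}. val_integral \<nu> \<Lambda>) + val_integral \<nu> \<Lambda>"
        using x(1) S unfolding sum.remove[OF I(1) L] by (simp add: add.commute)
      finally have "(\<Sum>\<Lambda>\<in>I - {\<Lambda>}. val_integral \<nu> \<Lambda>) + \<Lambda> x \<le> (\<Sum>\<Lambda>\<in>I - {\<Lambda>}. val_integral \<nu> \<Lambda>) + val_integral \<nu> \<Lambda>" .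
      moreover have "(\<Sum>\<Lambda>\<in>I - {\<Lambda>}. val_integral \<nu> \<Lambda>) \<noteq> top" using I by (auto simp: \<F>_def less_top)
      ultimately show ?thesis by (simp only: ennreal_add_left_cancel_le infinity_ennreal_def) blast
    qed
    then show "approximant_Inter \<nu> \<inter> (\<Inter>\<Lambda>\<in>I. {x. \<Lambda> x \<le> val_integral \<nu> \<Lambda>}) \<noteq> {}" using x(2) by blast
  qed
  then obtain x where x: "x \<in> approximant_Inter \<nu>" "\<And>\<Lambda>. \<Lambda> \<in> \<F> \<Longrightarrow> \<Lambda> x \<le> val_integral \<nu> \<Lambda>" by blast
  have "\<Lambda> x = val_integral \<nu> \<Lambda>" if L: "\<Lambda> \<in> cone_dual" for \<Lambda>
  proof (rule antisym)
    show "\<Lambda> x \<le> val_integral \<nu> \<Lambda>"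
      using x(2)[of \<Lambda>] L by (cases "val_integral \<nu> \<Lambda> < top") (auto simp: \<F>_def less_top[symmetric])
    show "val_integral \<nu> \<Lambda> \<le> \<Lambda> x" by (rule integral_le_approximant_Inter[OF lcc L x(1)])
  qed
  then show ?thesis using x(1) by (auto simp: is_barycenter_def)
qed

lemma barycenter_unique: "is_barycenter \<nu> x \<Longrightarrow> is_barycenter \<nu> y \<Longrightarrow> x = y" for x y :: 'a
  by (rule cone_dual_eqI[OF lc]) (metis is_barycenter_def)

lemma barycenter_eqI: "is_barycenter \<nu> x \<Longrightarrow> barycenter \<nu> = x" for x :: 'a
  unfolding barycenter_def by (rule the_equality) (auto intro: barycenter_unique)

lemma is_barycenter_barycenter: "is_barycenter \<nu> (barycenter \<nu> :: 'a)"
  using barycenter_exists[of \<nu>] barycenter_eqI by metis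

lemma cone_dual_barycenter: "\<Lambda> \<in> cone_dual \<Longrightarrow> \<Lambda> (barycenter \<nu> :: 'a) = val_integral \<nu> \<Lambda>"
  using is_barycenter_barycenter by (simp add: is_barycenter_def)

text \<open>The neighbourhood of \<open>\<nu>\<close> is given by the Hall condition of an
  approximant inside \<open>V\<close>. It does not provide approximants of the nearby valuations, so
  convexity of \<open>V\<close> is used to return from functionals to points.\<close>

lemma continuous_on_barycenter: "continuous_on UNIV (barycenter :: 'a valuation \<Rightarrow> 'a)"
proof -
  have "open ((barycenter :: 'a valuation \<Rightarrow> 'a) -` S)" if S: "open S" for S
  proof (subst open_subopen, intro ballI)
    fix \<nu> :: "'a valuation" assume "\<nu> \<in> barycenter -` S"
    then have "barycenter \<nu> \<in> S" by simp
    then obtain V where V: "open V" "cone_convex V" "barycenter \<nu> \<in> V" "V \<subseteq> S"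
      using lc S unfolding locally_convex_def neighbourhood_base_of open_openin[symmetric] by blast
    have "approximant_Inter \<nu> \<subseteq> V"
    proof
      fix y assume y: "y \<in> approximant_Inter \<nu>"
      have "\<Lambda> (barycenter \<nu>) \<le> \<Lambda> y" if "\<Lambda> \<in> cone_dual" for \<Lambda>
        unfolding cone_dual_barycenter[OF that] by (rule integral_le_approximant_Inter[OF lcc that y])
      then show "y \<in> V" by (rule cone_dual_separates[OF lc _ V(1,3)])
    qed
    with V(1) obtain A where A: "approximant \<nu> A" "A \<subseteq> V" by (rule approximant_subset_open)
    obtain qs where qs: "A = weighted_sum qs" "\<forall>q\<in>set qs. 0 \<le> fst q \<and> compact (snd q)" "hall \<nu> qs"
      using approximant_hall[OF A(1)] by blast
    \<comment> \<open>A functional that separates the barycenter of \<open>\<mu>\<close> from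
      \<open>V\<close> would exceed 1 on all of \<open>A\<close>, whereas the Hall condition gives a
      point of \<open>A\<close> where it is at most its integral, that is, its value at the
      barycenter, which is at most 1.\<close>
    have "barycenter \<mu> \<in> V" if \<mu>: "hall \<mu> qs" for \<mu>
    proof (rule ccontr)
      assume "barycenter \<mu> \<notin> V"
      then obtain \<Lambda> where L: "\<Lambda> \<in> cone_dual" "\<Lambda> (barycenter \<mu>) \<le> 1" "\<And>y. y \<in> V \<Longrightarrow> 1 < \<Lambda> y"
        using separation[OF V(1,2)] by blast
      obtain x where x: "x \<in> A" "\<Lambda> x \<le> val_integral \<mu> \<Lambda>"
        using hall_imp_le_integral[OF L(1) qs(2) \<mu>] qs(1) by blast
      have "1 < \<Lambda> x" using x(1) A(2) L(3) by blast
      then show False using x(2) L(2) cone_dual_barycenter[OF L(1)] by simp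
    qed
    then show "\<exists>T. open T \<and> \<nu> \<in> T \<and> T \<subseteq> barycenter -` S"
      using open_hall[of qs] qs(3) V(4) by (intro exI[of _ "{\<mu>. hall \<mu> qs}"]) auto
  qed
  then show ?thesis by (simp add: continuous_on_open_vimage)
qed

section \<open>The barycenter algebra\<close>

text \<open>Functionals separate points, so each law can be tested under the integral. For
  associativity both sides become the integral over \<open>\<phi>\<close> of the function that sends
  \<open>\<nu>\<close> to \<open>val_integral \<nu> \<Lambda>\<close>.\<close>

lemma Vw_algebra_barycenter: "Vw_algebra (barycenter :: 'a valuation \<Rightarrow> 'a)"
  unfolding Vw_algebra_def
proof (intro conjI ext)
  show "continuous_on UNIV (barycenter :: 'a valuation \<Rightarrow> 'a)" by (rule continuous_on_barycenter)
  show "(barycenter \<circ> dirac) x = id x" for x :: 'a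
    by (simp add: barycenter_eqI is_barycenter_def val_integral_dirac cone_dualD(1))
  fix \<phi> :: "'a valuation valuation"
  have "\<Lambda> (barycenter (val_map barycenter \<phi>) :: 'a) = val_integral (val_join \<phi>) \<Lambda>" if L: "\<Lambda> \<in> cone_dual" for \<Lambda>
    using cone_dualD(1)[OF L] continuous_on_barycenter
    by (simp add: cone_dual_barycenter[OF L] val_integral_map val_integral_join o_def)
  then show "(barycenter \<circ> val_map barycenter) \<phi> = ((barycenter :: 'a valuation \<Rightarrow> 'a) \<circ> val_join) \<phi>"
    by (simp add: is_barycenter_def barycenter_eqI[symmetric])
qed

lemma induces_cone_barycenter: "induces_cone (barycenter :: 'a valuation \<Rightarrow> 'a)"
  unfolding induces_cone_def
proof (intro conjI allI impI)
  show "x + y = barycenter (dirac x + dirac y)" for x y :: 'a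
    by (rule barycenter_eqI[symmetric])
      (simp add: is_barycenter_def val_integral_plus val_integral_dirac cone_dualD)
  show "a \<cdot> x = barycenter (a \<cdot> dirac x)" if "0 \<le> a" for a and x :: 'a
    using that by (intro barycenter_eqI[symmetric])
      (simp add: is_barycenter_def val_integral_cscale val_integral_dirac cone_dualD)
qed

end

text \<open>An algebra is a linear map, so composing it with \<open>\<Lambda> \<in> cone_dual\<close> gives a functional to which
  the Schroeder-Simpson theorem applies.\<close>

lemma Vw_algebra_is_barycenter:
  fixes \<alpha> :: "'a::topological_cone valuation \<Rightarrow> 'a"
  assumes alg: "Vw_algebra \<alpha>" and ind: "induces_cone \<alpha>"
  shows "is_barycenter \<nu> (\<alpha> \<nu>)"
  unfolding is_barycenter_def
proof
  fix \<Lambda> :: "'a \<Rightarrow> ennreal" assume L: "\<Lambda> \<in> cone_dual"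
  have cont: "continuous_on UNIV \<alpha>" and unit: "\<alpha> (dirac x) = x" and
    assoc: "\<alpha> (val_map \<alpha> \<phi>) = \<alpha> (val_join \<phi>)" for x \<phi>
    using alg unfolding Vw_algebra_def by (auto simp: fun_eq_iff)
  have add: "\<alpha> (\<mu> + \<nu>) = \<alpha> \<mu> + \<alpha> \<nu>" for \<mu> \<nu>
    using assoc[of "dirac \<mu> + dirac \<nu>"] ind
    by (simp add: val_map_plus val_map_dirac cont val_join_plus val_join_dirac induces_cone_def)
  have scale: "\<alpha> (a \<cdot> \<nu>) = a \<cdot> \<alpha> \<nu>" if "0 \<le> a" for a \<nu>
    using assoc[of "a \<cdot> dirac \<nu>"] ind that
    by (simp add: val_map_cscale val_map_dirac cont val_join_cscale val_join_dirac induces_cone_def)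
  have "lsc (\<lambda>\<nu>. \<Lambda> (\<alpha> \<nu>))"
  proof -
    have "open (\<alpha> -` {x. c < \<Lambda> x})" for c
      using cont cone_dualD(1)[OF L] by (intro open_vimage) (simp_all add: lsc_iff)
    then show ?thesis by (simp add: lsc_iff vimage_def)
  qed
  from linear_eq_integral[OF this, of \<nu>] show "\<Lambda> (\<alpha> \<nu>) = val_integral \<nu> \<Lambda>"
    by (simp add: add scale unit cone_dualD[OF L])
qed

theorem theorem3p4:
  assumes "locally_convex TYPE('a::topological_cone)"
    and "locally_convex_compact TYPE('a)"
    and "sober TYPE('a)"
  shows "(\<forall>\<nu>::'a valuation. \<exists>!x. is_barycenter \<nu> x) \<and>
    continuous_on UNIV (barycenter :: 'a valuation \<Rightarrow> 'a) \<and>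
    Vw_algebra (barycenter :: 'a valuation \<Rightarrow> 'a) \<and>
    induces_cone (barycenter :: 'a valuation \<Rightarrow> 'a) \<and>
    (\<forall>\<alpha>::'a valuation \<Rightarrow> 'a. Vw_algebra \<alpha> \<and> induces_cone \<alpha> \<longrightarrow> \<alpha> = barycenter)"
proof (intro conjI allI impI)
  show "\<exists>!x. is_barycenter \<nu> x" for \<nu> :: "'a valuation"
    using is_barycenter_barycenter[OF assms] barycenter_unique[OF assms] by blast
  show "continuous_on UNIV (barycenter :: 'a valuation \<Rightarrow> 'a)" by (rule continuous_on_barycenter[OF assms])
  show "Vw_algebra (barycenter :: 'a valuation \<Rightarrow> 'a)" by (rule Vw_algebra_barycenter[OF assms])
  show "induces_cone (barycenter :: 'a valuation \<Rightarrow> 'a)" by (rule induces_cone_barycenter[OF assms])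
  show "\<alpha> = barycenter" if "Vw_algebra \<alpha> \<and> induces_cone \<alpha>" for \<alpha> :: "'a valuation \<Rightarrow> 'a"
  proof
    fix \<nu>
    have "is_barycenter \<nu> (\<alpha> \<nu>)" using that by (intro Vw_algebra_is_barycenter) simp_all
    then show "\<alpha> \<nu> = barycenter \<nu>" by (rule barycenter_eqI[OF assms, symmetric])
  qed
qed

end
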